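(* Let $0<q\leq 1$, let $Q$ be an origin-symmetric star body in $\mathbb{R}^n$, and let $\mu$ be a finite even Borel measure on $\mathbb{S}^{n-1}$. Then there exists an origin-symmetric convex body $K$ in $\mathbb{R}^n$ such that $\widetilde{C}_q(K,Q,\cdot)=\mu$ if and only if $\mu$ is not concentrated on any great sub-sphere of $\mathbb{S}^{n-1}$.
   Context: $\mathbb{S}^{n-1}$ is the unit sphere of $\mathbb{R}^n$ and $du$ is the standard surface measure on it. A star body is a compact set $Q\subset\mathbb{R}^n$, star-shaped with respect to the origin (the segment joining any point of $Q$ to the origin lies in $Q$), whose radial function $\rho_Q(u)=\max\{\lambda:\lambda u\in Q\}$, $u\in\mathbb{S}^{n-1}$, is positive and continuous. A convex body is a compact convex set with non-empty interior; an origin-symmetric convex body contains the origin in its interior and is a star body. A measure on $\mathbb{S}^{n-1}$ is even if it takes the same value on antipodal measurable subsets $\eta$ and $-\eta$. A great sub-sphere is a set $\mathbb{S}^{n-1}\cap\xi$ with $\xi$ a proper linear subspace of $\mathbb{R}^n$; $\mu$ is concentrated on a Borel set $S$ if $\mu(\mathbb{S}^{n-1}\setminus S)=0$ (in particular the zero measure is concentrated on every such $S$). For $q\in\mathbb{R}$, a star body $Q$, and a convex body $K$ containing the origin in its interior, the generalized $q$-th dual curvature measure is the Borel measure on $\mathbb{S}^{n-1}$ $$\widetilde{C}_q(K,Q,\eta)=\frac1n\int_{\boldsymbol{\alpha}_K^*(\eta)}\rho_K^q(u)\rho_Q^{n-q}(u)\,du,\qquad \eta\subset\mathbb{S}^{n-1}\text{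 Borel},$$ where $\boldsymbol{\alpha}_K^*(\eta)=\{u\in\mathbb{S}^{n-1}:\rho_K(u)u\in\nu_K^{-1}(\eta)\}$ and $\nu_K^{-1}(\eta)$ is the set of boundary points of $K$ having an outer unit normal vector belonging to $\eta$. *)

theory Defs
  imports "HOL-Analysis.Analysis"
begin

definition sphere_borel :: "'a::euclidean_space measure" where
  "sphere_borel = restrict_space borel (sphere 0 1)"

text \<open>
  The standard surface measure, obtained from polar coordinates: the measure of \<open>A\<close> is
  \<open>n\<close> times the volume of the cone over \<open>A\<close> inside the unit ball
  (see \<open>emeasure_surface_measure\<close> below). It is completed because the set
  \<open>reverse_radial_gauss_image K \<eta>\<close> is in general only Borel up to a null set when
  \<open>\<eta>\<close> is Borel.
\<close>

definition surface_measure :: "'a::euclidean_space measure" where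
  "surface_measure = completion (scale_measure (of_nat DIM('a))
     (distr (restrict_space lborel (ball 0 1 - {0})) sphere_borel sgn))"

lemma emeasure_surface_measure:
  fixes A :: "'a::euclidean_space set"
  assumes "A \<in> sets sphere_borel"
  shows "emeasure surface_measure A =
    of_nat DIM('a) * emeasure lborel {x. x \<noteq> 0 \<and> norm x < 1 \<and> sgn x \<in> A}"
proof -
  let ?B = "ball (0::'a) 1 - {0}"
  have m: "sgn \<in> measurable (restrict_space lborel ?B) sphere_borel"
    unfolding sphere_borel_def
  proof (rule measurable_restrict_space2)
    show "sgn \<in> space (restrict_space lborel ?B) \<rightarrow> sphere 0 1"
      by (auto simp: space_restrict_space norm_sgn)
    show "sgn \<in> borel_measurable (restrict_space lborel ?B)"
      by (rule measurable_restrict_space1) (simp add: sgn_div_norm[abs_def])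
  qed
  have "emeasure surface_measure A = of_nat DIM('a) *
      emeasure (restrict_space lborel ?B) (sgn -` A \<inter> ?B)"
    using assms m
    by (simp add: surface_measure_def emeasure_distr space_restrict_space)
  also have "emeasure (restrict_space lborel ?B) (sgn -` A \<inter> ?B) =
      emeasure lborel (sgn -` A \<inter> ?B)"
    by (rule emeasure_restrict_space) auto
  also have "sgn -` A \<inter> ?B = {x. x \<noteq> 0 \<and> norm x < 1 \<and> sgn x \<in> A}"
    by auto
  finally show ?thesis .
qed

text \<open>Only used for compact sets containing the origin, where the supremum is a maximum.\<close>

definition radial_function :: "'a::euclidean_space set \<Rightarrow> 'a \<Rightarrow> real" where
  "radial_function Q u = Sup {t. t *\<^sub>R u \<in> Q}"

text \<open>
  The condition \<open>0 \<in> Q\<close> only excludes the empty set, for which the maximum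
  defining the radial function does not exist.
\<close>

definition star_body :: "'a::euclidean_space set \<Rightarrow> bool" where
  "star_body Q \<longleftrightarrow> compact Q \<and> 0 \<in> Q \<and> (\<forall>x\<in>Q. closed_segment 0 x \<subseteq> Q) \<and>
     (\<forall>u\<in>sphere 0 1. 0 < radial_function Q u) \<and>
     continuous_on (sphere 0 1) (radial_function Q)"

definition convex_body :: "'a::euclidean_space set \<Rightarrow> bool" where
  "convex_body K \<longleftrightarrow> compact K \<and> convex K \<and> interior K \<noteq> {}"

definition origin_symmetric :: "'a::euclidean_space set \<Rightarrow> bool" where
  "origin_symmetric K \<longleftrightarrow> uminus ` K = K"

definition outer_unit_normal :: "'a::euclidean_space set \<Rightarrow> 'a \<Rightarrow> 'a \<Rightarrow> bool" where
  "outer_unit_normal K x v \<longleftrightarrow> norm v = 1 \<and> (\<forall>y\<in>K. y \<bullet> v \<le> x \<bullet> v)"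

definition inverse_gauss_image :: "'a::euclidean_space set \<Rightarrow> 'a set \<Rightarrow> 'a set" where
  "inverse_gauss_image K \<eta> = {x \<in> frontier K. \<exists>v\<in>\<eta>. outer_unit_normal K x v}"

definition reverse_radial_gauss_image :: "'a::euclidean_space set \<Rightarrow> 'a set \<Rightarrow> 'a set" where
  "reverse_radial_gauss_image K \<eta> =
     {u \<in> sphere 0 1. radial_function K u *\<^sub>R u \<in> inverse_gauss_image K \<eta>}"

text \<open>The generalized dual curvature measure, as a set function on the Borel subsets of the sphere.\<close>

definition dual_curvature_measure ::
    "real \<Rightarrow> 'a::euclidean_space set \<Rightarrow> 'a set \<Rightarrow> 'a set \<Rightarrow> ennreal" where
  "dual_curvature_measure q K Q \<eta> = ennreal (1 / real DIM('a)) *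
     (\<integral>\<^sup>+u\<in>reverse_radial_gauss_image K \<eta>.
        ennreal (radial_function K u powr q * radial_function Q u powr (real DIM('a) - q))
      \<partial>surface_measure)"

definition even_measure :: "'a::euclidean_space measure \<Rightarrow> bool" where
  "even_measure \<mu> \<longleftrightarrow> (\<forall>\<eta>\<in>sets \<mu>. emeasure \<mu> (uminus ` \<eta>) = emeasure \<mu> \<eta>)"

definition great_subsphere :: "'a::euclidean_space set \<Rightarrow> bool" where
  "great_subsphere S \<longleftrightarrow> (\<exists>\<xi>. subspace \<xi> \<and> \<xi> \<noteq> UNIV \<and> S = sphere 0 1 \<inter> \<xi>)"

definition concentrated_on :: "'a::euclidean_space measure \<Rightarrow> 'a set \<Rightarrow> bool" where
  "concentrated_on \<mu> S \<longleftrightarrow> emeasure \<mu> (sphere 0 1 - S) = 0"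

end

(*
  Write h = exp f for a positive even function on the sphere. The gauge of the Wulff shape of h is
  N(x) = max over unit v of (x . v) / h(v), so its radial function is 1 / N. With the weight
  rho_Q^(n-q) / n absorbed into a measure M, the body is found by maximising the scaling invariant
  functional
    F(f) = (1/q) ln (integral of N^(-q) dM) - (mean of f with respect to mu).

  Existence of a maximiser: replacing h by the support function of its Wulff shape, normalised to
  circumradius 1, does not decrease F. If this support function has minimum eps, the body lies in a
  slab of width eps, and since q <= 1 the first term is at most (s/q) ln eps + C_s for every s < q.
  As mu is not concentrated on a great subsphere, the mean of |x . v| is at least m > 0 uniformly in x,
  and concavity of ln bounds the second term by about (1 - m) |ln eps|. Hence F is small for small eps,
  and Arzela-Ascoli applies to the remaining functions.

  Euler-Lagrange equation: the outer normal of the Wulff shape in direction u is the maximising v in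
  the definition of N(u). It is unique for almost every u because the convex function N is
  differentiable almost everywhere, so Danskin's theorem differentiates F(f + t g). The resulting
  identity holds for all even g and hence identifies the two even measures.

  Conversely, if xi is orthogonal to v, then no outer normal at a boundary point in a direction close
  to v lies in xi.
*)

theory Submission
  imports Defs "HOL-Complex_Analysis.Great_Picard"
begin

section \<open>The gauge of a Wulff shape\<close>

text \<open>Where \<open>q \<le> 1\<close> enters: a slab of width eps bounds the first integral by
  that of min(1, eps / |u . v|)^q. For q > 1 this is in general only of order eps, so the first term
  falls off like (1/q) ln eps, too weak against a mean bounded below only by about (1 - m) ln eps
  when m is small. For q < 1 the integral is of order eps^q. At q = 1 a logarithm appears, since |u
  . v|^(-1) is not integrable; lowering the exponent to s < q removes it, and the slack m pays for
  the loss. Working with f = ln h makes positivity automatic, turns dilations into additive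
  constants and makes the competitors a linear space, so that every direction g may be tested in the
  first variation. Evenness is used twice: one small support value bounds the body from both sides,
  and the Euler-Lagrange equation, known for even test functions only, still determines an even
  measure. Differentiability almost everywhere rests on an integral estimate for second differences,
  which needs only that N is Lipschitz and midpoint convex.\<close>

definition wulff_gauge :: "('a::euclidean_space \<Rightarrow> real) \<Rightarrow> 'a \<Rightarrow> real" where
  "wulff_gauge f x = (SUP v\<in>sphere 0 1. (x \<bullet> v) * exp (- f v))"

lemma sphere_nonempty [simp]: "sphere (0::'a::euclidean_space) 1 \<noteq> {}"
  using sphere_eq_empty by (metis not_one_less_zero)

lemma wulff_gauge_attained:
  fixes f :: "'a::euclidean_space \<Rightarrow> real"
  assumes "continuous_on (sphere 0 1) f"
  obtains v where "v \<in> sphere 0 1" "wulff_gauge f x = (x \<bullet> v) * exp (- f v)"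
    "\<And>w. w \<in> sphere 0 1 \<Longrightarrow> (x \<bullet> w) * exp (- f w) \<le> wulff_gauge f x"
proof -
  have "continuous_on (sphere 0 1) (\<lambda>v. (x \<bullet> v) * exp (- f v))"
    by (intro continuous_intros assms)
  from continuous_attains_sup[OF compact_sphere sphere_nonempty this]
  obtain v where v: "v \<in> sphere 0 1"
    "\<forall>w\<in>sphere 0 1. (x \<bullet> w) * exp (- f w) \<le> (x \<bullet> v) * exp (- f v)"
    by blast
  have "wulff_gauge f x = (x \<bullet> v) * exp (- f v)"
    unfolding wulff_gauge_def by (rule cSup_eq_maximum) (use v in auto)
  then show thesis using that v by auto
qed

lemma wulff_gauge_ge:
  assumes "continuous_on (sphere 0 1) f" "v \<in> sphere 0 1"
  shows "(x \<bullet> v) * exp (- f v) \<le> wulff_gauge f x"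
  using wulff_gauge_attained[OF assms(1)] assms(2) by metis

lemma wulff_gauge_le:
  assumes "continuous_on (sphere 0 1) f"
    and "\<And>v. v \<in> sphere 0 1 \<Longrightarrow> (x \<bullet> v) * exp (- f v) \<le> c"
  shows "wulff_gauge f x \<le> c"
  using wulff_gauge_attained[OF assms(1), of x] assms(2) by metis

lemma wulff_gauge_scale:
  assumes "continuous_on (sphere 0 1) f" "0 \<le> c"
  shows "wulff_gauge f (c *\<^sub>R x) = c * wulff_gauge f x"
proof -
  obtain v where v: "v \<in> sphere 0 1" "wulff_gauge f x = (x \<bullet> v) * exp (- f v)"
    using wulff_gauge_attained[OF assms(1)] by metis
  have "c * wulff_gauge f x \<le> wulff_gauge f (c *\<^sub>R x)"
    using wulff_gauge_ge[OF assms(1) v(1), of "c *\<^sub>R x"] v(2) by (simp add: mult.assoc)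
  moreover have "wulff_gauge f (c *\<^sub>R x) \<le> c * wulff_gauge f x"
    by (rule wulff_gauge_le[OF assms(1)])
       (use mult_left_mono[OF wulff_gauge_ge[OF assms(1)] assms(2)] in \<open>simp add: mult.assoc\<close>)
  ultimately show ?thesis by simp
qed

lemma wulff_gauge_add:
  assumes "continuous_on (sphere 0 1) f"
  shows "wulff_gauge f (x + y) \<le> wulff_gauge f x + wulff_gauge f y"
proof (rule wulff_gauge_le[OF assms])
  fix v :: 'a assume v: "v \<in> sphere 0 1"
  show "((x + y) \<bullet> v) * exp (- f v) \<le> wulff_gauge f x + wulff_gauge f y"
    using wulff_gauge_ge[OF assms v, of x] wulff_gauge_ge[OF assms v, of y]
    by (simp add: inner_add_left distrib_right)
qed

lemma wulff_gauge_le_norm: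
  assumes "continuous_on (sphere 0 1) f" "\<And>v. v \<in> sphere 0 1 \<Longrightarrow> a \<le> f v"
  shows "wulff_gauge f x \<le> exp (- a) * norm x"
proof (rule wulff_gauge_le[OF assms(1)])
  fix v :: 'a assume v: "v \<in> sphere 0 1"
  have "(x \<bullet> v) * exp (- f v) \<le> norm x * exp (- f v)"
    using v norm_cauchy_schwarz[of x v] by (intro mult_right_mono) auto
  also have "\<dots> \<le> norm x * exp (- a)" using assms(2)[OF v] by (intro mult_left_mono) auto
  finally show "(x \<bullet> v) * exp (- f v) \<le> exp (- a) * norm x" by (simp add: mult.commute)
qed

lemma wulff_gauge_ge_norm:
  assumes "continuous_on (sphere 0 1) f" "\<And>v. v \<in> sphere 0 1 \<Longrightarrow> f v \<le> b"
  shows "exp (- b) * norm x \<le> wulff_gauge f x"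
proof (cases "x = 0")
  case True
  then show ?thesis using wulff_gauge_scale[OF assms(1), of 0 0] by simp
next
  case False
  then have s: "sgn x \<in> sphere 0 1" by (simp add: norm_sgn)
  have e: "x \<bullet> sgn x = norm x"
    by (simp add: sgn_div_norm power2_norm_eq_inner[symmetric] power2_eq_square False
        flip: divide_inverse_commute)
  have "exp (- b) * norm x \<le> (x \<bullet> sgn x) * exp (- f (sgn x))"
    unfolding e using assms(2)[OF s] by (subst mult.commute, intro mult_left_mono) auto
  also have "\<dots> \<le> wulff_gauge f x" by (rule wulff_gauge_ge[OF assms(1) s])
  finally show ?thesis .
qed

lemma continuous_on_sphere_bounded:
  fixes f :: "'a::euclidean_space \<Rightarrow> real"
  assumes "continuous_on (sphere 0 1) f"
  obtains B where "0 < B" "\<And>v. v \<in> sphere 0 1 \<Longrightarrow> \<bar>f v\<bar> \<le> B"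
proof -
  have "bounded (f ` sphere 0 1)"
    by (intro compact_imp_bounded compact_continuous_image assms compact_sphere)
  then show thesis using that unfolding bounded_pos by auto
qed

lemma wulff_gauge_pos:
  assumes "continuous_on (sphere 0 1) f" "x \<noteq> 0"
  shows "0 < wulff_gauge f x"
proof -
  obtain B where B: "0 < B" "\<And>v. v \<in> sphere 0 1 \<Longrightarrow> \<bar>f v\<bar> \<le> B"
    using continuous_on_sphere_bounded[OF assms(1)] by blast
  have "0 < exp (- B) * norm x" using assms by simp
  also have "\<dots> \<le> wulff_gauge f x"
    by (rule wulff_gauge_ge_norm[OF assms(1)]) (use B in force)
  finally show ?thesis .
qed

lemma wulff_gauge_zero [simp]:
  assumes "continuous_on (sphere 0 1) f"
  shows "wulff_gauge f 0 = 0"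
  using wulff_gauge_scale[OF assms, of 0 0] by simp

lemma wulff_gauge_nonneg:
  assumes "continuous_on (sphere 0 1) f"
  shows "0 \<le> wulff_gauge f x"
  using wulff_gauge_pos[OF assms, of x] wulff_gauge_zero[OF assms] by (cases "x = 0") auto

lemma wulff_gauge_uminus:
  assumes "continuous_on (sphere 0 1) f" "\<And>v. v \<in> sphere 0 1 \<Longrightarrow> f (- v) = f v"
  shows "wulff_gauge f (- x) = wulff_gauge f x"
proof -
  have "wulff_gauge f (- x) \<le> wulff_gauge f x" for x
  proof (rule wulff_gauge_le[OF assms(1)])
    fix v :: 'a assume v: "v \<in> sphere 0 1"
    then show "(- x \<bullet> v) * exp (- f v) \<le> wulff_gauge f x"
      using wulff_gauge_ge[OF assms(1), of "- v" x] assms(2)[OF v] by simp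
  qed
  from this[of x] this[of "- x"] show ?thesis by simp
qed

lemma wulff_gauge_lipschitz:
  fixes f :: "'a::euclidean_space \<Rightarrow> real"
  assumes "continuous_on (sphere 0 1) f"
  obtains L where "0 < L" "\<And>x y. \<bar>wulff_gauge f x - wulff_gauge f y\<bar> \<le> L * norm (x - y)"
proof -
  obtain B where B: "0 < B" "\<And>v. v \<in> sphere 0 1 \<Longrightarrow> \<bar>f v\<bar> \<le> B"
    using continuous_on_sphere_bounded[OF assms(1)] by blast
  have le: "wulff_gauge f x \<le> exp B * norm x" for x
    using wulff_gauge_le_norm[OF assms, of "- B" x] B by force
  have "wulff_gauge f x - wulff_gauge f y \<le> exp B * norm (x - y)" for x y
    using wulff_gauge_add[OF assms, of "x - y" y] le[of "x - y"] by simp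
  from this this[of y x for x y] have "\<bar>wulff_gauge f x - wulff_gauge f y\<bar> \<le> exp B * norm (x - y)" for x y
    by (smt (verit) norm_minus_commute)
  then show thesis using that[of "exp B"] by simp
qed

lemma continuous_on_wulff_gauge:
  fixes f :: "'a::euclidean_space \<Rightarrow> real"
  assumes "continuous_on (sphere 0 1) f"
  shows "continuous_on A (wulff_gauge f)"
proof -
  obtain L where L: "0 < L" "\<And>x y. \<bar>wulff_gauge f x - wulff_gauge f y\<bar> \<le> L * norm (x - y)"
    using wulff_gauge_lipschitz[OF assms] by blast
  have "L-lipschitz_on UNIV (wulff_gauge f)"
    using L by (auto intro!: lipschitz_onI simp: dist_norm)
  then show ?thesis using lipschitz_on_continuous_on continuous_on_subset by blast
qed

lemma wulff_gauge_mono: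
  assumes "continuous_on (sphere 0 1) f" "continuous_on (sphere 0 1) g"
    and "\<And>v. v \<in> sphere 0 1 \<Longrightarrow> f v \<le> g v + d"
  shows "wulff_gauge g x \<le> exp d * wulff_gauge f x"
proof -
  obtain v where v: "v \<in> sphere 0 1" "wulff_gauge g x = (x \<bullet> v) * exp (- g v)"
    using wulff_gauge_attained[OF assms(2)] by metis
  \<comment> \<open>The comparison of exponentials can be multiplied by x . v only if this is
    nonnegative; a maximiser has this property because the gauge is nonnegative.\<close>
  have "(x \<bullet> v) * exp (- g v) \<ge> 0" using wulff_gauge_nonneg[OF assms(2), of x] v by simp
  then have nn: "x \<bullet> v \<ge> 0" by (simp add: zero_le_mult_iff)
  have "wulff_gauge g x \<le> (x \<bullet> v) * exp (d - f v)"
    unfolding v(2) using assms(3)[OF v(1)] nn by (intro mult_left_mono) auto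
  also have "\<dots> = exp d * ((x \<bullet> v) * exp (- f v))" by (simp add: exp_diff exp_minus divide_inverse)
  also have "\<dots> \<le> exp d * wulff_gauge f x"
    using wulff_gauge_ge[OF assms(1) v(1)] by (intro mult_left_mono) auto
  finally show ?thesis .
qed

section \<open>Almost everywhere uniqueness of subgradients\<close>

lemma integral_lborel_translate:
  fixes f :: "'a::euclidean_space \<Rightarrow> real"
  assumes "f \<in> borel_measurable borel"
  shows "(\<integral>x. f (x + c) \<partial>lborel) = (\<integral>x. f x \<partial>lborel)"
proof -
  have "(\<integral>x. f x \<partial>lborel) = (\<integral>x. f x \<partial>distr lborel borel ((+) c))"
    by (simp add: lborel_distr_plus)
  also have "\<dots> = (\<integral>x. f (c + x) \<partial>lborel)"
    by (rule integral_distr) (use assms in auto)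
  finally show ?thesis by (simp add: add.commute)
qed

lemma integrable_continuous_compact_support:
  fixes f :: "'a::euclidean_space \<Rightarrow> real"
  assumes "continuous_on UNIV f" "\<And>x. r < norm x \<Longrightarrow> f x = 0"
  shows "integrable lborel f"
proof -
  have "integrable lborel (\<lambda>x. indicator (cball 0 r) x *\<^sub>R f x)"
    by (intro borel_integrable_compact compact_cball continuous_on_subset[OF assms(1)]) auto
  also have "(\<lambda>x. indicator (cball 0 r) x *\<^sub>R f x) = f"
    using assms(2) by (auto simp: fun_eq_iff indicator_def not_le)
  finally show ?thesis .
qed

text \<open>
  For a convex function \<open>N\<close> these are the points of differentiability. In this form the set is
  visibly Borel and invariant under positive scaling if \<open>N\<close> is positively homogeneous.
\<close>

definition smooth_points :: "('a::euclidean_space \<Rightarrow> real) \<Rightarrow> 'a set" where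
  "smooth_points N = {x. \<forall>e\<in>Basis. \<forall>m::nat. \<exists>t>0.
     N (x + t *\<^sub>R e) + N (x - t *\<^sub>R e) - 2 * N x < t / real (Suc m)}"

lemma open_smooth_approx:
  fixes N :: "'a::euclidean_space \<Rightarrow> real"
  assumes "continuous_on UNIV N"
  shows "open {x. \<exists>t>0. N (x + t *\<^sub>R e) + N (x - t *\<^sub>R e) - 2 * N x < t / c}"
proof -
  have "open {x. N (x + t *\<^sub>R e) + N (x - t *\<^sub>R e) - 2 * N x < t / c}" for t
    by (intro open_Collect_less continuous_intros continuous_on_compose2[OF assms]) auto
  then have "open (\<Union>t\<in>{0<..}. {x. N (x + t *\<^sub>R e) + N (x - t *\<^sub>R e) - 2 * N x < t / c})"
    by blast
  also have "(\<Union>t\<in>{0<..}. {x. N (x + t *\<^sub>R e) + N (x - t *\<^sub>R e) - 2 * N x < t / c}) =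
    {x. \<exists>t>0. N (x + t *\<^sub>R e) + N (x - t *\<^sub>R e) - 2 * N x < t / c}"
    by auto
  finally show ?thesis .
qed

lemma smooth_points_borel:
  fixes N :: "'a::euclidean_space \<Rightarrow> real"
  assumes "continuous_on UNIV N"
  shows "smooth_points N \<in> sets borel"
proof -
  have "smooth_points N = (\<Inter>e\<in>Basis. \<Inter>m::nat.
    {x. \<exists>t>0. N (x + t *\<^sub>R e) + N (x - t *\<^sub>R e) - 2 * N x < t / real (Suc m)})"
    by (auto simp: smooth_points_def)
  also have "\<dots> \<in> sets borel"
    by (intro sets.countable_INT'' sets.finite_INT borel_open open_smooth_approx assms)
       (auto simp: assms borel_open open_smooth_approx)
  finally show ?thesis .
qed

lemma smooth_points_scale:
  assumes "\<And>c x. 0 < c \<Longrightarrow> N (c *\<^sub>R x) = c * N x" "0 < c" "x \<in> smooth_points N"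
  shows "c *\<^sub>R x \<in> smooth_points N"
  unfolding smooth_points_def
proof (intro CollectI ballI allI)
  fix e :: 'a and m :: nat assume "e \<in> Basis"
  with assms(3) obtain t where t: "t > 0"
    "N (x + t *\<^sub>R e) + N (x - t *\<^sub>R e) - 2 * N x < t / real (Suc m)"
    unfolding smooth_points_def by blast
  have "N (c *\<^sub>R x + (c * t) *\<^sub>R e) + N (c *\<^sub>R x - (c * t) *\<^sub>R e) - 2 * N (c *\<^sub>R x) =
     c * (N (x + t *\<^sub>R e) + N (x - t *\<^sub>R e) - 2 * N x)"
    using assms(1)[OF assms(2), of "x + t *\<^sub>R e"] assms(1)[OF assms(2), of "x - t *\<^sub>R e"]
      assms(1)[OF assms(2), of x]
    by (simp add: algebra_simps)
  also have "\<dots> < c * (t / real (Suc m))" using t assms(2) by (intro mult_strict_left_mono) auto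
  finally show "\<exists>t>0. N (c *\<^sub>R x + t *\<^sub>R e) + N (c *\<^sub>R x - t *\<^sub>R e) - 2 * N (c *\<^sub>R x) < t / real (Suc m)"
    using t assms(2) by (intro exI[of _ "c * t"]) auto
qed

lemma smooth_points_uminus:
  assumes "\<And>x. N (- x) = N x" "x \<in> smooth_points N"
  shows "- x \<in> smooth_points N"
proof -
  have "N (- x + y) = N (x - y)" "N (- x - y) = N (x + y)" for y
    using assms(1)[of "x - y"] assms(1)[of "x + y"] by (simp_all add: algebra_simps)
  with assms(1)[of x] assms(2) show ?thesis
    unfolding smooth_points_def by (simp add: add.commute)
qed

text \<open>Inserting one subgradient at x + t e and the other at x - t e bounds the second
  difference of \<open>N\<close> from below by t times the difference of their e-components, for
  every t. At a smooth point this beats any positive difference once m is large.\<close>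

lemma smooth_points_unique_subgradient:
  assumes "x \<in> smooth_points N"
    and "p \<bullet> x = N x" "\<And>y. p \<bullet> y \<le> N y"
    and "p' \<bullet> x = N x" "\<And>y. p' \<bullet> y \<le> N y"
  shows "p = p'"
proof (rule euclidean_eqI)
  fix e :: 'a assume e: "e \<in> Basis"
  have le: "a \<bullet> e \<le> b \<bullet> e" if a: "a \<bullet> x = N x" "\<And>y. a \<bullet> y \<le> N y"
    and b: "b \<bullet> x = N x" "\<And>y. b \<bullet> y \<le> N y" for a b
  proof (rule ccontr)
    assume "\<not> a \<bullet> e \<le> b \<bullet> e"
    then obtain m where m: "inverse (real (Suc m)) < a \<bullet> e - b \<bullet> e"
      using reals_Archimedean[of "a \<bullet> e - b \<bullet> e"] by auto
    obtain t where t: "t > 0" "N (x + t *\<^sub>R e) + N (x - t *\<^sub>R e) - 2 * N x < t / real (Suc m)"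
      using assms(1) e unfolding smooth_points_def by blast
    have "t * (a \<bullet> e - b \<bullet> e) \<le> N (x + t *\<^sub>R e) + N (x - t *\<^sub>R e) - 2 * N x"
      using a(1) b(1) a(2)[of "x + t *\<^sub>R e"] b(2)[of "x - t *\<^sub>R e"] by (simp add: algebra_simps inner_add_right inner_diff_right)
    with t(2) have "t * (a \<bullet> e - b \<bullet> e) < t * inverse (real (Suc m))"
      by (simp add: divide_inverse)
    with t(1) m show False by simp
  qed
  show "p \<bullet> e = p' \<bullet> e" using le[of p p'] le[of p' p] assms by force
qed

text \<open>
  Moving one difference from \<open>N\<close> onto the Lipschitz cut-off \<open>\<psi>\<close> by translation shows that the
  integral of \<open>\<psi>\<close> times the second difference of \<open>N\<close> of step \<open>t\<close> is only \<open>O(t\<^sup>2)\<close>.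
\<close>

lemma second_difference_integral_le:
  fixes N :: "'a::euclidean_space \<Rightarrow> real"
  assumes lip: "\<And>x y. \<bar>N x - N y\<bar> \<le> L * norm (x - y)" and "norm e = 1"
  obtains C where "\<And>t. 0 < t \<Longrightarrow> t \<le> 1 \<Longrightarrow>
    integrable lborel (\<lambda>x. max 0 (R - norm x) * (N (x + t *\<^sub>R e) + N (x - t *\<^sub>R e) - 2 * N x)) \<and>
    (\<integral>x. max 0 (R - norm x) * (N (x + t *\<^sub>R e) + N (x - t *\<^sub>R e) - 2 * N x) \<partial>lborel) \<le> C * t\<^sup>2"
proof
  fix t :: real assume t: "0 < t" "t \<le> 1"
  define \<psi> where "\<psi> x = max 0 (R - norm x)" for x :: 'a
  \<comment> \<open>The extra 1 accommodates the shift by a vector of length t \<le> 1: outside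
    radius \<open>r\<close> both \<open>\<psi>\<close> and its translate vanish.\<close>
  define r where "r = \<bar>R\<bar> + 1"
  have L0: "0 \<le> L" using lip[of e 0] assms(2) by simp
  have "L-lipschitz_on UNIV N" using lip L0 by (auto intro!: lipschitz_onI simp: dist_norm)
  then have cN: "continuous_on UNIV N" by (rule lipschitz_on_continuous_on)
  note cont = continuous_intros continuous_on_compose2[OF cN]
  have c\<psi>: "continuous_on UNIV \<psi>" unfolding \<psi>_def by (intro continuous_intros)
  note cont = cont continuous_on_compose2[OF c\<psi>]
  have nt: "norm (t *\<^sub>R e) = t" using t assms(2) by simp
  have \<psi>0: "\<psi> x = 0" if "r < norm x" for x using that by (auto simp: \<psi>_def r_def)
  have \<psi>1: "\<psi> (x + t *\<^sub>R e) = 0" if "r < norm x" for x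
    using that t nt norm_diff_ineq[of x "t *\<^sub>R e"] by (auto simp: \<psi>_def r_def)
  have \<psi>2: "\<bar>\<psi> x - \<psi> (x + t *\<^sub>R e)\<bar> \<le> t" for x
    using norm_triangle_ineq3[of "x + t *\<^sub>R e" x] nt t by (auto simp: \<psi>_def max_def)
  have i1: "integrable lborel (\<lambda>x. \<psi> x * (N (x + t *\<^sub>R e) - N x))"
    by (rule integrable_continuous_compact_support[of _ r]) (auto intro!: cont simp: \<psi>0)
  have i2: "integrable lborel (\<lambda>x. \<psi> x * (N x - N (x - t *\<^sub>R e)))"
    by (rule integrable_continuous_compact_support[of _ r]) (auto intro!: cont simp: \<psi>0)
  have i3: "integrable lborel (\<lambda>x. \<psi> (x + t *\<^sub>R e) * (N (x + t *\<^sub>R e) - N x))"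
    by (rule integrable_continuous_compact_support[of _ r]) (auto intro!: cont simp: \<psi>1)
  have m2: "(\<lambda>x. \<psi> x * (N x - N (x - t *\<^sub>R e))) \<in> borel_measurable borel"
    by (intro borel_measurable_continuous_onI cont) auto
  have eq: "\<psi> x * (N (x + t *\<^sub>R e) + N (x - t *\<^sub>R e) - 2 * N x) =
      \<psi> x * (N (x + t *\<^sub>R e) - N x) - \<psi> x * (N x - N (x - t *\<^sub>R e))" for x
    by (simp add: algebra_simps)
  have int: "integrable lborel (\<lambda>x. \<psi> x * (N (x + t *\<^sub>R e) + N (x - t *\<^sub>R e) - 2 * N x))"
    unfolding eq using i1 i2 by (rule Bochner_Integration.integrable_diff)
  have "(\<integral>x. \<psi> x * (N (x + t *\<^sub>R e) + N (x - t *\<^sub>R e) - 2 * N x) \<partial>lborel) =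
      (\<integral>x. \<psi> x * (N (x + t *\<^sub>R e) - N x) \<partial>lborel) - (\<integral>x. \<psi> x * (N x - N (x - t *\<^sub>R e)) \<partial>lborel)"
    unfolding eq using i1 i2 by (rule Bochner_Integration.integral_diff)
  also have "(\<integral>x. \<psi> x * (N x - N (x - t *\<^sub>R e)) \<partial>lborel) =
      (\<integral>x. \<psi> (x + t *\<^sub>R e) * (N (x + t *\<^sub>R e) - N x) \<partial>lborel)"
    using integral_lborel_translate[OF m2, of "t *\<^sub>R e"] by simp
  also have "(\<integral>x. \<psi> x * (N (x + t *\<^sub>R e) - N x) \<partial>lborel) - \<dots> =
      (\<integral>x. \<psi> x * (N (x + t *\<^sub>R e) - N x) - \<psi> (x + t *\<^sub>R e) * (N (x + t *\<^sub>R e) - N x) \<partial>lborel)"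
    using i1 i3 by (rule Bochner_Integration.integral_diff[symmetric])
  also have "\<dots> \<le> (\<integral>x. indicator (cball (0::'a) r) x * (t * (L * t)) \<partial>lborel)"
  proof (rule integral_mono)
    show "integrable lborel (\<lambda>x. \<psi> x * (N (x + t *\<^sub>R e) - N x) - \<psi> (x + t *\<^sub>R e) * (N (x + t *\<^sub>R e) - N x))"
      using i1 i3 by (rule Bochner_Integration.integrable_diff)
    show "integrable lborel (\<lambda>x. indicator (cball (0::'a) r) x * (t * (L * t)) :: real)"
      by (auto intro!: integrable_real_indicator emeasure_lborel_cball_finite)
    fix x :: 'a
    show "\<psi> x * (N (x + t *\<^sub>R e) - N x) - \<psi> (x + t *\<^sub>R e) * (N (x + t *\<^sub>R e) - N x)
      \<le> indicator (cball 0 r) x * (t * (L * t))"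
    proof (cases "r < norm x")
      case True
      then show ?thesis using \<psi>0 \<psi>1 by simp
    next
      case False
      have "\<psi> x * (N (x + t *\<^sub>R e) - N x) - \<psi> (x + t *\<^sub>R e) * (N (x + t *\<^sub>R e) - N x) =
        (\<psi> x - \<psi> (x + t *\<^sub>R e)) * (N (x + t *\<^sub>R e) - N x)" by (simp add: algebra_simps)
      also have "\<dots> \<le> \<bar>\<psi> x - \<psi> (x + t *\<^sub>R e)\<bar> * \<bar>N (x + t *\<^sub>R e) - N x\<bar>"
        by (metis abs_ge_self abs_mult)
      also have "\<dots> \<le> t * (L * t)"
        using \<psi>2[of x] lip[of "x + t *\<^sub>R e" x] nt t by (intro mult_mono) auto
      finally show ?thesis using False by simp
    qed
  qed
  also have "\<dots> = (measure lborel (cball (0::'a) r) * L) * t\<^sup>2"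
    by (simp add: power2_eq_square)
  finally have "(\<integral>x. \<psi> x * (N (x + t *\<^sub>R e) + N (x - t *\<^sub>R e) - 2 * N x) \<partial>lborel) \<le>
    (measure lborel (cball (0::'a) (\<bar>R\<bar> + 1)) * L) * t\<^sup>2" unfolding r_def .
  with int show "integrable lborel (\<lambda>x. max 0 (R - norm x) * (N (x + t *\<^sub>R e) + N (x - t *\<^sub>R e) - 2 * N x)) \<and>
    (\<integral>x. max 0 (R - norm x) * (N (x + t *\<^sub>R e) + N (x - t *\<^sub>R e) - 2 * N x) \<partial>lborel) \<le>
    (measure lborel (cball (0::'a) (\<bar>R\<bar> + 1)) * L) * t\<^sup>2"
    unfolding \<psi>_def by blast
qed

text \<open>On the bad set \<open>A\<close> of one direction and one tolerance the second difference
  is at least t / (m + 1) for every t > 0, whereas its weighted integral is O(t^2). Dividing by t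
  and letting t tend to 0 leaves measure zero inside each ball. Countably many such sets suffice, as
  uniqueness of subgradients tests basis directions only.\<close>

lemma AE_smooth_points:
  fixes N :: "'a::euclidean_space \<Rightarrow> real"
  assumes lip: "\<And>x y. \<bar>N x - N y\<bar> \<le> L * norm (x - y)"
    and convex: "\<And>x y. 2 * N x \<le> N (x + y) + N (x - y)"
  shows "AE x in lborel. x \<in> smooth_points N"
proof -
  have L0: "0 \<le> L"
  proof -
    obtain e :: 'a where "e \<in> Basis" using nonempty_Basis by blast
    then show ?thesis using lip[of e 0] by simp
  qed
  have "L-lipschitz_on UNIV N" using lip L0 by (auto intro!: lipschitz_onI simp: dist_norm)
  then have cN: "continuous_on UNIV N" by (rule lipschitz_on_continuous_on)
  have main: "AE x in lborel. \<exists>t>0. N (x + t *\<^sub>R e) + N (x - t *\<^sub>R e) - 2 * N x < t / real (Suc m)"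
    if e: "e \<in> Basis" for e and m :: nat
  proof -
    define A where "A = - {x. \<exists>t>0. N (x + t *\<^sub>R e) + N (x - t *\<^sub>R e) - 2 * N x < t / real (Suc m)}"
    have A: "A \<in> sets borel" unfolding A_def by (intro borel_closed closed_Compl open_smooth_approx cN)
    have "AE x in lborel. norm x < real k \<longrightarrow> x \<notin> A" for k :: nat
    proof -
      define R where "R = real k"
      obtain C where C: "\<And>t. 0 < t \<Longrightarrow> t \<le> 1 \<Longrightarrow>
        integrable lborel (\<lambda>x. max 0 (R - norm x) * (N (x + t *\<^sub>R e) + N (x - t *\<^sub>R e) - 2 * N x)) \<and>
        (\<integral>x. max 0 (R - norm x) * (N (x + t *\<^sub>R e) + N (x - t *\<^sub>R e) - 2 * N x) \<partial>lborel) \<le> C * t\<^sup>2"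
        using second_difference_integral_le[of N L e R, OF lip] e by auto
      have i\<psi>: "integrable lborel (\<lambda>x::'a. max 0 (R - norm x))"
        by (rule integrable_continuous_compact_support[of _ R]) (auto intro!: continuous_intros)
      have iA: "integrable lborel (\<lambda>x. indicator A x * max 0 (R - norm x))"
        by (rule Bochner_Integration.integrable_bound[OF i\<psi>])
           (use A in \<open>auto simp: indicator_def\<close>)
      let ?I = "\<integral>x. indicator A x * max 0 (R - norm x) \<partial>lborel"
      have le: "?I \<le> (C * real (Suc m)) * t" if t: "0 < t" "t \<le> 1" for t
      proof -
        have "(\<integral>x. (t / real (Suc m)) * (indicator A x * max 0 (R - norm x)) \<partial>lborel) \<le>
          (\<integral>x. max 0 (R - norm x) * (N (x + t *\<^sub>R e) + N (x - t *\<^sub>R e) - 2 * N x) \<partial>lborel)"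
        proof (rule integral_mono)
          show "integrable lborel (\<lambda>x. max 0 (R - norm x) * (N (x + t *\<^sub>R e) + N (x - t *\<^sub>R e) - 2 * N x))"
            using C[OF t] by blast
          show "integrable lborel (\<lambda>x. (t / real (Suc m)) * (indicator A x * max 0 (R - norm x)))"
            using iA by (rule integrable_mult_right)
          fix x :: 'a
          have "indicator A x * (t / real (Suc m)) \<le> N (x + t *\<^sub>R e) + N (x - t *\<^sub>R e) - 2 * N x"
          proof (cases "x \<in> A")
            case True
            then show ?thesis using t(1) by (force simp: A_def not_less)
          next
            case False
            then show ?thesis using convex[of x "t *\<^sub>R e"] by simp
          qed
          then have "max 0 (R - norm x) * (indicator A x * (t / real (Suc m))) \<le>
            max 0 (R - norm x) * (N (x + t *\<^sub>R e) + N (x - t *\<^sub>R e) - 2 * N x)"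
            by (intro mult_left_mono) auto
          then show "(t / real (Suc m)) * (indicator A x * max 0 (R - norm x)) \<le>
            max 0 (R - norm x) * (N (x + t *\<^sub>R e) + N (x - t *\<^sub>R e) - 2 * N x)"
            by (simp add: mult_ac)
        qed
        also have "\<dots> \<le> C * t\<^sup>2" using C[OF t] by blast
        finally have "(t / real (Suc m)) * ?I \<le> C * t\<^sup>2" by simp
        then have "t * ?I \<le> t * ((C * real (Suc m)) * t)"
          by (simp add: field_simps power2_eq_square)
        then show ?thesis using t(1) by (simp only: mult_le_cancel_left_pos)
      qed
      have "?I \<le> 0"
      proof (rule tendsto_lowerbound)
        show "((\<lambda>t. (C * real (Suc m)) * t) \<longlongrightarrow> 0) (at_right 0)"
          by (auto intro!: tendsto_eq_intros)
        show "\<forall>\<^sub>F t in at_right 0. ?I \<le> (C * real (Suc m)) * t"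
          using le by (auto simp: eventually_at_right_field intro!: exI[of _ 1])
      qed auto
      moreover have "0 \<le> ?I" by (rule integral_nonneg_AE) (auto simp: indicator_def)
      ultimately have "?I = 0" by simp
      then have "AE x in lborel. indicator A x * max 0 (R - norm x) = 0"
        using integral_nonneg_eq_0_iff_AE[OF iA] by (auto simp: indicator_def)
      then show ?thesis
        by eventually_elim (auto simp: indicator_def R_def max_def split: if_splits)
    qed
    then have "AE x in lborel. \<forall>k::nat. norm x < real k \<longrightarrow> x \<notin> A"
      unfolding AE_all_countable by blast
    then show ?thesis
      by eventually_elim (use reals_Archimedean2 in \<open>auto simp: A_def\<close>)
  qed
  have "AE x in lborel. \<forall>m::nat. \<exists>t>0. N (x + t *\<^sub>R e) + N (x - t *\<^sub>R e) - 2 * N x < t / real (Suc m)"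
    if "e \<in> Basis" for e using main[OF that] by (simp only: AE_all_countable) simp
  then have "AE x in lborel. \<forall>e\<in>Basis. \<forall>m::nat. \<exists>t>0.
      N (x + t *\<^sub>R e) + N (x - t *\<^sub>R e) - 2 * N x < t / real (Suc m)"
    by (intro AE_finite_allI finite_Basis)
  then show ?thesis by (simp add: smooth_points_def)
qed

section \<open>Integration over the sphere\<close>

lemma space_sphere_borel [simp]: "space sphere_borel = sphere 0 1"
  by (simp add: sphere_borel_def space_restrict_space)

lemma sets_sphere_borel_iff: "A \<in> sets sphere_borel \<longleftrightarrow> A \<in> sets borel \<and> A \<subseteq> sphere 0 1"
  unfolding sphere_borel_def by (subst sets_restrict_space_iff) auto

lemma borel_measurable_sphere_borel:
  "f \<in> borel_measurable borel \<Longrightarrow> f \<in> borel_measurable sphere_borel"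
  unfolding sphere_borel_def by (rule measurable_restrict_space1)

lemma borel_measurable_sphere_continuous:
  "continuous_on (sphere 0 1) f \<Longrightarrow> f \<in> borel_measurable sphere_borel"
  unfolding sphere_borel_def by (rule borel_measurable_continuous_on_restrict)

text \<open>The uncompleted version, so that measurability can be checked on Borel sets. Nonnegative
  integrals over it and over its completion agree for every integrand, which is how results return
  to \<open>surface_measure\<close>.\<close>

definition sphere_measure :: "'a::euclidean_space measure" where
  "sphere_measure = scale_measure (of_nat DIM('a))
     (distr (restrict_space lborel (ball 0 1 - {0})) sphere_borel sgn)"

lemma surface_measure_eq: "surface_measure = completion sphere_measure"
  by (simp add: surface_measure_def sphere_measure_def)

lemma sets_sphere_measure [simp, measurable_cong]: "sets sphere_measure = sets sphere_borel"
  by (simp add: sphere_measure_def)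

lemma space_sphere_measure [simp]: "space sphere_measure = sphere 0 1"
  by (simp add: sphere_measure_def space_scale_measure)

lemma measurable_sgn_sphere_borel:
  "sgn \<in> measurable (restrict_space lborel (ball (0::'a::euclidean_space) 1 - {0})) sphere_borel"
  unfolding sphere_borel_def
proof (rule measurable_restrict_space2)
  show "sgn \<in> space (restrict_space lborel (ball (0::'a) 1 - {0})) \<rightarrow> sphere 0 1"
    by (auto simp: space_restrict_space norm_sgn)
  show "sgn \<in> borel_measurable (restrict_space lborel (ball (0::'a) 1 - {0}))"
    by (rule measurable_restrict_space1) (simp add: sgn_div_norm[abs_def])
qed

lemma nn_integral_sphere_measure:
  fixes f :: "'a::euclidean_space \<Rightarrow> ennreal"
  assumes "f \<in> borel_measurable sphere_borel"
  shows "(\<integral>\<^sup>+u. f u \<partial>sphere_measure) =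
    of_nat DIM('a) * (\<integral>\<^sup>+x. f (sgn x) * indicator (ball 0 1 - {0}) x \<partial>lborel)"
  unfolding sphere_measure_def using assms
  by (simp add: nn_integral_scale_measure nn_integral_distr[OF measurable_sgn_sphere_borel]
      nn_integral_restrict_space)

lemma emeasure_sphere_measure:
  fixes A :: "'a::euclidean_space set"
  assumes "A \<in> sets sphere_borel"
  shows "emeasure sphere_measure A =
    of_nat DIM('a) * emeasure lborel {x. x \<noteq> 0 \<and> norm x < 1 \<and> sgn x \<in> A}"
  using emeasure_surface_measure[OF assms] assms by (simp add: surface_measure_eq)

lemma finite_measure_sphere_measure: "finite_measure (sphere_measure :: 'a::euclidean_space measure)"
proof
  have "emeasure sphere_measure (sphere (0::'a) 1) =
    of_nat DIM('a) * emeasure lborel {x::'a. x \<noteq> 0 \<and> norm x < 1 \<and> sgn x \<in> sphere 0 1}"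
    by (rule emeasure_sphere_measure) (simp add: sets_sphere_borel_iff borel_closed)
  also have "\<dots> \<le> of_nat DIM('a) * emeasure lborel (ball (0::'a) 1)"
    by (intro mult_left_mono emeasure_mono) auto
  also have "\<dots> < \<infinity>"
    using emeasure_lborel_ball_finite[of "0::'a" 1]
    by (simp add: ennreal_mult_less_top of_nat_less_top)
  finally show "emeasure sphere_measure (space sphere_measure :: 'a set) \<noteq> \<infinity>" by simp
qed

text \<open>Carries null sets from space to the sphere: sgn x is a positive multiple of x, so the
  cone over the exceptional part of the sphere stays inside the exceptional set in space.\<close>

lemma AE_sphere_measure_cone:
  fixes A :: "'a::euclidean_space set"
  assumes "A \<in> sets borel" "\<And>c x. 0 < c \<Longrightarrow> x \<in> A \<Longrightarrow> c *\<^sub>R x \<in> A"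
    and "AE x in lborel. x \<in> A"
  shows "AE u in sphere_measure. u \<in> A"
proof (rule AE_I)
  have s: "sphere 0 1 - A \<in> sets sphere_borel"
    using assms(1) by (auto simp: sets_sphere_borel_iff borel_closed)
  then show "sphere 0 1 - A \<in> sets sphere_measure" by simp
  show "{u \<in> space sphere_measure. u \<notin> A} \<subseteq> sphere 0 1 - A" by auto
  have "{x. x \<noteq> 0 \<and> norm x < 1 \<and> sgn x \<in> sphere 0 1 - A} \<subseteq> - A"
  proof
    fix x assume x: "x \<in> {x. x \<noteq> 0 \<and> norm x < 1 \<and> sgn x \<in> sphere 0 1 - A}"
    have "sgn x \<in> A" if "x \<in> A"
      using assms(2)[of "inverse (norm x)" x] that x by (simp add: sgn_div_norm)
    with x show "x \<in> - A" by auto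
  qed
  then have "emeasure lborel {x. x \<noteq> 0 \<and> norm x < 1 \<and> sgn x \<in> sphere 0 1 - A} \<le> emeasure lborel (- A)"
    using assms(1) by (intro emeasure_mono) auto
  also have "\<dots> = 0"
    using assms(3) assms(1) AE_iff_measurable[of "- A" lborel "\<lambda>x. x \<in> A"] by (simp add: Compl_eq)
  finally show "emeasure sphere_measure (sphere 0 1 - A) = 0"
    by (simp add: emeasure_sphere_measure[OF s])
qed

lemma emeasure_sphere_measure_open_pos:
  fixes U :: "'a::euclidean_space set"
  assumes "open U" "u \<in> U" "u \<in> sphere 0 1"
  shows "0 < emeasure sphere_measure (sphere 0 1 \<inter> U)"
proof -
  have s: "sphere 0 1 \<inter> U \<in> sets sphere_borel"
    using assms(1) by (auto simp: sets_sphere_borel_iff borel_closed borel_open)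
  let ?C = "{x::'a. x \<noteq> 0 \<and> norm x < 1 \<and> sgn x \<in> sphere 0 1 \<inter> U}"
  have C: "?C = (ball 0 1 - {0}) \<inter> sgn -` U" by (auto simp: norm_sgn)
  have o: "open ?C" unfolding C
    by (intro continuous_open_preimage assms(1) continuous_intros) auto
  have "u \<noteq> 0" using assms(3) by auto
  then have "(1/2) *\<^sub>R u \<in> ?C"
    using assms by (simp add: sgn_div_norm)
  then have "?C \<noteq> {}" by (metis empty_iff)
  have n: "\<not> negligible ?C"
    by (rule open_not_negligible[OF o \<open>?C \<noteq> {}\<close>])
  have b: "?C \<in> sets borel" by (rule borel_open[OF o])
  have "emeasure lborel ?C \<noteq> 0"
  proof
    assume "emeasure lborel ?C = 0"
    with b have "?C \<in> null_sets lborel" by (simp only: null_sets_def sets_lborel mem_Collect_eq simp_thms)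
    from null_sets_completionI[OF this] n show False by (simp only: negligible_iff_null_sets simp_thms)
  qed
  then have "of_nat DIM('a) * emeasure lborel ?C \<noteq> 0" by (simp only: mult_eq_0_iff) simp
  then show ?thesis
    unfolding emeasure_sphere_measure[OF s] zero_less_iff_neq_zero .
qed

lemma lborel_distr_uminus_euclidean:
  "distr lborel borel uminus = (lborel :: 'a::euclidean_space measure)"
proof -
  have "(\<lambda>x::'a. 0 + (-1::real) *\<^sub>R x) = uminus" by (auto simp: fun_eq_iff)
  then show ?thesis using lborel_affine[of "-1" "0::'a"] by (simp add: density_1)
qed

lemma nn_integral_lborel_uminus:
  fixes f :: "'a::euclidean_space \<Rightarrow> ennreal"
  assumes "f \<in> borel_measurable borel"
  shows "(\<integral>\<^sup>+x. f (- x) \<partial>lborel) = (\<integral>\<^sup>+x. f x \<partial>lborel)"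
  by (subst (2) lborel_distr_uminus_euclidean[symmetric]) (simp add: nn_integral_distr assms)

lemma nn_integral_lborel_translate:
  fixes f :: "'a::euclidean_space \<Rightarrow> ennreal"
  assumes "f \<in> borel_measurable borel"
  shows "(\<integral>\<^sup>+x. f (x + c) \<partial>lborel) = (\<integral>\<^sup>+x. f x \<partial>lborel)"
  by (subst (2) lborel_distr_plus[of c, symmetric]) (simp add: nn_integral_distr assms add.commute)

lemma measurable_uminus_sphere_borel: "uminus \<in> measurable sphere_borel sphere_borel"
  unfolding sphere_borel_def
  by (rule measurable_restrict_space3) auto

lemma nn_integral_sphere_measure_uminus:
  fixes f :: "'a::euclidean_space \<Rightarrow> ennreal"
  assumes f: "f \<in> borel_measurable sphere_borel"
  shows "(\<integral>\<^sup>+u. f (- u) \<partial>sphere_measure) = (\<integral>\<^sup>+u. f u \<partial>sphere_measure)"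
proof -
  have "(\<lambda>u. f (- u)) \<in> borel_measurable sphere_borel"
    using measurable_compose[OF measurable_uminus_sphere_borel f] .
  moreover have "(\<lambda>x. f (sgn x) * indicator (ball 0 1 - {0}) x) \<in> borel_measurable borel"
    using measurable_compose[OF measurable_sgn_sphere_borel f]
    by (subst (asm) borel_measurable_restrict_space_iff_ennreal) auto
  from nn_integral_lborel_uminus[OF this]
  have "(\<integral>\<^sup>+x. f (- sgn x) * indicator (ball 0 1 - {0}) x \<partial>lborel) =
    (\<integral>\<^sup>+x. f (sgn x) * indicator (ball 0 1 - {0}) x \<partial>lborel)"
    by (simp add: indicator_def sgn_minus)
  ultimately show ?thesis using f by (simp add: nn_integral_sphere_measure)
qed

section \<open>Bounds for negative powers of |u . v|, uniform in the direction and in the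
  cut-off\<close>

lemma nn_integral_max_powr_le:
  fixes s a \<epsilon> :: real
  assumes s: "0 < s" "s < 1" and \<epsilon>: "0 < \<epsilon>"
  shows "(\<integral>\<^sup>+t\<in>{0..1}. ennreal (max \<epsilon> \<bar>a + t\<bar> powr (- s)) \<partial>lborel) \<le> ennreal (1 + 2 / (1 - s))"
proof -
  have "((\<lambda>x. x powr (- s)) has_integral (1 powr (- s + 1) / (- s + 1))) {0..1}"
    by (rule has_integral_powr_from_0) (use s in auto)
  then have hi: "((\<lambda>x. x powr (- s)) has_integral (1 / (1 - s))) {0..1}" by simp
  define \<phi> where "\<phi> t = ennreal (indicator {0..1} t * t powr (- s))" for t :: real
  have \<phi>m [measurable]: "\<phi> \<in> borel_measurable borel" unfolding \<phi>_def by measurable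
  have "(\<integral>\<^sup>+t. \<phi> t \<partial>lborel) = (\<integral>\<^sup>+t. ennreal (t powr (- s)) * indicator {0..1} t \<partial>lborel)"
    by (intro nn_integral_cong) (auto simp: \<phi>_def indicator_def)
  also have "\<dots> = ennreal (1 / (1 - s))"
    by (rule nn_integral_has_integral_lebesgue'[OF _ hi]) auto
  finally have I: "(\<integral>\<^sup>+t. \<phi> t \<partial>lborel) = ennreal (1 / (1 - s))" .
  \<comment> \<open>Where |a + t| > 1 the integrand is at most 1. Elsewhere it is dominated by
    \<open>\<phi>\<close> on the matching side of the singularity, and each side contributes at most
    1 / (1 - s). None of this depends on \<open>a\<close> or \<open>\<epsilon>\<close>.\<close>
  have "(\<integral>\<^sup>+t\<in>{0..1}. ennreal (max \<epsilon> \<bar>a + t\<bar> powr (- s)) \<partial>lborel) \<le>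
    (\<integral>\<^sup>+t. indicator {0..1} t + (\<phi> (a + t) + \<phi> (- (a + t))) \<partial>lborel)"
  proof (rule nn_integral_mono_AE)
    \<comment> \<open>At t = -a the value 0 powr (- s) is 0 by convention, so the comparison with
      the untruncated power fails there.\<close>
    have "AE t in lborel. t \<noteq> - a" by (rule AE_lborel_singleton)
    then show "AE t in lborel. ennreal (max \<epsilon> \<bar>a + t\<bar> powr (- s)) * indicator {0..1} t \<le>
      indicator {0..1} t + (\<phi> (a + t) + \<phi> (- (a + t)))"
    proof eventually_elim
      case (elim t)
      then have nz: "\<bar>a + t\<bar> > 0" by auto
      show ?case
      proof (cases "t \<in> {0..1}")
        case False then show ?thesis by simp
      next
        case t: True
        have le: "max \<epsilon> \<bar>a + t\<bar> powr (- s) \<le> \<bar>a + t\<bar> powr (- s)"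
          using nz s by (intro powr_mono2') auto
        show ?thesis
        proof (cases "\<bar>a + t\<bar> \<le> 1")
          case True
          have "ennreal (\<bar>a + t\<bar> powr (- s)) \<le> \<phi> (a + t) + \<phi> (- (a + t))"
          proof (cases "a + t > 0")
            case pos: True
            then have "\<phi> (a + t) = ennreal (\<bar>a + t\<bar> powr (- s))"
              using True by (simp add: \<phi>_def)
            then show ?thesis by (metis add_increasing2 order_refl zero_le)
          next
            case neg: False
            then have "\<phi> (- (a + t)) = ennreal (\<bar>a + t\<bar> powr (- s))"
              using True by (simp add: \<phi>_def)
            then show ?thesis by (metis add_increasing order_refl zero_le)
          qed
          with ennreal_leI[OF le] have "ennreal (max \<epsilon> \<bar>a + t\<bar> powr (- s)) \<le> \<phi> (a + t) + \<phi> (- (a + t))"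
            by (rule order_trans)
          then show ?thesis using t by (simp add: add_increasing)
        next
          case False
          then have "\<bar>a + t\<bar> powr (- s) \<le> 1"
            using s powr_mono2'[of "-s" 1 "\<bar>a + t\<bar>"] by simp
          with le have "max \<epsilon> \<bar>a + t\<bar> powr (- s) \<le> 1"
            by (rule order_trans)
          then have "ennreal (max \<epsilon> \<bar>a + t\<bar> powr (- s)) \<le> 1"
            by (metis ennreal_1 ennreal_leI)
          then show ?thesis using t by (simp add: add_increasing2)
        qed
      qed
    qed
  qed
  also have "\<dots> = (\<integral>\<^sup>+t. indicator {0..1::real} t \<partial>lborel) +
      ((\<integral>\<^sup>+t. \<phi> (a + t) \<partial>lborel) + (\<integral>\<^sup>+t. \<phi> (- (a + t)) \<partial>lborel))"
    by (simp add: nn_integral_add)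
  also have "(\<integral>\<^sup>+t. \<phi> (a + t) \<partial>lborel) = ennreal (1 / (1 - s))"
    using nn_integral_lborel_translate[OF \<phi>m, of a] I by (simp add: add.commute)
  also have "(\<integral>\<^sup>+t. \<phi> (- (a + t)) \<partial>lborel) = ennreal (1 / (1 - s))"
    using nn_integral_lborel_translate[of "\<lambda>t. \<phi> (- t)" a] nn_integral_lborel_uminus[OF \<phi>m] I
    by (simp add: add.commute)
  also have "(\<integral>\<^sup>+t. indicator {0..1::real} t \<partial>lborel) = ennreal 1" by simp
  also have "ennreal 1 + (ennreal (1 / (1 - s)) + ennreal (1 / (1 - s))) = ennreal (1 + 2 / (1 - s))"
    using s by (simp flip: ennreal_plus del: ennreal_1)
  finally show ?thesis .
qed

text \<open>Averaging over the translations by \<open>t *\<^sub>R v\<close> reduces the integral to one variable.\<close>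

lemma nn_integral_ball_max_powr_le:
  fixes v :: "'a::euclidean_space" and s \<epsilon> :: real
  assumes s: "0 < s" "s < 1" and \<epsilon>: "0 < \<epsilon>" and v: "norm v = 1"
  shows "(\<integral>\<^sup>+x\<in>ball 0 1. ennreal (max \<epsilon> \<bar>x \<bullet> v\<bar> powr (- s)) \<partial>lborel) \<le>
    ennreal (1 + 2 / (1 - s)) * emeasure lborel (ball (0::'a) 2)"
proof -
  let ?\<phi> = "\<lambda>t. ennreal (max \<epsilon> \<bar>t\<bar> powr (- s))"
  define F where "F x = ?\<phi> (x \<bullet> v) * indicator (ball 0 1) x" for x :: 'a
  have [measurable]: "ball (0::'a) r \<in> sets borel" for r by (rule borel_open) simp
  have Fm: "F \<in> borel_measurable borel" unfolding F_def by measurable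
  have vv: "v \<bullet> v = 1" using v by (simp add: norm_eq_1)
  have "(\<integral>\<^sup>+x. F x \<partial>lborel) = (\<integral>\<^sup>+t\<in>{0..1::real}. (\<integral>\<^sup>+x. F x \<partial>lborel) \<partial>lborel)"
    by (simp add: nn_integral_cmult)
  \<comment> \<open>Translation invariance makes the inner integral independent of t, and [0, 1] has
    length 1, so the average changes nothing. Shifts of length at most 1 are why the unit ball grows
    to \<open>ball 0 2\<close> next.\<close>
  also have "\<dots> = (\<integral>\<^sup>+t\<in>{0..1}. (\<integral>\<^sup>+x. F (x + t *\<^sub>R v) \<partial>lborel) \<partial>lborel)"
    by (simp add: nn_integral_lborel_translate[OF Fm])
  also have "\<dots> \<le> (\<integral>\<^sup>+t\<in>{0..1}. (\<integral>\<^sup>+x. ?\<phi> (x \<bullet> v + t) * indicator (ball 0 2) x \<partial>lborel) \<partial>lborel)"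
  proof (intro nn_integral_mono)
    fix t :: real
    show "(\<integral>\<^sup>+x. F (x + t *\<^sub>R v) \<partial>lborel) * indicator {0..1} t \<le>
      (\<integral>\<^sup>+x. ?\<phi> (x \<bullet> v + t) * indicator (ball 0 2) x \<partial>lborel) * indicator {0..1} t"
    proof (cases "t \<in> {0..1}")
      case t: True
      have "F (x + t *\<^sub>R v) \<le> ?\<phi> (x \<bullet> v + t) * indicator (ball 0 2) x" for x
      proof (cases "norm (x + t *\<^sub>R v) < 1")
        case True
        then have "norm x < 2" using t v norm_triangle_sub[of x "- (t *\<^sub>R v)"] by simp
        then show ?thesis by (simp add: F_def inner_add_left vv indicator_def)
      qed (simp add: F_def)
      then show ?thesis by (intro mult_right_mono nn_integral_mono) auto
    qed simp
  qed
  also have "\<dots> = (\<integral>\<^sup>+t. (\<integral>\<^sup>+x. ?\<phi> (x \<bullet> v + t) * indicator (ball 0 2) x * indicator {0..1} t \<partial>lborel) \<partial>lborel)"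
    by (simp add: nn_integral_multc)
  also have "\<dots> = (\<integral>\<^sup>+x. (\<integral>\<^sup>+t. ?\<phi> (x \<bullet> v + t) * indicator (ball 0 2) x * indicator {0..1} t \<partial>lborel) \<partial>lborel)"
    by (rule lborel_pair.Fubini') measurable
  also have "\<dots> = (\<integral>\<^sup>+x. (\<integral>\<^sup>+t\<in>{0..1}. ?\<phi> (x \<bullet> v + t) \<partial>lborel) * indicator (ball 0 2) x \<partial>lborel)"
  proof (rule nn_integral_cong)
    fix x :: 'a
    have "(\<integral>\<^sup>+t\<in>{0..1}. ?\<phi> (x \<bullet> v + t) \<partial>lborel) * indicator (ball 0 2) x =
      (\<integral>\<^sup>+t. ?\<phi> (x \<bullet> v + t) * indicator {0..1} t * indicator (ball 0 2) x \<partial>lborel)"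
      by (rule nn_integral_multc[symmetric]) measurable
    then show "(\<integral>\<^sup>+t. ?\<phi> (x \<bullet> v + t) * indicator (ball 0 2) x * indicator {0..1} t \<partial>lborel) =
      (\<integral>\<^sup>+t\<in>{0..1}. ?\<phi> (x \<bullet> v + t) \<partial>lborel) * indicator (ball 0 2) x"
      by (simp add: mult_ac)
  qed
  also have "\<dots> \<le> (\<integral>\<^sup>+x. ennreal (1 + 2 / (1 - s)) * indicator (ball (0::'a) 2) x \<partial>lborel)"
    by (intro nn_integral_mono mult_right_mono nn_integral_max_powr_le s \<epsilon>) auto
  also have "\<dots> = ennreal (1 + 2 / (1 - s)) * emeasure lborel (ball (0::'a) 2)"
    by (simp add: nn_integral_cmult_indicator)
  finally show ?thesis by (simp add: F_def)
qed

text \<open>Moving a point of the unit ball out to the sphere increases |x . v|, and the exponent is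
  negative; so the sphere integral is bounded by the ball integral.\<close>

lemma nn_integral_sphere_max_powr_le:
  fixes s :: real
  assumes s: "0 < s" "s < 1"
  obtains C where "0 < C" "\<And>v \<epsilon>. norm (v::'a::euclidean_space) = 1 \<Longrightarrow> 0 < \<epsilon> \<Longrightarrow>
    (\<integral>\<^sup>+u. ennreal (max \<epsilon> \<bar>u \<bullet> v\<bar> powr (- s)) \<partial>sphere_measure) \<le> ennreal C"
proof -
  define c where "c = of_nat DIM('a) * (ennreal (1 + 2 / (1 - s)) * emeasure lborel (ball (0::'a) 2))"
  have c: "c < top" unfolding c_def
    using emeasure_lborel_ball_finite[of "0::'a" 2]
    by (simp add: ennreal_mult_less_top of_nat_less_top)
  have "(\<integral>\<^sup>+u. ennreal (max \<epsilon> \<bar>u \<bullet> v\<bar> powr (- s)) \<partial>sphere_measure) \<le> c"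
    if v: "norm v = 1" and \<epsilon>: "0 < \<epsilon>" for v :: 'a and \<epsilon> :: real
  proof -
    have "(\<integral>\<^sup>+u. ennreal (max \<epsilon> \<bar>u \<bullet> v\<bar> powr (- s)) \<partial>sphere_measure) =
      of_nat DIM('a) * (\<integral>\<^sup>+x. ennreal (max \<epsilon> \<bar>sgn x \<bullet> v\<bar> powr (- s)) * indicator (ball 0 1 - {0}) x \<partial>lborel)"
      by (rule nn_integral_sphere_measure) (intro borel_measurable_sphere_borel, measurable)
    also have "\<dots> \<le> of_nat DIM('a) * (\<integral>\<^sup>+x\<in>ball 0 1. ennreal (max \<epsilon> \<bar>x \<bullet> v\<bar> powr (- s)) \<partial>lborel)"
    proof (intro mult_left_mono nn_integral_mono)
      fix x :: 'a
      show "ennreal (max \<epsilon> \<bar>sgn x \<bullet> v\<bar> powr (- s)) * indicator (ball 0 1 - {0}) x \<le>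
        ennreal (max \<epsilon> \<bar>x \<bullet> v\<bar> powr (- s)) * indicator (ball 0 1) x"
      proof (cases "x \<in> ball 0 1 - {0}")
        case True
        then have "\<bar>x \<bullet> v\<bar> \<le> \<bar>sgn x \<bullet> v\<bar>"
          by (simp add: sgn_div_norm abs_mult field_simps mult_left_le_one_le)
        then have "max \<epsilon> \<bar>sgn x \<bullet> v\<bar> powr (- s) \<le> max \<epsilon> \<bar>x \<bullet> v\<bar> powr (- s)"
          using \<epsilon> s by (intro powr_mono2') auto
        then show ?thesis using True by (simp add: ennreal_leI)
      qed simp
    qed auto
    also have "\<dots> \<le> c" unfolding c_def
      by (intro mult_left_mono nn_integral_ball_max_powr_le s \<epsilon> v) auto
    finally show ?thesis .
  qed
  moreover have "c \<le> ennreal (enn2real c + 1)"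
    using c by (cases c) (auto simp: ennreal_leI)
  ultimately show thesis
    by (intro that[of "enn2real c + 1"]) (auto intro: order_trans simp: add_nonneg_pos)
qed

section \<open>The variational problem\<close>

lemma ln_diff_le:
  assumes "\<epsilon> \<le> a" "\<epsilon> \<le> b" "0 < (\<epsilon>::real)"
  shows "\<bar>ln a - ln b\<bar> \<le> \<bar>a - b\<bar> / \<epsilon>"
proof -
  have "ln a - ln b \<le> \<bar>a - b\<bar> / \<epsilon>" if "\<epsilon> \<le> a" "\<epsilon> \<le> b" for a b :: real
  proof -
    have "ln a - ln b = ln (a / b)" using that assms(3) by (simp add: ln_div)
    also have "\<dots> \<le> a / b - 1" using that assms(3) by (intro ln_le_minus_one) auto
    also have "\<dots> = (a - b) / b" using that assms(3) by (simp add: field_simps)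
    also have "\<dots> \<le> \<bar>a - b\<bar> / b" using that assms(3) by (intro divide_right_mono) auto
    also have "\<dots> \<le> \<bar>a - b\<bar> / \<epsilon>" using that assms(3) by (intro divide_left_mono) auto
    finally show ?thesis .
  qed
  from this[of a b] this[of b a] assms show ?thesis by (simp add: abs_le_iff abs_minus_commute)
qed

lemma integrable_sphere_continuous:
  fixes f :: "'a::euclidean_space \<Rightarrow> real"
  assumes "finite_measure M" "sets M = sets sphere_borel" "continuous_on (sphere 0 1) f"
  shows "integrable M f"
proof -
  obtain B where B: "\<And>v. v \<in> sphere 0 1 \<Longrightarrow> \<bar>f v\<bar> \<le> B"
    using continuous_on_sphere_bounded[OF assms(3)] by blast
  have "space M = sphere 0 1" using sets_eq_imp_space_eq[OF assms(2)] by simp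
  moreover have "f \<in> borel_measurable M"
    unfolding measurable_cong_sets[OF assms(2) refl]
    by (rule borel_measurable_sphere_continuous[OF assms(3)])
  ultimately show ?thesis
    by (intro finite_measure.integrable_const_bound[OF assms(1), of _ B] AE_I2) (simp_all add: B)
qed

text \<open>
  \<open>M\<close> stands for the surface measure with density \<open>\<rho>\<^sub>Q powr (n - q) / n\<close>.
\<close>

locale dual_minkowski =
  fixes M \<mu> :: "'a::euclidean_space measure" and q :: real
  assumes q: "0 < q" "q \<le> 1"
    and sets_M: "sets M = sets sphere_borel" and finite_M: "finite_measure M"
    and M_nonzero: "emeasure M (sphere 0 1) \<noteq> 0"
    and M_even: "\<And>\<phi> :: 'a \<Rightarrow> ennreal. \<phi> \<in> borel_measurable sphere_borel \<Longrightarrow>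
        (\<integral>\<^sup>+u. \<phi> (- u) \<partial>M) = (\<integral>\<^sup>+u. \<phi> u \<partial>M)"
    and M_cone: "\<And>A. A \<in> sets borel \<Longrightarrow> (\<And>c x. 0 < c \<Longrightarrow> x \<in> A \<Longrightarrow> c *\<^sub>R x \<in> A) \<Longrightarrow>
        AE x in lborel. x \<in> A \<Longrightarrow> AE u in M. u \<in> A"
    and M_powr: "\<And>s. 0 < s \<Longrightarrow> s < 1 \<Longrightarrow> \<exists>C>0. \<forall>v \<epsilon>. norm v = 1 \<longrightarrow> 0 < \<epsilon> \<longrightarrow>
        (\<integral>\<^sup>+u. ennreal (max \<epsilon> \<bar>u \<bullet> v\<bar> powr (- s)) \<partial>M) \<le> ennreal C"
    and sets_mu: "sets \<mu> = sets sphere_borel" and finite_mu: "finite_measure \<mu>"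
    and mu_even: "\<And>A. A \<in> sets sphere_borel \<Longrightarrow> emeasure \<mu> (uminus ` A) = emeasure \<mu> A"
    and not_concentrated: "\<And>x. x \<in> sphere 0 1 \<Longrightarrow> \<not> (AE v in \<mu>. x \<bullet> v = 0)"
begin

lemma space_M: "space M = sphere 0 1"
  using sets_eq_imp_space_eq[OF sets_M] by simp

lemma space_mu: "space \<mu> = sphere 0 1"
  using sets_eq_imp_space_eq[OF sets_mu] by simp

lemmas integrable_M = integrable_sphere_continuous[OF finite_M sets_M]
lemmas integrable_mu = integrable_sphere_continuous[OF finite_mu sets_mu]

definition mass :: real where "mass = measure \<mu> (sphere 0 1)"

text \<open>The dual mixed volume of the Wulff shape with Q, which is also the total mass of the
  dual curvature measure to be prescribed.\<close>

definition volume :: "('a \<Rightarrow> real) \<Rightarrow> real" where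
  "volume f = (\<integral>u. wulff_gauge f u powr (- q) \<partial>M)"

definition avg :: "('a \<Rightarrow> real) \<Rightarrow> real" where
  "avg f = (\<integral>v. f v \<partial>\<mu>) / mass"

text \<open>The factor 1 / q undoes the homogeneity of \<open>volume\<close>, and the mean is
  normalised by \<open>mass\<close>; hence adding a constant to \<open>f\<close> changes both terms
  equally.\<close>

definition entropy :: "('a \<Rightarrow> real) \<Rightarrow> real" where
  "entropy f = ln (volume f) / q - avg f"

lemma mass_pos: "0 < mass"
proof (rule ccontr)
  interpret \<mu>: finite_measure \<mu> by (rule finite_mu)
  assume "\<not> 0 < mass"
  then have "measure \<mu> (space \<mu>) = 0" by (simp add: mass_def space_mu not_less antisym)
  then have "emeasure \<mu> (space \<mu>) = 0" by (simp add: \<mu>.emeasure_eq_measure)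
  then have "AE v in \<mu>. False" by (simp add: AE_iff_measurable[of "space \<mu>"])
  then have "AE v in \<mu>. x \<bullet> v = 0" for x :: 'a by eventually_elim simp
  moreover obtain x :: 'a where "x \<in> sphere 0 1" using sphere_nonempty by blast
  ultimately show False using not_concentrated[of x] by simp
qed

lemma integral_const_M: "(\<integral>u. c \<partial>M) = measure M (sphere 0 1) * c" for c :: real
  by (simp add: space_M)

lemma measure_M_pos: "0 < measure M (sphere 0 1)"
proof -
  interpret M: finite_measure M by (rule finite_M)
  show ?thesis using M_nonzero
    by (metis M.emeasure_eq_measure ennreal_0 measure_nonneg order_less_le)
qed

lemma avg_const [simp]: "avg (\<lambda>_. c) = c"
  using mass_pos by (simp add: avg_def space_mu flip: mass_def)

lemma avg_mono:
  assumes "continuous_on (sphere 0 1) f" "continuous_on (sphere 0 1) g"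
    and "\<And>v. v \<in> sphere 0 1 \<Longrightarrow> f v \<le> g v"
  shows "avg f \<le> avg g"
  unfolding avg_def using assms mass_pos
  by (intro divide_right_mono integral_mono integrable_mu) (auto simp: space_mu)

lemma avg_add:
  assumes "continuous_on (sphere 0 1) f" "continuous_on (sphere 0 1) g"
  shows "avg (\<lambda>v. f v + g v) = avg f + avg g"
  unfolding avg_def using assms
  by (subst Bochner_Integration.integral_add) (auto intro: integrable_mu simp: add_divide_distrib)

lemma avg_mult: "avg (\<lambda>v. c * f v) = c * avg f"
  unfolding avg_def by simp

lemma continuous_on_gauge_powr:
  fixes f :: "'a \<Rightarrow> real"
  assumes "continuous_on (sphere 0 1) f"
  shows "continuous_on (sphere 0 1) (\<lambda>u. wulff_gauge f u powr a)"
proof (intro continuous_intros continuous_on_wulff_gauge assms ballI)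
  fix u :: 'a assume "u \<in> sphere 0 1"
  then have "u \<noteq> 0" by auto
  then show "wulff_gauge f u \<noteq> 0" using wulff_gauge_pos[OF assms] by force
qed

lemma volume_pos:
  assumes "continuous_on (sphere 0 1) f"
  shows "0 < volume f"
proof -
  have ne: "u \<noteq> 0" if "u \<in> sphere 0 1" for u :: 'a using that by auto
  obtain u0 where u0: "u0 \<in> sphere 0 1"
    "\<And>u. u \<in> sphere 0 1 \<Longrightarrow> wulff_gauge f u0 powr (- q) \<le> wulff_gauge f u powr (- q)"
    using continuous_attains_inf[OF compact_sphere sphere_nonempty continuous_on_gauge_powr[OF assms]]
    by blast
  have "0 < measure M (sphere 0 1) * wulff_gauge f u0 powr (- q)"
    using measure_M_pos wulff_gauge_pos[OF assms ne[OF u0(1)]] by simp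
  also have "\<dots> = (\<integral>u. wulff_gauge f u0 powr (- q) \<partial>M)" by (simp only: integral_const_M)
  also have "\<dots> \<le> volume f" unfolding volume_def
    by (rule integral_mono)
       (use u0 integrable_M[OF continuous_on_gauge_powr[OF assms]] integrable_M[OF continuous_on_const] space_M in auto)
  finally show ?thesis .
qed

text \<open>The Wulff shape of \<open>f\<close> lies in the dilate by exp d of that of
  \<open>g\<close>, and the integral is homogeneous of degree q under dilation.\<close>

lemma ln_volume_mono:
  assumes "continuous_on (sphere 0 1) f" "continuous_on (sphere 0 1) g"
    and "\<And>v. v \<in> sphere 0 1 \<Longrightarrow> f v \<le> g v + d"
  shows "ln (volume f) / q \<le> ln (volume g) / q + d"
proof -
  have "exp (- (q * d)) * volume f = (\<integral>u. exp (- (q * d)) * wulff_gauge f u powr (- q) \<partial>M)"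
    by (simp add: volume_def)
  also have "\<dots> \<le> volume g" unfolding volume_def
  proof (rule integral_mono)
    show "integrable M (\<lambda>u. exp (- (q * d)) * wulff_gauge f u powr (- q))"
      by (intro integrable_mult_right integrable_M continuous_on_gauge_powr assms)
    show "integrable M (\<lambda>u. wulff_gauge g u powr (- q))"
      by (intro integrable_M continuous_on_gauge_powr assms)
    fix u assume "u \<in> space M"
    then have u: "u \<noteq> 0" by (auto simp: space_M)
    have "exp (- (q * d)) * wulff_gauge f u powr (- q) = (exp d * wulff_gauge f u) powr (- q)"
      using wulff_gauge_nonneg[OF assms(1)] by (simp add: powr_mult exp_powr_real mult.commute)
    also have "\<dots> \<le> wulff_gauge g u powr (- q)"
      using wulff_gauge_mono[OF assms(1-3)] wulff_gauge_pos[OF assms(2) u] q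
      by (intro powr_mono2') auto
    finally show "exp (- (q * d)) * wulff_gauge f u powr (- q) \<le> wulff_gauge g u powr (- q)" .
  qed
  finally have "ln (exp (- (q * d)) * volume f) \<le> ln (volume g)"
    using volume_pos[OF assms(1)] by (intro ln_mono) auto
  also have "ln (exp (- (q * d)) * volume f) = - (q * d) + ln (volume f)"
    using volume_pos[OF assms(1)] by (subst ln_mult_pos) auto
  finally have "ln (volume f) \<le> ln (volume g) + q * d" by simp
  then have "ln (volume f) / q \<le> (ln (volume g) + q * d) / q"
    using q by (intro divide_right_mono) auto
  then show ?thesis using q by (simp add: add_divide_distrib)
qed

text \<open>Each of the two terms is 1-Lipschitz for the uniform distance. This gives boundedness on
  the compact class of competitors and passage to a uniform limit.\<close>

lemma entropy_le_add:
  assumes "continuous_on (sphere 0 1) f" "continuous_on (sphere 0 1) g"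
    and "\<And>v. v \<in> sphere 0 1 \<Longrightarrow> \<bar>f v - g v\<bar> \<le> d"
  shows "entropy f \<le> entropy g + 2 * d"
proof -
  have "ln (volume f) / q \<le> ln (volume g) / q + d"
  proof (rule ln_volume_mono[OF assms(1,2)])
    show "f v \<le> g v + d" if "v \<in> sphere 0 1" for v using assms(3)[OF that] by simp
  qed
  moreover have "avg g \<le> avg (\<lambda>v. f v + d)"
  proof (rule avg_mono[OF assms(2)])
    show "continuous_on (sphere 0 1) (\<lambda>v. f v + d)" by (intro continuous_intros assms)
    show "g v \<le> f v + d" if "v \<in> sphere 0 1" for v using assms(3)[OF that] by simp
  qed
  then have "avg g \<le> avg f + d" using assms by (simp add: avg_add)
  ultimately show ?thesis by (simp add: entropy_def)
qed

section \<open>Thin bodies are bad competitors\<close>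

lemma avg_inner_lower_bound:
  obtains m where "0 < m" "m \<le> 1" "\<And>x. x \<in> sphere 0 1 \<Longrightarrow> m \<le> avg (\<lambda>v. \<bar>x \<bullet> v\<bar>)"
proof -
  have ci: "continuous_on (sphere 0 1) (\<lambda>v. \<bar>x \<bullet> v\<bar>)" for x :: 'a by (intro continuous_intros)
  have lip: "avg (\<lambda>v. \<bar>x \<bullet> v\<bar>) \<le> avg (\<lambda>v. \<bar>y \<bullet> v\<bar>) + norm (x - y)" for x y
  proof -
    have "avg (\<lambda>v. \<bar>x \<bullet> v\<bar>) \<le> avg (\<lambda>v. \<bar>y \<bullet> v\<bar> + norm (x - y))"
    proof (rule avg_mono)
      fix v :: 'a assume "v \<in> sphere 0 1"
      then have "\<bar>(x - y) \<bullet> v\<bar> \<le> norm (x - y)" using Cauchy_Schwarz_ineq2[of "x - y" v] by simp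
      then show "\<bar>x \<bullet> v\<bar> \<le> \<bar>y \<bullet> v\<bar> + norm (x - y)" by (simp add: inner_diff_left)
    qed (intro continuous_intros)+
    then show ?thesis using avg_add[OF ci continuous_on_const] by simp
  qed
  \<comment> \<open>Continuity in x on the compact sphere upgrades the pointwise positivity given by
    \<open>not_concentrated\<close> to a uniform lower bound.\<close>
  have "1-lipschitz_on (sphere 0 1) (\<lambda>x. avg (\<lambda>v. \<bar>x \<bullet> v\<bar>))"
  proof (rule lipschitz_onI)
    fix x y :: 'a
    show "dist (avg (\<lambda>v. \<bar>x \<bullet> v\<bar>)) (avg (\<lambda>v. \<bar>y \<bullet> v\<bar>)) \<le> 1 * dist x y"
      using lip[of x y] lip[of y x] norm_minus_commute[of x y] by (simp add: dist_norm abs_le_iff)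
  qed simp
  then have "continuous_on (sphere 0 1) (\<lambda>x. avg (\<lambda>v. \<bar>x \<bullet> v\<bar>))"
    by (rule lipschitz_on_continuous_on)
  from continuous_attains_inf[OF compact_sphere sphere_nonempty this]
  obtain x0 where x0: "x0 \<in> sphere 0 1"
    "\<And>x. x \<in> sphere 0 1 \<Longrightarrow> avg (\<lambda>v. \<bar>x0 \<bullet> v\<bar>) \<le> avg (\<lambda>v. \<bar>x \<bullet> v\<bar>)" by blast
  have "avg (\<lambda>v. \<bar>x0 \<bullet> v\<bar>) \<le> avg (\<lambda>v. 1)"
  proof (rule avg_mono)
    fix v :: 'a assume "v \<in> sphere 0 1"
    then show "\<bar>x0 \<bullet> v\<bar> \<le> 1" using Cauchy_Schwarz_ineq2[of x0 v] x0 by simp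
  qed (intro continuous_intros)+
  moreover have nz: "(\<integral>v. \<bar>x0 \<bullet> v\<bar> \<partial>\<mu>) \<noteq> 0"
    using not_concentrated[OF x0(1)] integral_nonneg_eq_0_iff_AE[OF integrable_mu[OF ci, of x0]] by simp
  moreover have "0 < (\<integral>v. \<bar>x0 \<bullet> v\<bar> \<partial>\<mu>)"
    using nz Bochner_Integration.integral_nonneg[of \<mu> "\<lambda>v. \<bar>x0 \<bullet> v\<bar>"] by linarith
  ultimately have "0 < avg (\<lambda>v. \<bar>x0 \<bullet> v\<bar>)" "avg (\<lambda>v. \<bar>x0 \<bullet> v\<bar>) \<le> 1"
    using mass_pos by (simp_all add: avg_def)
  then show thesis using x0(2) by (rule that)
qed

text \<open>Here \<open>v0\<close> is a direction of least support, so the body is thin across it,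
  and \<open>x0\<close> is a unit vector in the body, which keeps \<open>f\<close> well above ln
  \<epsilon> on average. Both terms are compared with multiples of ln \<epsilon>, and the multiple
  from the integral is the larger one.\<close>

lemma entropy_degenerate:
  obtains \<epsilon>0 where "0 < \<epsilon>0" "\<epsilon>0 < 1"
    "\<And>f \<epsilon> v0 x0. \<lbrakk>continuous_on (sphere 0 1) f; \<And>v. v \<in> sphere 0 1 \<Longrightarrow> f (- v) = f v;
       \<And>v. v \<in> sphere 0 1 \<Longrightarrow> f v \<le> 0; 0 < \<epsilon>; \<epsilon> < \<epsilon>0; v0 \<in> sphere 0 1; x0 \<in> sphere 0 1;
       f v0 = ln \<epsilon>; \<And>v. v \<in> sphere 0 1 \<Longrightarrow> ln \<epsilon> \<le> f v;
       \<And>v. v \<in> sphere 0 1 \<Longrightarrow> \<bar>x0 \<bullet> v\<bar> \<le> exp (f v)\<rbrakk> \<Longrightarrow> entropy f \<le> entropy (\<lambda>_. 0)"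
proof -
  obtain m where m: "0 < m" "m \<le> 1" "\<And>x. x \<in> sphere 0 1 \<Longrightarrow> m \<le> avg (\<lambda>v. \<bar>x \<bullet> v\<bar>)"
    using avg_inner_lower_bound by blast
  \<comment> \<open>The mean will cost only (1 - m / 2) |ln \<epsilon>|, so any s < q with s / q > 1
    - m / 2 would do. This choice leaves a surplus of (m / 4) |ln \<epsilon>|, and s < q also forces
    s < 1.\<close>
  define s where "s = q * (1 - m / 4)"
  have s: "0 < s" "s < 1" "s \<le> q"
  proof -
    show "0 < s" using m q by (simp add: s_def)
    have "s < q * 1" unfolding s_def using m q by (intro mult_strict_left_mono) auto
    then show "s < 1" "s \<le> q" using q by auto
  qed
  obtain C where C: "0 < C" "\<And>v \<epsilon>. norm v = 1 \<Longrightarrow> 0 < \<epsilon> \<Longrightarrow>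
        (\<integral>\<^sup>+u. ennreal (max \<epsilon> \<bar>u \<bullet> v\<bar> powr (- s)) \<partial>M) \<le> ennreal C"
    using M_powr[OF s(1,2)] by blast
  \<comment> \<open>\<open>E\<close> is what the surplus must beat: the exponential in
    \<open>\<epsilon>0\<close> gives (m / 4) ln \<epsilon> \<le> - E. The bound m / 2 is what turns
    (1 - m) / (1 - \<epsilon>) into at most 1 - m / 2. The function 0 represents the unit
    ball.\<close>
  define E where "E = ln C / q - entropy (\<lambda>_. 0)"
  define \<epsilon>0 where "\<epsilon>0 = min (m / 2) (exp (- (4 * E / m)))"
  show thesis
  proof
    show "0 < \<epsilon>0" "\<epsilon>0 < 1" using m by (auto simp: \<epsilon>0_def)
    fix f \<epsilon> and v0 x0 :: 'a
    assume f: "continuous_on (sphere 0 1) f" "\<And>v. v \<in> sphere 0 1 \<Longrightarrow> f (- v) = f v"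
       "\<And>v. v \<in> sphere 0 1 \<Longrightarrow> f v \<le> 0"
      and \<epsilon>: "0 < \<epsilon>" "\<epsilon> < \<epsilon>0" and v0: "v0 \<in> sphere 0 1" and x0: "x0 \<in> sphere 0 1"
      and fv0: "f v0 = ln \<epsilon>" and f_ge: "\<And>v. v \<in> sphere 0 1 \<Longrightarrow> ln \<epsilon> \<le> f v"
      and f_x0: "\<And>v. v \<in> sphere 0 1 \<Longrightarrow> \<bar>x0 \<bullet> v\<bar> \<le> exp (f v)"
    have \<epsilon>m: "\<epsilon> \<le> m / 2" using \<epsilon> by (simp add: \<epsilon>0_def)
    have \<epsilon>1: "\<epsilon> < 1" using \<epsilon>m m by simp
    have ln\<epsilon>: "ln \<epsilon> < 0" using \<epsilon> \<epsilon>1 by simp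
    have "\<epsilon> \<le> exp (- (4 * E / m))" using \<epsilon>(2) by (simp add: \<epsilon>0_def)
    then have "ln \<epsilon> \<le> - (4 * E / m)" using \<epsilon>(1) by (metis ln_exp ln_le_cancel_iff exp_gt_zero)
    then have lnE: "(m / 4) * ln \<epsilon> \<le> - E" using m by (simp add: field_simps)
    \<comment> \<open>the body lies in the slab of width \<open>\<epsilon>\<close> orthogonal to \<open>v0\<close>\<close>
    have vol: "ln (volume f) / q \<le> (1 - m / 4) * ln \<epsilon> + ln C / q"
    proof -
      \<comment> \<open>From f \<le> 0 the body lies in the unit ball and its gauge is at least 1 on
        the sphere. That supplies the cut-off in \<open>max\<close> and permits weakening the
        exponent from -q to -s; evenness gives the slab bound for both signs of u . v0.\<close>
      have pw: "wulff_gauge f u powr (- q) \<le> \<epsilon> powr s * max \<epsilon> \<bar>u \<bullet> v0\<bar> powr (- s)"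
        if u: "u \<in> sphere 0 1" for u
      proof -
        have 1: "1 \<le> wulff_gauge f u"
          using wulff_gauge_ge_norm[OF f(1), of 0 u] f(3) u by simp
        have e: "exp (- f v0) = 1 / \<epsilon>" using \<epsilon> by (simp add: fv0 exp_minus inverse_eq_divide)
        have "(u \<bullet> v0) / \<epsilon> \<le> wulff_gauge f u"
          using wulff_gauge_ge[OF f(1) v0, of u] e by simp
        moreover have "(u \<bullet> (- v0)) / \<epsilon> \<le> wulff_gauge f u"
          using wulff_gauge_ge[OF f(1), of "- v0" u] v0 e f(2)[OF v0] by simp
        ultimately have "max \<epsilon> \<bar>u \<bullet> v0\<bar> / \<epsilon> \<le> wulff_gauge f u"
          using 1 \<epsilon> by (auto simp: max_def abs_if)
        then have "wulff_gauge f u powr (- s) \<le> (max \<epsilon> \<bar>u \<bullet> v0\<bar> / \<epsilon>) powr (- s)"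
          using \<epsilon> s by (intro powr_mono2') auto
        also have "\<dots> = \<epsilon> powr s * max \<epsilon> \<bar>u \<bullet> v0\<bar> powr (- s)"
          using \<epsilon> by (simp add: powr_divide powr_minus field_simps)
        finally have "wulff_gauge f u powr (- s) \<le> \<epsilon> powr s * max \<epsilon> \<bar>u \<bullet> v0\<bar> powr (- s)" .
        moreover have "wulff_gauge f u powr (- q) \<le> wulff_gauge f u powr (- s)"
          using 1 s by (intro powr_mono) auto
        ultimately show ?thesis by (rule order_trans[rotated])
      qed
      have im: "integrable M (\<lambda>u. max \<epsilon> \<bar>u \<bullet> v0\<bar> powr (- s))"
        using \<epsilon> by (intro integrable_M continuous_intros) auto
      have "ennreal (\<integral>u. max \<epsilon> \<bar>u \<bullet> v0\<bar> powr (- s) \<partial>M) \<le> ennreal C"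
        using C(2)[of v0 \<epsilon>] v0 \<epsilon> by (subst nn_integral_eq_integral[OF im, symmetric]) auto
      then have le: "(\<integral>u. max \<epsilon> \<bar>u \<bullet> v0\<bar> powr (- s) \<partial>M) \<le> C" using C(1) by (simp add: ennreal_le_iff)
      have "volume f \<le> (\<integral>u. \<epsilon> powr s * max \<epsilon> \<bar>u \<bullet> v0\<bar> powr (- s) \<partial>M)"
        unfolding volume_def
        by (intro integral_mono integrable_M continuous_on_gauge_powr f(1) integrable_mult_right im pw)
           (simp add: space_M)
      moreover have "\<epsilon> powr s * (\<integral>u. max \<epsilon> \<bar>u \<bullet> v0\<bar> powr (- s) \<partial>M) \<le> \<epsilon> powr s * C"
        using le by (intro mult_left_mono) auto
      ultimately have "volume f \<le> \<epsilon> powr s * C" by simp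
      then have "ln (volume f) \<le> ln (\<epsilon> powr s * C)"
        using volume_pos[OF f(1)] by simp
      also have "\<dots> = s * ln \<epsilon> + ln C"
        using \<epsilon> C by (simp add: ln_mult ln_powr)
      finally have "ln (volume f) / q \<le> (s * ln \<epsilon> + ln C) / q"
        using q by (intro divide_right_mono) auto
      then show ?thesis using q by (simp add: s_def add_divide_distrib)
    qed
    \<comment> \<open>concavity of \<open>ln\<close> on \<open>[\<epsilon>, 1]\<close>\<close>
    have f_low: "ln \<epsilon> / (1 - \<epsilon>) * (1 - \<bar>x0 \<bullet> v\<bar>) \<le> f v" if v: "v \<in> sphere 0 1" for v
    proof -
      let ?\<tau> = "\<bar>x0 \<bullet> v\<bar>"
      have \<tau>1: "?\<tau> \<le> 1" using Cauchy_Schwarz_ineq2[of x0 v] x0 v by simp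
      show ?thesis
      proof (cases "?\<tau> \<le> \<epsilon>")
        \<comment> \<open>For values below \<epsilon> the chord of ln lies under ln \<epsilon>, so
          the plain lower bound on \<open>f\<close> is enough.\<close>
        case True
        then have "1 \<le> (1 - ?\<tau>) / (1 - \<epsilon>)" using \<epsilon>1 by simp
        then have "ln \<epsilon> * ((1 - ?\<tau>) / (1 - \<epsilon>)) \<le> ln \<epsilon> * 1"
          using ln\<epsilon> by (intro mult_left_mono_neg) auto
        then show ?thesis using f_ge[OF v] by simp
      next
        case False
        define l where "l = (1 - ?\<tau>) / (1 - \<epsilon>)"
        have l: "0 \<le> l" "l \<le> 1" using \<tau>1 False \<epsilon>1 by (auto simp: l_def)
        have "l * (1 - \<epsilon>) = 1 - ?\<tau>" using \<epsilon>1 by (simp add: l_def)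
        then have "?\<tau> = (1 - l) * 1 + l * \<epsilon>" by (simp add: algebra_simps)
        then have "l * ln \<epsilon> \<le> ln ?\<tau>"
          using concave_onD[OF ln_concave l, of 1 \<epsilon>] \<epsilon> by simp
        also have "\<dots> \<le> ln (exp (f v))"
          using False \<epsilon> f_x0[OF v] by (intro ln_mono) auto
        finally show ?thesis by (simp add: l_def mult.commute)
      qed
    qed
    have "avg (\<lambda>v. ln \<epsilon> / (1 - \<epsilon>) * (1 - \<bar>x0 \<bullet> v\<bar>)) \<le> avg f"
      by (rule avg_mono) (use f f_low \<epsilon>1 in \<open>auto intro!: continuous_intros\<close>)
    also have "avg (\<lambda>v. ln \<epsilon> / (1 - \<epsilon>) * (1 - \<bar>x0 \<bullet> v\<bar>)) =
        ln \<epsilon> / (1 - \<epsilon>) * avg (\<lambda>v. 1 + (-1) * \<bar>x0 \<bullet> v\<bar>)"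
      by (subst avg_mult) simp
    also have "avg (\<lambda>v. 1 + (-1) * \<bar>x0 \<bullet> v\<bar>) = 1 - avg (\<lambda>v. \<bar>x0 \<bullet> v\<bar>)"
      by (subst avg_add, (intro continuous_intros)+, subst avg_mult) simp
    finally have a: "ln \<epsilon> * ((1 - avg (\<lambda>v. \<bar>x0 \<bullet> v\<bar>)) / (1 - \<epsilon>)) \<le> avg f" by simp
    have "(1 - avg (\<lambda>v. \<bar>x0 \<bullet> v\<bar>)) / (1 - \<epsilon>) \<le> (1 - m) / (1 - \<epsilon>)"
      using m(3)[OF x0] \<epsilon>1 by (intro divide_right_mono) auto
    also have "\<dots> \<le> 1 - m / 2"
    proof -
      have "(1 - m / 2) * \<epsilon> \<le> 1 * (m / 2)" using m \<epsilon> \<epsilon>m by (intro mult_mono) auto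
      then have "1 - m \<le> (1 - m / 2) * (1 - \<epsilon>)"
        by (simp add: algebra_simps diff_divide_distrib)
      then show ?thesis using \<epsilon>1 by (simp add: pos_divide_le_eq)
    qed
    finally have "ln \<epsilon> * (1 - m / 2) \<le> ln \<epsilon> * ((1 - avg (\<lambda>v. \<bar>x0 \<bullet> v\<bar>)) / (1 - \<epsilon>))"
      using ln\<epsilon> by (intro mult_left_mono_neg) auto
    with a have "ln \<epsilon> * (1 - m / 2) \<le> avg f" by simp
    with vol have "entropy f \<le> (1 - m / 4) * ln \<epsilon> + ln C / q - ln \<epsilon> * (1 - m / 2)"
      unfolding entropy_def by (rule diff_mono)
    also have "\<dots> = (m / 4) * ln \<epsilon> + ln C / q" by (simp add: algebra_simps)
    also have "\<dots> \<le> entropy (\<lambda>_. 0)" using lnE by (simp add: E_def)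
    finally show "entropy f \<le> entropy (\<lambda>_. 0)" .
  qed
qed

section \<open>Reduction to support functions and existence of a maximiser\<close>

text \<open>
  Replacing \<open>f\<close> by the logarithm of the support function of its Wulff shape, rescaled to have
  circumradius 1, does not decrease the functional.
\<close>

lemma entropy_le_support:
  assumes f: "continuous_on (sphere 0 1) f" "\<And>v. v \<in> sphere 0 1 \<Longrightarrow> f (- v) = f v"
  obtains h x0 where "x0 \<in> sphere 0 1"
    "\<And>v. v \<in> sphere 0 1 \<Longrightarrow> 0 < h v" "\<And>v. v \<in> sphere 0 1 \<Longrightarrow> h v \<le> 1"
    "\<And>v. v \<in> sphere 0 1 \<Longrightarrow> h (- v) = h v" "\<And>v. v \<in> sphere 0 1 \<Longrightarrow> \<bar>x0 \<bullet> v\<bar> \<le> h v"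
    "\<And>v w. v \<in> sphere 0 1 \<Longrightarrow> w \<in> sphere 0 1 \<Longrightarrow> \<bar>h v - h w\<bar> \<le> norm (v - w)"
    "entropy f \<le> entropy (\<lambda>v. ln (h v))"
proof -
  let ?N = "wulff_gauge f"
  obtain B where B: "0 < B" "\<And>v. v \<in> sphere 0 1 \<Longrightarrow> \<bar>f v\<bar> \<le> B"
    using continuous_on_sphere_bounded[OF f(1)] by blast
  define K where "K = {x. ?N x \<le> 1}"
  have Kc: "closed K" unfolding K_def
    by (intro closed_Collect_le continuous_intros continuous_on_wulff_gauge f)
  have Nlow: "exp (- B) * norm x \<le> ?N x" for x
    by (rule wulff_gauge_ge_norm[OF f(1)]) (use B in force)
  have Kb: "norm x \<le> exp B" if "x \<in> K" for x
  proof -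
    have "exp (- B) * norm x \<le> 1" using Nlow[of x] that by (simp add: K_def)
    then show ?thesis by (simp add: exp_minus field_simps)
  qed
  have Kcomp: "compact K"
    using Kc Kb by (auto simp: compact_eq_bounded_closed bounded_iff)
  have K0: "0 \<in> K" by (simp add: K_def f)
  then have Kne: "K \<noteq> {}" by blast
  have Kneg: "- x \<in> K" if "x \<in> K" for x
    using that wulff_gauge_uminus[OF f] by (simp add: K_def)
  have Kbig: "exp (- B) *\<^sub>R v \<in> K" if "v \<in> sphere 0 1" for v
  proof -
    have "?N v \<le> exp B * norm v"
      using wulff_gauge_le_norm[OF f(1), of "- B" v] B(2) by force
    then have "exp (- B) * ?N v \<le> 1" using that by (simp add: exp_minus field_simps)
    then show ?thesis by (simp add: K_def wulff_gauge_scale[OF f(1)])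
  qed
  \<comment> \<open>A farthest point. Its norm is the circumradius about the origin, and since x1
    and -x1 both lie in \<open>K\<close>, the unit vector x1 / R will satisfy |x0 . v| \<le>
    h(v).\<close>
  obtain x1 where x1: "x1 \<in> K" "\<And>x. x \<in> K \<Longrightarrow> norm x \<le> norm x1"
    using continuous_attains_sup[OF Kcomp Kne continuous_on_norm_id] by blast
  define R where "R = norm x1"
  have R: "0 < R"
  proof -
    obtain v :: 'a where "v \<in> sphere 0 1" using sphere_nonempty by blast
    with x1(2)[OF Kbig[OF this]] have "exp (- B) \<le> R" by (simp add: R_def)
    then show ?thesis by (meson exp_gt_zero order_less_le_trans)
  qed
  define H where "H v = (SUP x\<in>K. x \<bullet> v)" for v
  have H_attained: "\<exists>x\<in>K. H v = x \<bullet> v \<and> (\<forall>y\<in>K. y \<bullet> v \<le> H v)" for v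
  proof -
    have "continuous_on K (\<lambda>x. x \<bullet> v)" by (intro continuous_intros)
    from continuous_attains_sup[OF Kcomp Kne this]
    obtain x where x: "x \<in> K" "\<forall>y\<in>K. y \<bullet> v \<le> x \<bullet> v" by blast
    then have "H v = x \<bullet> v" unfolding H_def by (intro cSup_eq_maximum) auto
    with x show ?thesis by metis
  qed
  have H_ge: "y \<bullet> v \<le> H v" if "y \<in> K" for y v using H_attained that by metis
  have H_le: "H v \<le> R" if "v \<in> sphere 0 1" for v
  proof -
    obtain x where x: "x \<in> K" "H v = x \<bullet> v" using H_attained by blast
    have "x \<bullet> v \<le> norm x * norm v" by (rule norm_cauchy_schwarz)
    then show ?thesis using x1(2)[OF x(1)] that x(2) by (simp add: R_def)
  qed
  have H_f: "H v \<le> exp (f v)" if v: "v \<in> sphere 0 1" for v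
  proof -
    obtain x where x: "x \<in> K" "H v = x \<bullet> v" using H_attained by blast
    have "(x \<bullet> v) * exp (- f v) \<le> 1"
      using wulff_gauge_ge[OF f(1) v, of x] x(1) by (simp add: K_def)
    then show ?thesis using x(2) by (simp add: exp_minus field_simps)
  qed
  have H_lip: "\<bar>H v - H w\<bar> \<le> R * norm (v - w)" for v w
  proof -
    have "H v \<le> H w + R * norm (v - w)" for v w
    proof -
      obtain x where x: "x \<in> K" "H v = x \<bullet> v" using H_attained by blast
      have "x \<bullet> (v - w) \<le> norm x * norm (v - w)" by (rule norm_cauchy_schwarz)
      also have "\<dots> \<le> R * norm (v - w)" using x1(2)[OF x(1)] by (simp add: R_def mult_right_mono)
      finally show ?thesis using x H_ge[OF x(1), of w] by (simp add: inner_diff_right)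
    qed
    from this[of v w] this[of w v] show ?thesis by (simp add: abs_le_iff norm_minus_commute)
  qed
  have H_neg: "H (- v) = H v" for v
  proof -
    have "H v \<le> H (- v)" for v
    proof -
      obtain x where x: "x \<in> K" "H v = x \<bullet> v" using H_attained by blast
      show ?thesis using H_ge[OF Kneg[OF x(1)], of "- v"] x(2) by simp
    qed
    from this[of v] this[of "- v"] show ?thesis by simp
  qed
  have H_pos: "0 < H v" if "v \<in> sphere 0 1" for v
  proof -
    have "(exp (- B) *\<^sub>R v) \<bullet> v \<le> H v" by (rule H_ge[OF Kbig[OF that]])
    moreover have "(exp (- B) *\<^sub>R v) \<bullet> v = exp (- B)" using that by (simp add: norm_eq_1)
    ultimately show ?thesis by (metis exp_gt_zero order_less_le_trans)
  qed
  define h where "h v = H v / R" for v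
  have h_pos: "0 < h v" if "v \<in> sphere 0 1" for v using H_pos[OF that] R by (simp add: h_def)
  have h_lip: "\<bar>h v - h w\<bar> \<le> norm (v - w)" for v w
  proof -
    have "h v - h w = (H v - H w) / R" by (simp add: h_def diff_divide_distrib)
    then have "\<bar>h v - h w\<bar> = \<bar>H v - H w\<bar> / R" using R by simp
    also have "\<dots> \<le> (R * norm (v - w)) / R" using H_lip R by (intro divide_right_mono) auto
    finally show ?thesis using R by simp
  qed
  have "1-lipschitz_on (sphere 0 1) h" using h_lip by (auto intro!: lipschitz_onI simp: dist_norm)
  then have "continuous_on (sphere 0 1) h" by (rule lipschitz_on_continuous_on)
  then have lnh: "continuous_on (sphere 0 1) (\<lambda>v. ln (h v))"
    using h_pos by (intro continuous_intros) force+
  have ln_eq: "ln (h v) = ln (H v) - ln R" if "v \<in> sphere 0 1" for v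
    using H_pos[OF that] R by (simp add: h_def ln_div)
  define g where "g v = ln (H v)" for v
  have g_eq: "g v = ln (h v) + ln R" if "v \<in> sphere 0 1" for v
    using ln_eq[OF that] by (simp add: g_def)
  have gc: "continuous_on (sphere 0 1) g"
    using continuous_on_add[OF lnh continuous_on_const[of _ "ln R"]]
    by (rule continuous_on_eq) (simp add: g_eq)
  have g_le: "g v \<le> f v" if "v \<in> sphere 0 1" for v
    unfolding g_def using H_f[OF that] H_pos[OF that] by (metis ln_exp ln_mono)
  \<comment> \<open>As x . v \<le> N(x) H(v), the Wulff shape of the support function contains
    \<open>K\<close>, so the integral does not drop, while \<open>g_le\<close> says that the mean
    does not grow. The later division by \<open>R\<close> shifts both terms by ln R.\<close>
  have Ng: "wulff_gauge g x \<le> ?N x" for x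
  proof (rule wulff_gauge_le[OF gc])
    fix v :: 'a assume v: "v \<in> sphere 0 1"
    have "x \<bullet> v \<le> ?N x * H v"
    proof (cases "x = 0")
      case False
      then have p: "0 < ?N x" by (rule wulff_gauge_pos[OF f(1)])
      have "inverse (?N x) *\<^sub>R x \<in> K"
        using p by (simp add: K_def wulff_gauge_scale[OF f(1)])
      from H_ge[OF this, of v] show ?thesis using p by (simp add: field_simps)
    qed (simp add: f)
    then show "(x \<bullet> v) * exp (- g v) \<le> ?N x"
      using H_pos[OF v] by (simp add: g_def exp_minus field_simps)
  qed
  have vol: "volume f \<le> volume g" unfolding volume_def
  proof (intro integral_mono integrable_M continuous_on_gauge_powr f(1) gc)
    fix u assume "u \<in> space M"
    then have "u \<noteq> 0" by (auto simp: space_M)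
    then show "?N u powr (- q) \<le> wulff_gauge g u powr (- q)"
      using Ng[of u] wulff_gauge_pos[OF gc, of u] q by (intro powr_mono2') auto
  qed
  have "ln (volume f) / q \<le> ln (volume g) / q"
    using vol volume_pos[OF f(1)] q by (intro divide_right_mono ln_mono) auto
  also have "\<dots> \<le> ln (volume (\<lambda>v. ln (h v))) / q + ln R"
    by (rule ln_volume_mono[OF gc lnh]) (simp add: g_eq)
  finally have 1: "ln (volume f) / q \<le> ln (volume (\<lambda>v. ln (h v))) / q + ln R" .
  have "avg (\<lambda>v. ln (h v) + ln R) \<le> avg f"
    by (rule avg_mono) (use lnh f g_le g_eq in \<open>auto intro!: continuous_intros\<close>)
  then have "avg (\<lambda>v. ln (h v)) + ln R \<le> avg f"
    using avg_add[OF lnh continuous_on_const, of "ln R"] by simp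
  with 1 have ent: "entropy f \<le> entropy (\<lambda>v. ln (h v))" by (simp add: entropy_def)
  show thesis
  proof (rule that[of "x1 /\<^sub>R R" h])
    show "x1 /\<^sub>R R \<in> sphere 0 1" using R by (simp add: R_def)
    show "h v \<le> 1" if "v \<in> sphere 0 1" for v using H_le[OF that] R by (simp add: h_def)
    show "\<bar>(x1 /\<^sub>R R) \<bullet> v\<bar> \<le> h v" for v
    proof -
      have "\<bar>x1 \<bullet> v\<bar> \<le> H v" using H_ge[OF x1(1), of v] H_ge[OF Kneg[OF x1(1)], of v] by (simp add: abs_le_iff)
      then show ?thesis using R by (simp add: h_def abs_mult divide_inverse mult.commute)
    qed
  qed (use h_pos h_lip ent H_neg in \<open>auto simp: h_def\<close>)
qed

text \<open>Every even competitor is dominated by a member of the equicontinuous, uniformly bounded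
  class \<open>\<C>\<close>, so a maximising sequence can be chosen there and has a uniformly
  convergent subsequence. Its limit only has to be continuous and even.\<close>

lemma entropy_maximizer:
  obtains f where "continuous_on (sphere 0 1) f" "\<And>v. v \<in> sphere 0 1 \<Longrightarrow> f (- v) = f v"
    "\<And>g. continuous_on (sphere 0 1) g \<Longrightarrow> (\<And>v. v \<in> sphere 0 1 \<Longrightarrow> g (- v) = g v) \<Longrightarrow>
       entropy g \<le> entropy f"
proof -
  obtain \<epsilon> where \<epsilon>: "0 < \<epsilon>" "\<epsilon> < 1"
    and degenerate: "\<And>f \<delta> v0 x0. \<lbrakk>continuous_on (sphere 0 1) f; \<And>v. v \<in> sphere 0 1 \<Longrightarrow> f (- v) = f v;
       \<And>v. v \<in> sphere 0 1 \<Longrightarrow> f v \<le> 0; 0 < \<delta>; \<delta> < \<epsilon>; v0 \<in> sphere 0 1; x0 \<in> sphere 0 1;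
       f v0 = ln \<delta>; \<And>v. v \<in> sphere 0 1 \<Longrightarrow> ln \<delta> \<le> f v;
       \<And>v. v \<in> sphere 0 1 \<Longrightarrow> \<bar>x0 \<bullet> v\<bar> \<le> exp (f v)\<rbrakk> \<Longrightarrow> entropy f \<le> entropy (\<lambda>_. 0)"
    using entropy_degenerate by metis
  \<comment> \<open>The Lipschitz constant 1 / \<epsilon> is that of ln on [\<epsilon>, 1], applied
    to a 1-Lipschitz support function.\<close>
  define \<C> where "\<C> = {f :: 'a \<Rightarrow> real. (\<forall>v\<in>sphere 0 1. f (- v) = f v \<and> ln \<epsilon> \<le> f v \<and> f v \<le> 0) \<and>
    (\<forall>v\<in>sphere 0 1. \<forall>w\<in>sphere 0 1. \<bar>f v - f w\<bar> \<le> norm (v - w) / \<epsilon>)}"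
  have \<C>_cont: "continuous_on (sphere 0 1) f" if "f \<in> \<C>" for f
  proof -
    have "(1/\<epsilon>)-lipschitz_on (sphere 0 1) f"
      using that \<epsilon> by (intro lipschitz_onI) (auto simp: \<C>_def dist_norm)
    then show ?thesis by (rule lipschitz_on_continuous_on)
  qed
  have zero: "(\<lambda>_. 0) \<in> \<C>" using \<epsilon> by (auto simp: \<C>_def)
  have dom: "\<exists>g\<in>\<C>. entropy f \<le> entropy g"
    if f: "continuous_on (sphere 0 1) f" "\<And>v. v \<in> sphere 0 1 \<Longrightarrow> f (- v) = f v" for f
  proof -
    obtain h x0 where h: "x0 \<in> sphere 0 1"
    "\<And>v. v \<in> sphere 0 1 \<Longrightarrow> 0 < h v" "\<And>v. v \<in> sphere 0 1 \<Longrightarrow> h v \<le> 1"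
    "\<And>v. v \<in> sphere 0 1 \<Longrightarrow> h (- v) = h v" "\<And>v. v \<in> sphere 0 1 \<Longrightarrow> \<bar>x0 \<bullet> v\<bar> \<le> h v"
    "\<And>v w. v \<in> sphere 0 1 \<Longrightarrow> w \<in> sphere 0 1 \<Longrightarrow> \<bar>h v - h w\<bar> \<le> norm (v - w)"
    "entropy f \<le> entropy (\<lambda>v. ln (h v))"
      using entropy_le_support[OF f] by metis
    have "1-lipschitz_on (sphere 0 1) h" using h(6) by (auto intro!: lipschitz_onI simp: dist_norm)
    then have hc: "continuous_on (sphere 0 1) h" by (rule lipschitz_on_continuous_on)
    have lnh: "continuous_on (sphere 0 1) (\<lambda>v. ln (h v))"
      using h(2) by (intro continuous_intros hc) force+
    obtain v0 where v0: "v0 \<in> sphere 0 1" "\<And>v. v \<in> sphere 0 1 \<Longrightarrow> h v0 \<le> h v"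
      using continuous_attains_inf[OF compact_sphere sphere_nonempty hc] by blast
    show ?thesis
    \<comment> \<open>Thin bodies do no better than the unit ball, whose function 0 already belongs
      to \<open>\<C>\<close>.\<close>
    proof (cases "h v0 < \<epsilon>")
      case True
      have "entropy (\<lambda>v. ln (h v)) \<le> entropy (\<lambda>_. 0)"
      proof (rule degenerate[of _ "h v0" v0 x0])
        fix v :: 'a assume v: "v \<in> sphere 0 1"
        show "ln (h (- v)) = ln (h v)" by (simp add: h(4)[OF v])
        show "ln (h v) \<le> 0" using h(2,3)[OF v] by simp
        show "ln (h v0) \<le> ln (h v)" using v0(2)[OF v] h(2)[OF v0(1)] by (rule ln_mono)
        show "\<bar>x0 \<bullet> v\<bar> \<le> exp (ln (h v))" using h(2,5)[OF v] by simp
      qed (use lnh True h(1) h(2)[OF v0(1)] v0(1) in auto)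
      with h(7) zero show ?thesis by (blast intro: order_trans)
    next
      case False
      have ge: "\<epsilon> \<le> h v" if "v \<in> sphere 0 1" for v using False v0(2)[OF that] by simp
      have "(\<lambda>v. ln (h v)) \<in> \<C>"
        unfolding \<C>_def
      proof (intro CollectI conjI ballI)
        fix v :: 'a assume v: "v \<in> sphere 0 1"
        show "ln (h (- v)) = ln (h v)" by (simp add: h(4)[OF v])
        show "ln (h v) \<le> 0" using h(2,3)[OF v] by simp
        show "ln \<epsilon> \<le> ln (h v)" using ge[OF v] \<epsilon>(1) by (rule ln_mono)
        fix w :: 'a assume w: "w \<in> sphere 0 1"
        have "\<bar>ln (h v) - ln (h w)\<bar> \<le> \<bar>h v - h w\<bar> / \<epsilon>"
          by (rule ln_diff_le[OF ge[OF v] ge[OF w] \<epsilon>(1)])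
        also have "\<dots> \<le> norm (v - w) / \<epsilon>" using h(6)[OF v w] \<epsilon>(1) by (intro divide_right_mono) auto
        finally show "\<bar>ln (h v) - ln (h w)\<bar> \<le> norm (v - w) / \<epsilon>" .
      qed
      with h(7) show ?thesis by blast
    qed
  qed
  have bdd: "bdd_above (entropy ` \<C>)"
  proof (rule bdd_aboveI2)
    fix f assume f: "f \<in> \<C>"
    have "entropy f \<le> entropy (\<lambda>_. 0) + 2 * \<bar>ln \<epsilon>\<bar>"
    proof (rule entropy_le_add[OF \<C>_cont[OF f] continuous_on_const])
      fix v :: 'a assume "v \<in> sphere 0 1"
      with f have "ln \<epsilon> \<le> f v" "f v \<le> 0" by (auto simp: \<C>_def)
      then show "\<bar>f v - 0\<bar> \<le> \<bar>ln \<epsilon>\<bar>" by simp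
    qed
    then show "entropy f \<le> entropy (\<lambda>_. 0) + 2 * \<bar>ln \<epsilon>\<bar>" .
  qed
  define s where "s = (SUP f\<in>\<C>. entropy f)"
  have "\<exists>f\<in>\<C>. s - inverse (real (Suc n)) < entropy f" for n
  proof -
    have "s - inverse (real (Suc n)) < s" by simp
    then show ?thesis unfolding s_def using less_cSUP_iff[of \<C> entropy] bdd zero by blast
  qed
  then obtain F where F: "\<And>n. F n \<in> \<C>" "\<And>n. s - inverse (real (Suc n)) < entropy (F n)" by metis
  obtain f r where f: "continuous_on (sphere 0 1) f" "strict_mono (r :: nat \<Rightarrow> nat)"
    and conv: "\<And>e. 0 < e \<Longrightarrow> \<exists>N. \<forall>n x. n \<ge> N \<and> x \<in> sphere 0 1 \<longrightarrow> norm (F (r n) x - f x) < e"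
  proof (rule Arzela_Ascoli[of "sphere (0::'a) 1" F "\<bar>ln \<epsilon>\<bar>"])
    show "norm (F n x) \<le> \<bar>ln \<epsilon>\<bar>" if "x \<in> sphere 0 1" for n x
    proof -
      have "ln \<epsilon> \<le> F n x" "F n x \<le> 0" using F(1)[of n] that by (auto simp: \<C>_def)
      then show ?thesis by simp
    qed
    show "\<exists>d>0. \<forall>n y. y \<in> sphere 0 1 \<and> norm (x - y) < d \<longrightarrow> norm (F n x - F n y) < e"
      if "x \<in> sphere 0 1" "0 < e" for x e
    proof (intro exI[of _ "e * \<epsilon>"] conjI allI impI)
      show "0 < e * \<epsilon>" using that \<epsilon> by simp
      fix n y assume y: "y \<in> sphere 0 1 \<and> norm (x - y) < e * \<epsilon>"
      have "norm (F n x - F n y) \<le> norm (x - y) / \<epsilon>" using F(1)[of n] that y by (auto simp: \<C>_def)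
      also have "\<dots> < e" using y \<epsilon> by (simp add: field_simps)
      finally show "norm (F n x - F n y) < e" .
    qed
  qed (auto intro: that)
  have pw: "(\<lambda>n. F (r n) x) \<longlonglongrightarrow> f x" if "x \<in> sphere 0 1" for x
    using conv that by (fastforce simp: lim_sequentially dist_norm)
  have f_even: "f (- v) = f v" if "v \<in> sphere 0 1" for v
  proof -
    have "(\<lambda>n. F (r n) (- v)) \<longlonglongrightarrow> f (- v)" using that by (intro pw) simp
    moreover have "F n (- v) = F n v" for n using F(1)[of n] that by (auto simp: \<C>_def)
    ultimately show ?thesis using pw[OF that] LIMSEQ_unique by auto
  qed
  have "s \<le> entropy f"
  proof (rule field_le_epsilon)
    fix e :: real assume e: "0 < e"
    \<comment> \<open>\<open>entropy_le_add\<close> doubles the uniform distance, so e / 4 costs e /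
      2; the other half is spent on the approximation of the supremum.\<close>
    obtain N where N: "\<And>n x. n \<ge> N \<Longrightarrow> x \<in> sphere 0 1 \<Longrightarrow> norm (F (r n) x - f x) < e / 4"
      using conv[of "e / 4"] e by auto
    obtain k where k: "inverse (real (Suc k)) < e / 2" using reals_Archimedean[of "e / 2"] e by auto
    define n where "n = max N k"
    have "k \<le> r n" using seq_suble[OF f(2), of n] by (simp add: n_def)
    then have "inverse (real (Suc (r n))) \<le> inverse (real (Suc k))" by simp
    then have "s - e / 2 < entropy (F (r n))" using F(2)[of "r n"] k by linarith
    also have "\<dots> \<le> entropy f + 2 * (e / 4)"
      by (rule entropy_le_add[OF \<C>_cont[OF F(1)] f(1)])
         (use N[of n] in \<open>force simp: n_def\<close>)
    finally show "s \<le> entropy f + e" by simp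
  qed
  moreover have "entropy g \<le> s" if "g \<in> \<C>" for g
    unfolding s_def using that bdd by (rule cSUP_upper)
  ultimately show thesis
    using that[OF f(1) f_even] dom by (meson order_trans)
qed

end

section \<open>The first variation\<close>

text \<open>A subsequence staying away from \<open>a\<close> would, by compactness, accumulate at a
  second point where \<open>\<phi>\<close> takes the value m. It makes almost-maximisers converge to
  a unique maximiser.\<close>

lemma compact_unique_limit:
  fixes \<phi> :: "'a::metric_space \<Rightarrow> real"
  assumes "compact S" "continuous_on S \<phi>" "\<And>k::nat. v k \<in> S" "(\<lambda>k. \<phi> (v k)) \<longlonglongrightarrow> m"
    and unique: "\<And>w. w \<in> S \<Longrightarrow> \<phi> w = m \<Longrightarrow> w = a"
  shows "v \<longlonglongrightarrow> a"
proof (rule ccontr)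
  assume "\<not> v \<longlonglongrightarrow> a"
  then obtain e where e: "e > 0" "\<exists>\<^sub>F k in sequentially. e \<le> dist (v k) a"
    by (auto simp: tendsto_iff not_eventually not_less)
  then have "infinite {k. e \<le> dist (v k) a}"
    by (simp add: frequently_cofinite cofinite_eq_sequentially[symmetric])
  from infinite_enumerate[OF this]
  obtain r :: "nat \<Rightarrow> nat" where r: "strict_mono r" "\<And>k. e \<le> dist (v (r k)) a" by blast
  obtain l r' where l: "l \<in> S" "strict_mono (r' :: nat \<Rightarrow> nat)" "((\<lambda>k. v (r k)) \<circ> r') \<longlonglongrightarrow> l"
    using seq_compactE[OF assms(1)[unfolded compact_eq_seq_compact_metric], of "\<lambda>k. v (r k)"] assms(3) by metis
  have "(\<lambda>k. \<phi> (v (r (r' k)))) \<longlonglongrightarrow> \<phi> l"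
    using continuous_on_tendsto_compose[OF assms(2) _ l(1), of "\<lambda>k. v (r (r' k))" sequentially] l(3) assms(3)
    by (simp add: o_def)
  moreover have "(\<lambda>k. \<phi> (v (r (r' k)))) \<longlonglongrightarrow> m"
    using LIMSEQ_subseq_LIMSEQ[OF LIMSEQ_subseq_LIMSEQ[OF assms(4) r(1)] l(2)] by (simp add: o_def)
  ultimately have "l = a" using unique[OF l(1)] LIMSEQ_unique by blast
  then have "(\<lambda>k. dist (v (r (r' k))) a) \<longlonglongrightarrow> 0"
    using l(3) unfolding o_def by (intro tendsto_dist_iff[THEN iffD1]) simp
  then have "e \<le> 0" by (rule LIMSEQ_le_const) (use r in auto)
  with e show False by simp
qed

text \<open>
  Outside \<open>smooth_points\<close> the value is irrelevant; the identity keeps the map odd.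
\<close>

definition radial_gauss_map :: "('a::euclidean_space \<Rightarrow> real) \<Rightarrow> 'a \<Rightarrow> 'a" where
  "radial_gauss_map f u = (if u \<in> smooth_points (wulff_gauge f)
     then (THE v. v \<in> sphere 0 1 \<and> (u \<bullet> v) * exp (- f v) = wulff_gauge f u) else u)"

text \<open>A maximiser v at u yields the subgradient exp(- f v) v of the gauge at u. Subgradients
  are unique there, and the norm of this vector separates the factor from the direction.\<close>

lemma wulff_gauge_maximizer_unique:
  assumes f: "continuous_on (sphere 0 1) f" and u: "u \<in> smooth_points (wulff_gauge f)"
    and v: "v \<in> sphere 0 1" "(u \<bullet> v) * exp (- f v) = wulff_gauge f u"
    and w: "w \<in> sphere 0 1" "(u \<bullet> w) * exp (- f w) = wulff_gauge f u"
  shows "v = w"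
proof -
  have eq: "exp (- f v) *\<^sub>R v = exp (- f w) *\<^sub>R w"
    by (rule smooth_points_unique_subgradient[OF u])
       (use v w wulff_gauge_ge[OF f v(1)] wulff_gauge_ge[OF f w(1)] in \<open>auto simp: mult.commute inner_commute\<close>)
  then have "norm (exp (- f v) *\<^sub>R v) = norm (exp (- f w) *\<^sub>R w)" by simp
  then have "exp (- f v) = exp (- f w)" using v(1) w(1) by simp
  with eq show ?thesis by simp
qed

lemma radial_gauss_map_smooth:
  assumes f: "continuous_on (sphere 0 1) f" and u: "u \<in> smooth_points (wulff_gauge f)"
  shows "radial_gauss_map f u \<in> sphere 0 1"
    and "(u \<bullet> radial_gauss_map f u) * exp (- f (radial_gauss_map f u)) = wulff_gauge f u"
proof -
  obtain v where v: "v \<in> sphere 0 1" "(u \<bullet> v) * exp (- f v) = wulff_gauge f u"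
    using wulff_gauge_attained[OF f] by metis
  have "\<exists>!v. v \<in> sphere 0 1 \<and> (u \<bullet> v) * exp (- f v) = wulff_gauge f u"
    using v wulff_gauge_maximizer_unique[OF f u] by blast
  from theI'[OF this] show "radial_gauss_map f u \<in> sphere 0 1"
    "(u \<bullet> radial_gauss_map f u) * exp (- f (radial_gauss_map f u)) = wulff_gauge f u"
    using u by (simp_all add: radial_gauss_map_def)
qed

lemma radial_gauss_map_eqI:
  assumes "continuous_on (sphere 0 1) f" "u \<in> smooth_points (wulff_gauge f)"
    and "v \<in> sphere 0 1" "(u \<bullet> v) * exp (- f v) = wulff_gauge f u"
  shows "radial_gauss_map f u = v"
  using wulff_gauge_maximizer_unique[OF assms(1,2) radial_gauss_map_smooth[OF assms(1,2)] assms(3,4)] .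

lemma radial_gauss_map_in_sphere:
  assumes "continuous_on (sphere 0 1) f" "u \<in> sphere 0 1"
  shows "radial_gauss_map f u \<in> sphere 0 1"
  using radial_gauss_map_smooth(1)[OF assms(1)] assms(2)
  by (cases "u \<in> smooth_points (wulff_gauge f)") (auto simp: radial_gauss_map_def)

lemma radial_gauss_map_uminus:
  assumes f: "continuous_on (sphere 0 1) f" "\<And>v. v \<in> sphere 0 1 \<Longrightarrow> f (- v) = f v"
  shows "radial_gauss_map f (- u) = - radial_gauss_map f u"
proof -
  note N = wulff_gauge_uminus[OF f]
  have iff: "- u \<in> smooth_points (wulff_gauge f) \<longleftrightarrow> u \<in> smooth_points (wulff_gauge f)"
    using smooth_points_uminus[of "wulff_gauge f" u, OF N] smooth_points_uminus[of "wulff_gauge f" "- u", OF N] by auto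
  show ?thesis
  proof (cases "u \<in> smooth_points (wulff_gauge f)")
    case True
    show ?thesis
      by (rule radial_gauss_map_eqI[OF f(1)])
         (use True iff radial_gauss_map_smooth[OF f(1) True] f(2) N in auto)
  qed (simp add: iff radial_gauss_map_def)
qed

text \<open>On the smooth points the map is even continuous: its graph is the closed relation "v is
  a maximiser at u", and its values lie in a compact set. The identity on the rest and Borel
  measurability of the smooth points complete the argument.\<close>

lemma measurable_radial_gauss_map:
  fixes f :: "'a::euclidean_space \<Rightarrow> real"
  assumes f: "continuous_on (sphere 0 1) f"
  shows "radial_gauss_map f \<in> measurable sphere_borel sphere_borel"
proof -
  let ?S = "sphere (0::'a) 1" and ?G = "smooth_points (wulff_gauge f)"
  have G: "?G \<in> sets borel" by (rule smooth_points_borel[OF continuous_on_wulff_gauge[OF f]])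
  let ?g = "\<lambda>u. THE v. v \<in> ?S \<and> (u \<bullet> v) * exp (- f v) = wulff_gauge f u"
  have g: "?g u = radial_gauss_map f u" if "u \<in> ?G" for u using that by (simp add: radial_gauss_map_def)
  have cont: "continuous_on (?S \<inter> ?G) (radial_gauss_map f)"
  proof -
    have im: "radial_gauss_map f \<in> ?S \<inter> ?G \<rightarrow> ?S" using radial_gauss_map_in_sphere[OF f] by auto
    have c: "continuous_on (UNIV \<times> ?S) (\<lambda>z. (fst z \<bullet> snd z) * exp (- f (snd z)) - wulff_gauge f (fst z))"
      by (intro continuous_intros continuous_on_compose2[OF f]
          continuous_on_compose2[OF continuous_on_wulff_gauge[OF f, of UNIV]]) auto
    have "closed (UNIV \<times> ?S)" by (intro closed_Times) auto
    then have "closed ((UNIV \<times> ?S) \<inter> (\<lambda>z. (fst z \<bullet> snd z) * exp (- f (snd z)) - wulff_gauge f (fst z)) -` {0})"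
      using continuous_closed_preimage[OF c] by blast
    then have "closedin (top_of_set ((?S \<inter> ?G) \<times> ?S)) (((?S \<inter> ?G) \<times> ?S) \<inter>
       ((UNIV \<times> ?S) \<inter> (\<lambda>z. (fst z \<bullet> snd z) * exp (- f (snd z)) - wulff_gauge f (fst z)) -` {0}))"
      by (rule closedin_closed_Int)
    also have "((?S \<inter> ?G) \<times> ?S) \<inter>
       ((UNIV \<times> ?S) \<inter> (\<lambda>z. (fst z \<bullet> snd z) * exp (- f (snd z)) - wulff_gauge f (fst z)) -` {0}) =
       (\<lambda>u. (u, radial_gauss_map f u)) ` (?S \<inter> ?G)"
    proof (intro set_eqI iffI)
      fix z assume "z \<in> ((?S \<inter> ?G) \<times> ?S) \<inter>
       ((UNIV \<times> ?S) \<inter> (\<lambda>z. (fst z \<bullet> snd z) * exp (- f (snd z)) - wulff_gauge f (fst z)) -` {0})"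
      then have z: "fst z \<in> ?S \<inter> ?G" "snd z \<in> ?S"
        "(fst z \<bullet> snd z) * exp (- f (snd z)) = wulff_gauge f (fst z)" by auto
      then have "z = (fst z, radial_gauss_map f (fst z))"
        using radial_gauss_map_eqI[OF f, of "fst z" "snd z"] by simp
      with z(1) show "z \<in> (\<lambda>u. (u, radial_gauss_map f u)) ` (?S \<inter> ?G)" by blast
    qed (use radial_gauss_map_smooth[OF f] in auto)
    finally show ?thesis
      using continuous_closed_graph_eq[OF compact_sphere im] by simp
  qed
  have "(\<lambda>u. if u \<in> ?G then ?g u else u) \<in> borel_measurable sphere_borel"
  proof -
    have s: "{u \<in> space sphere_borel. u \<in> ?G} \<in> sets sphere_borel"
      using G by (auto simp: sets_sphere_borel_iff Int_def[symmetric] borel_closed)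
    have "radial_gauss_map f \<in> borel_measurable (restrict_space borel (?S \<inter> ?G))"
      by (rule borel_measurable_continuous_on_restrict[OF cont])
    then have "radial_gauss_map f \<in> borel_measurable (restrict_space sphere_borel ?G)"
      by (simp add: sphere_borel_def restrict_restrict_space borel_closed G)
    moreover have "?g u = radial_gauss_map f u" if "u \<in> space (restrict_space sphere_borel ?G)" for u
      by (rule g) (use that in \<open>simp add: space_restrict_space\<close>)
    ultimately have "?g \<in> borel_measurable (restrict_space sphere_borel {u. u \<in> ?G})"
      using measurable_cong[of "restrict_space sphere_borel ?G" ?g "radial_gauss_map f" borel] by simp
    moreover have "(\<lambda>u. u) \<in> borel_measurable (restrict_space sphere_borel {u. u \<notin> ?G})"
      unfolding sphere_borel_def by (intro measurable_restrict_space1) simp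
    ultimately show ?thesis by (intro measurable_If_restrict_space_iff[OF s, THEN iffD2] conjI)
  qed
  then have "radial_gauss_map f \<in> borel_measurable sphere_borel"
    by (subst measurable_cong[of _ _ "\<lambda>u. if u \<in> ?G then ?g u else u"]) (auto simp: radial_gauss_map_def)
  then show ?thesis
    using radial_gauss_map_in_sphere[OF f]
    by (subst (2) sphere_borel_def) (intro measurable_restrict_space2, auto)
qed

text \<open>A bound free of t, wanted as a majorant for dominated convergence; it comes from exp x -
  1 \<le> x exp x.\<close>

lemma exp_mult_diff_quotient_bound:
  fixes a t B c :: real
  assumes "0 < t" "t \<le> 1" "\<bar>a\<bar> \<le> B" "0 < c"
  shows "(exp (c * t * a) - 1) / t \<le> c * B * exp (c * B)"
proof -
  let ?x = "c * t * a"
  have x: "?x \<le> t * (c * B)"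
    using assms by (simp add: mult_ac mult_left_mono)
  have B: "0 \<le> B" using assms(3) by simp
  have "1 - ?x \<le> exp (- ?x)" using exp_ge_add_one_self[of "- ?x"] by simp
  then have "(1 - ?x) * exp ?x \<le> exp (- ?x) * exp ?x" by (intro mult_right_mono) auto
  then have "exp ?x - 1 \<le> ?x * exp ?x" by (simp add: exp_minus algebra_simps)
  also have "\<dots> \<le> (t * (c * B)) * exp ?x" using x by (intro mult_right_mono) auto
  also have "\<dots> \<le> (t * (c * B)) * exp (c * B)"
  proof (intro mult_left_mono)
    have "t * (c * B) \<le> 1 * (c * B)" using assms B by (intro mult_right_mono) auto
    with x show "exp ?x \<le> exp (c * B)" by simp
  qed (use assms B in auto)
  finally show ?thesis using assms(1) by (simp add: field_simps)
qed

lemma exp_mult_diff_quotient_tendsto: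
  "(\<lambda>k. (exp (c * inverse (real (Suc k)) * a) - 1) / inverse (real (Suc k))) \<longlonglongrightarrow> c * a"
proof -
  have "((\<lambda>t. exp (c * t * a)) has_real_derivative (c * a)) (at 0)"
    by (auto intro!: derivative_eq_intros)
  then have "((\<lambda>t. (exp (c * t * a) - 1) / t) \<longlongrightarrow> c * a) (at 0)"
    by (simp add: has_field_derivative_iff)
  moreover have "filterlim (\<lambda>k. inverse (real (Suc k))) (at 0) sequentially"
    by (rule filterlim_atI[OF LIMSEQ_inverse_real_of_nat]) auto
  ultimately show ?thesis by (rule filterlim_compose)
qed

context dual_minkowski
begin

lemma borel_measurable_M_continuous:
  "continuous_on (sphere 0 1) f \<Longrightarrow> f \<in> borel_measurable M"
  unfolding measurable_cong_sets[OF sets_M refl] by (rule borel_measurable_sphere_continuous)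

lemma measurable_radial_gauss_map_M:
  "continuous_on (sphere 0 1) f \<Longrightarrow> radial_gauss_map f \<in> measurable M sphere_borel"
  unfolding measurable_cong_sets[OF sets_M refl] by (rule measurable_radial_gauss_map)

lemma AE_smooth_points_wulff_gauge:
  fixes f :: "'a \<Rightarrow> real"
  assumes f: "continuous_on (sphere 0 1) f"
  shows "AE u in M. u \<in> smooth_points (wulff_gauge f)"
proof (rule M_cone)
  show "smooth_points (wulff_gauge f) \<in> sets borel"
    by (rule smooth_points_borel[OF continuous_on_wulff_gauge[OF f]])
  show "c *\<^sub>R x \<in> smooth_points (wulff_gauge f)" if "0 < c" "x \<in> smooth_points (wulff_gauge f)" for c x
    by (rule smooth_points_scale[OF _ that]) (simp add: wulff_gauge_scale f)
  obtain L where L: "\<And>x y. \<bar>wulff_gauge f x - wulff_gauge f y\<bar> \<le> L * norm (x - y)"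
    using wulff_gauge_lipschitz[OF f] by metis
  show "AE x in lborel. x \<in> smooth_points (wulff_gauge f)"
  proof (rule AE_smooth_points[OF L])
    fix x y :: 'a
    have "2 * wulff_gauge f x = wulff_gauge f ((x + y) + (x - y))"
      using wulff_gauge_scale[OF f, of 2 x] by (simp add: scaleR_2)
    also have "\<dots> \<le> wulff_gauge f (x + y) + wulff_gauge f (x - y)" by (rule wulff_gauge_add[OF f])
    finally show "2 * wulff_gauge f x \<le> wulff_gauge f (x + y) + wulff_gauge f (x - y)" .
  qed
qed

text \<open>Danskin's theorem for the maximum defining \<open>wulff_gauge\<close>, integrated over the sphere.\<close>

lemma volume_derivative:
  fixes f g :: "'a \<Rightarrow> real"
  assumes f: "continuous_on (sphere 0 1) f" and g: "continuous_on (sphere 0 1) g"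
  shows "(\<lambda>k. (volume (\<lambda>v. f v + inverse (real (Suc k)) * g v) - volume f) / inverse (real (Suc k)))
     \<longlonglongrightarrow> q * (\<integral>u. g (radial_gauss_map f u) * wulff_gauge f u powr (- q) \<partial>M)"
proof -
  define t where "t k = inverse (real (Suc k))" for k
  have t: "0 < t k" "t k \<le> 1" for k by (auto simp: t_def inverse_le_1_iff)
  have t0: "t \<longlonglongrightarrow> 0" unfolding t_def by (rule LIMSEQ_inverse_real_of_nat)
  define F where "F k v = f v + t k * g v" for k v
  have F: "continuous_on (sphere 0 1) (F k)" for k unfolding F_def by (intro continuous_intros f g)
  let ?N = "wulff_gauge f"
  let ?NF = "\<lambda>k. wulff_gauge (F k)"
  let ?\<alpha> = "radial_gauss_map f"
  obtain B where B: "0 < B" "\<And>v. v \<in> sphere 0 1 \<Longrightarrow> \<bar>g v\<bar> \<le> B"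
    using continuous_on_sphere_bounded[OF g] by blast
  define s where "s k u = (?NF k u powr (- q) - ?N u powr (- q)) / t k" for k u
  \<comment> \<open>The unperturbed maximiser \<open>?\<alpha> u\<close> is a competitor for the
    perturbed gauge and so bounds that gauge from below; the negative power reverses the
    inequality.\<close>
  have upper: "s k u \<le> ?N u powr (- q) * ((exp (q * t k * g (?\<alpha> u)) - 1) / t k)"
    if u: "u \<in> sphere 0 1" "u \<in> smooth_points ?N" for k u
  proof -
    note a = radial_gauss_map_smooth[OF f u(2)]
    have "?N u * exp (- (t k * g (?\<alpha> u))) = (u \<bullet> ?\<alpha> u) * exp (- F k (?\<alpha> u))"
      unfolding a(2)[symmetric] by (simp add: F_def mult.assoc flip: exp_add)
    also have "\<dots> \<le> ?NF k u" by (rule wulff_gauge_ge[OF F a(1)])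
    finally have le: "?N u * exp (- (t k * g (?\<alpha> u))) \<le> ?NF k u" .
    have "u \<noteq> 0" using u by auto
    then have "0 < ?N u" by (rule wulff_gauge_pos[OF f])
    then have "?NF k u powr (- q) \<le> (?N u * exp (- (t k * g (?\<alpha> u)))) powr (- q)"
      using le q by (intro powr_mono2') auto
    also have "\<dots> = ?N u powr (- q) * exp (q * t k * g (?\<alpha> u))"
      using \<open>0 < ?N u\<close> by (simp add: powr_mult exp_powr_real mult_ac)
    finally have "?NF k u powr (- q) - ?N u powr (- q) \<le> ?N u powr (- q) * (exp (q * t k * g (?\<alpha> u)) - 1)"
      by (simp add: algebra_simps)
    then show ?thesis unfolding s_def using t[of k] by (simp add: divide_right_mono)
  qed
  \<comment> \<open>Conversely, a maximiser \<open>v k\<close> of the perturbed gauge competes in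
    the unperturbed one. The resulting bound involves g at \<open>v k\<close>, so convergence of
    these maximisers has to be recorded with it.\<close>
  have lower: "\<exists>v. (\<forall>k. v k \<in> sphere 0 1 \<and> ?N u powr (- q) * (q * g (v k)) \<le> s k u) \<and> v \<longlonglongrightarrow> ?\<alpha> u"
    if u: "u \<in> sphere 0 1" "u \<in> smooth_points ?N" for u
  proof -
    note a = radial_gauss_map_smooth[OF f u(2)]
    have "u \<noteq> 0" using u by auto
    then have Npos: "0 < ?N u" by (rule wulff_gauge_pos[OF f])
    have "\<exists>v. v \<in> sphere 0 1 \<and> ?NF k u = (u \<bullet> v) * exp (- F k v)" for k
      using wulff_gauge_attained[OF F] by metis
    then obtain v where v: "\<And>k. v k \<in> sphere 0 1" "\<And>k. ?NF k u = (u \<bullet> v k) * exp (- F k (v k))"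
      by metis
    define \<phi> where "\<phi> w = (u \<bullet> w) * exp (- f w)" for w
    have \<phi>c: "continuous_on (sphere 0 1) \<phi>" unfolding \<phi>_def by (intro continuous_intros f)
    have \<phi>_le: "\<phi> (v k) \<le> ?N u" for k unfolding \<phi>_def by (rule wulff_gauge_ge[OF f v(1)])
    have NF: "?NF k u = \<phi> (v k) * exp (- (t k * g (v k)))" for k
      by (simp add: v(2) \<phi>_def F_def mult.assoc flip: exp_add)
    have bound: "?N u powr (- q) * (q * g (v k)) \<le> s k u" for k
    proof -
      have "u \<noteq> 0" using u by auto
      then have p: "0 < ?NF k u" by (rule wulff_gauge_pos[OF F])
      have le: "?NF k u \<le> ?N u * exp (- (t k * g (v k)))"
        unfolding NF using \<phi>_le by (intro mult_right_mono) auto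
      have "?N u powr (- q) * (1 + q * t k * g (v k)) \<le> ?N u powr (- q) * exp (q * t k * g (v k))"
        by (intro mult_left_mono exp_ge_add_one_self) auto
      also have "\<dots> = (?N u * exp (- (t k * g (v k)))) powr (- q)"
        using Npos by (simp add: powr_mult exp_powr_real mult_ac)
      also have "\<dots> \<le> ?NF k u powr (- q)" using le p q by (intro powr_mono2') auto
      finally have "t k * (?N u powr (- q) * (q * g (v k))) \<le> ?NF k u powr (- q) - ?N u powr (- q)"
        by (simp add: algebra_simps)
      then show ?thesis unfolding s_def using t[of k] by (simp add: pos_le_divide_eq mult.commute)
    qed
    \<comment> \<open>\<open>v k\<close> is optimal for the perturbed function, hence almost optimal
      for \<open>\<phi>\<close>: the two perturbation factors, at \<open>v k\<close> and at
      \<open>?\<alpha> u\<close>, cost at most exp(B t) each.\<close>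
    have \<phi>_low: "?N u * exp (- (2 * B * t k)) \<le> \<phi> (v k)" for k
    proof -
      have "\<phi> (?\<alpha> u) * exp (- (t k * g (?\<alpha> u))) \<le> \<phi> (v k) * exp (- (t k * g (v k)))"
        using wulff_gauge_ge[OF F a(1), of u k] unfolding NF
        by (simp add: \<phi>_def F_def mult.assoc flip: exp_add)
      then have "?N u * exp (- (t k * g (?\<alpha> u))) * exp (t k * g (v k)) \<le> \<phi> (v k)"
        using a(2) by (simp add: \<phi>_def exp_minus field_simps)
      moreover have "?N u * exp (- (2 * B * t k)) \<le> ?N u * (exp (- (t k * g (?\<alpha> u))) * exp (t k * g (v k)))"
      proof (intro mult_left_mono)
        have "g (?\<alpha> u) - g (v k) \<le> 2 * B" using B(2)[OF a(1)] B(2)[OF v(1)[of k]] by linarith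
        then have "t k * (g (?\<alpha> u) - g (v k)) \<le> t k * (2 * B)" using t[of k] by (intro mult_left_mono) auto
        then show "exp (- (2 * B * t k)) \<le> exp (- (t k * g (?\<alpha> u))) * exp (t k * g (v k))"
          by (simp add: algebra_simps flip: exp_add)
      qed (use Npos in auto)
      ultimately show ?thesis by (simp add: mult.assoc)
    qed
    have "(\<lambda>k. ?N u * exp (- (2 * B * t k))) \<longlonglongrightarrow> ?N u * exp (- (2 * B * 0))"
      by (intro tendsto_intros t0)
    then have low: "(\<lambda>k. ?N u * exp (- (2 * B * t k))) \<longlonglongrightarrow> ?N u" by simp
    have "(\<lambda>k. \<phi> (v k)) \<longlonglongrightarrow> ?N u"
      by (rule tendsto_sandwich[OF _ _ low tendsto_const]) (use \<phi>_le \<phi>_low in simp_all)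
    then have "v \<longlonglongrightarrow> ?\<alpha> u"
      by (rule compact_unique_limit[OF compact_sphere \<phi>c v(1)])
         (use radial_gauss_map_eqI[OF f u(2)] in \<open>auto simp: \<phi>_def\<close>)
    with v(1) bound show ?thesis by blast
  qed
  have lim: "(\<lambda>k. s k u) \<longlonglongrightarrow> q * (g (?\<alpha> u) * ?N u powr (- q))"
    if u: "u \<in> sphere 0 1" "u \<in> smooth_points ?N" for u
  proof -
    obtain v where v: "\<And>k. v k \<in> sphere 0 1" "\<And>k. ?N u powr (- q) * (q * g (v k)) \<le> s k u" "v \<longlonglongrightarrow> ?\<alpha> u"
      using lower[OF u] by blast
    have "(\<lambda>k. g (v k)) \<longlonglongrightarrow> g (?\<alpha> u)"
      by (rule continuous_on_tendsto_compose[OF g v(3)])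
         (use v(1) radial_gauss_map_smooth[OF f u(2)] in auto)
    then have 1: "(\<lambda>k. ?N u powr (- q) * (q * g (v k))) \<longlonglongrightarrow> ?N u powr (- q) * (q * g (?\<alpha> u))"
      by (intro tendsto_intros)
    have 2: "(\<lambda>k. ?N u powr (- q) * ((exp (q * t k * g (?\<alpha> u)) - 1) / t k)) \<longlonglongrightarrow> ?N u powr (- q) * (q * g (?\<alpha> u))"
      unfolding t_def by (intro tendsto_intros exp_mult_diff_quotient_tendsto)
    have "(\<lambda>k. s k u) \<longlonglongrightarrow> ?N u powr (- q) * (q * g (?\<alpha> u))"
      by (rule tendsto_sandwich[OF _ _ 1 2]) (use v(2) upper[OF u] in auto)
    then show ?thesis by (simp add: mult_ac)
  qed
  have bound: "\<bar>s k u\<bar> \<le> ?N u powr (- q) * (q * B * exp (q * B))"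
    if u: "u \<in> sphere 0 1" "u \<in> smooth_points ?N" for k u
  proof -
    note a = radial_gauss_map_smooth[OF f u(2)]
    obtain v where v: "v k \<in> sphere 0 1" "?N u powr (- q) * (q * g (v k)) \<le> s k u"
      using lower[OF u] by blast
    have "(exp (q * t k * g (?\<alpha> u)) - 1) / t k \<le> q * B * exp (q * B)"
      by (rule exp_mult_diff_quotient_bound) (use t B(2)[OF a(1)] q in auto)
    then have 1: "s k u \<le> ?N u powr (- q) * (q * B * exp (q * B))"
      by (intro order_trans[OF upper[OF u]] mult_left_mono) auto
    have "q * B * 1 \<le> q * B * exp (q * B)" using q B by (intro mult_left_mono) auto
    moreover have "q * (- B) \<le> q * g (v k)"
      using B(2)[OF v(1)] q by (intro mult_left_mono) (auto simp: abs_le_iff)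
    ultimately have "- (q * B * exp (q * B)) \<le> q * g (v k)" by simp
    then have "?N u powr (- q) * - (q * B * exp (q * B)) \<le> ?N u powr (- q) * (q * g (v k))"
      by (intro mult_left_mono) auto
    with v(2) 1 show ?thesis by (simp add: abs_le_iff)
  qed
  have AE: "AE u in M. u \<in> sphere 0 1 \<and> u \<in> smooth_points ?N"
    using AE_smooth_points_wulff_gauge[OF f] AE_space by eventually_elim (simp add: space_M)
  have "(\<lambda>k. \<integral>u. s k u \<partial>M) \<longlonglongrightarrow> (\<integral>u. q * (g (?\<alpha> u) * ?N u powr (- q)) \<partial>M)"
  proof (rule integral_dominated_convergence)
    have "g \<circ> ?\<alpha> \<in> borel_measurable M"
      using measurable_radial_gauss_map_M[OF f] borel_measurable_sphere_continuous[OF g] by (rule measurable_comp)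
    then show "(\<lambda>u. q * (g (?\<alpha> u) * ?N u powr (- q))) \<in> borel_measurable M"
      using borel_measurable_M_continuous[OF continuous_on_gauge_powr[OF f, of "- q"]] by (simp add: o_def)
    show "s k \<in> borel_measurable M" for k
      unfolding s_def
      using borel_measurable_M_continuous[OF continuous_on_gauge_powr[OF f, of "- q"]]
        borel_measurable_M_continuous[OF continuous_on_gauge_powr[OF F, where a = "- q"]]
      by measurable
    show "integrable M (\<lambda>u. ?N u powr (- q) * (q * B * exp (q * B)))"
      by (intro integrable_mult_left integrable_M continuous_on_gauge_powr f)
    show "AE u in M. (\<lambda>k. s k u) \<longlonglongrightarrow> q * (g (?\<alpha> u) * ?N u powr (- q))"
      using AE by eventually_elim (use lim in blast)
    show "AE u in M. norm (s k u) \<le> ?N u powr (- q) * (q * B * exp (q * B))" for k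
      using AE by eventually_elim (use bound in auto)
  qed
  moreover have "(\<integral>u. s k u \<partial>M) = (volume (F k) - volume f) / t k" for k
    unfolding s_def volume_def
    by (subst Bochner_Integration.integral_diff[symmetric])
       (auto intro!: integrable_M continuous_on_gauge_powr f F)
  ultimately have "(\<lambda>k. (volume (F k) - volume f) / t k)
     \<longlonglongrightarrow> q * (\<integral>u. g (?\<alpha> u) * ?N u powr (- q) \<partial>M)"
    by simp
  then show ?thesis unfolding F_def[abs_def] t_def .
qed

text \<open>Maximality says that \<open>volume\<close> at f + t g is at most \<open>volume f\<close>
  times exp(q t avg g). Both sides agree at t = 0, so their difference quotients can be compared as
  t decreases to 0.\<close>

lemma euler_lagrange_le:
  assumes f: "continuous_on (sphere 0 1) f" "\<And>v. v \<in> sphere 0 1 \<Longrightarrow> f (- v) = f v"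
    and max: "\<And>g. continuous_on (sphere 0 1) g \<Longrightarrow> (\<And>v. v \<in> sphere 0 1 \<Longrightarrow> g (- v) = g v) \<Longrightarrow>
       entropy g \<le> entropy f"
    and g: "continuous_on (sphere 0 1) g" "\<And>v. v \<in> sphere 0 1 \<Longrightarrow> g (- v) = g v"
  shows "(\<integral>u. g (radial_gauss_map f u) * wulff_gauge f u powr (- q) \<partial>M) \<le> volume f * avg g"
proof -
  define t where "t k = inverse (real (Suc k))" for k
  have t: "0 < t k" for k by (simp add: t_def)
  have "(volume (\<lambda>v. f v + t k * g v) - volume f) / t k \<le>
      volume f * ((exp (q * t k * avg g) - 1) / t k)" for k
  proof -
    let ?F = "\<lambda>v. f v + t k * g v"
    have F: "continuous_on (sphere 0 1) ?F" by (intro continuous_intros f g)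
    have "entropy ?F \<le> entropy f" by (rule max[OF F]) (simp add: f g)
    moreover have "avg ?F = avg f + t k * avg g"
      by (subst avg_add, intro f, intro continuous_intros g, simp add: avg_mult)
    ultimately have "ln (volume ?F) / q \<le> ln (volume f) / q + t k * avg g"
      by (simp add: entropy_def)
    then have "ln (volume ?F) \<le> ln (volume f) + q * t k * avg g"
      using q by (simp add: field_simps)
    then have "exp (ln (volume ?F)) \<le> exp (ln (volume f) + q * t k * avg g)" by simp
    then have "volume ?F \<le> volume f * exp (q * t k * avg g)"
      using volume_pos[OF F] volume_pos[OF f(1)] by (simp add: exp_add)
    then have "volume ?F - volume f \<le> volume f * (exp (q * t k * avg g) - 1)" by (simp add: algebra_simps)
    then show ?thesis using t[of k] by (simp add: divide_right_mono)
  qed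
  moreover have "(\<lambda>k. volume f * ((exp (q * t k * avg g) - 1) / t k)) \<longlonglongrightarrow> volume f * (q * avg g)"
    unfolding t_def by (intro tendsto_intros exp_mult_diff_quotient_tendsto)
  moreover have "(\<lambda>k. (volume (\<lambda>v. f v + t k * g v) - volume f) / t k)
     \<longlonglongrightarrow> q * (\<integral>u. g (radial_gauss_map f u) * wulff_gauge f u powr (- q) \<partial>M)"
    unfolding t_def by (rule volume_derivative[OF f(1) g(1)])
  ultimately have "q * (\<integral>u. g (radial_gauss_map f u) * wulff_gauge f u powr (- q) \<partial>M) \<le> volume f * (q * avg g)"
    using LIMSEQ_le by blast
  then have "q * (\<integral>u. g (radial_gauss_map f u) * wulff_gauge f u powr (- q) \<partial>M) \<le> q * (volume f * avg g)"
    by (simp add: mult_ac)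
  then show ?thesis using q by simp
qed

text \<open>Only positive steps t were used, so one direction g gives an inequality; -g gives its
  reverse.\<close>

lemma euler_lagrange:
  assumes f: "continuous_on (sphere 0 1) f" "\<And>v. v \<in> sphere 0 1 \<Longrightarrow> f (- v) = f v"
    and max: "\<And>g. continuous_on (sphere 0 1) g \<Longrightarrow> (\<And>v. v \<in> sphere 0 1 \<Longrightarrow> g (- v) = g v) \<Longrightarrow>
       entropy g \<le> entropy f"
    and g: "continuous_on (sphere 0 1) g" "\<And>v. v \<in> sphere 0 1 \<Longrightarrow> g (- v) = g v"
  shows "(\<integral>u. g (radial_gauss_map f u) * wulff_gauge f u powr (- q) \<partial>M) = volume f * avg g"
proof (rule antisym)
  show "(\<integral>u. g (radial_gauss_map f u) * wulff_gauge f u powr (- q) \<partial>M) \<le> volume f * avg g"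
    by (rule euler_lagrange_le[OF f max g])
  have "(\<integral>u. - g (radial_gauss_map f u) * wulff_gauge f u powr (- q) \<partial>M) \<le> volume f * avg (\<lambda>v. - g v)"
    by (rule euler_lagrange_le[OF f max]) (auto intro!: continuous_intros g)
  then show "volume f * avg g \<le> (\<integral>u. g (radial_gauss_map f u) * wulff_gauge f u powr (- q) \<partial>M)"
    by (simp add: avg_def)
qed

end

section \<open>Even measures on the sphere\<close>

lemma integral_uminus_even_measure:
  fixes g :: "'a::euclidean_space \<Rightarrow> real"
  assumes "sets \<mu> = sets sphere_borel"
    and even: "\<And>A. A \<in> sets sphere_borel \<Longrightarrow> emeasure \<mu> (uminus ` A) = emeasure \<mu> A"
    and g: "continuous_on (sphere 0 1) g"
  shows "(\<integral>v. g (- v) \<partial>\<mu>) = (\<integral>v. g v \<partial>\<mu>)"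
proof -
  have space: "space \<mu> = sphere 0 1" using sets_eq_imp_space_eq[OF assms(1)] by simp
  have m: "uminus \<in> measurable \<mu> sphere_borel"
    unfolding measurable_cong_sets[OF assms(1) refl] by (rule measurable_uminus_sphere_borel)
  have "distr \<mu> sphere_borel uminus = \<mu>"
  proof (rule measure_eqI)
    fix A assume A: "A \<in> sets (distr \<mu> sphere_borel uminus)"
    then have "A \<subseteq> sphere 0 1" by (simp add: sets_sphere_borel_iff)
    then have "uminus -` A \<inter> sphere 0 1 = uminus ` A" by force
    then show "emeasure (distr \<mu> sphere_borel uminus) A = emeasure \<mu> A"
      using A even by (simp add: emeasure_distr[OF m] space)
  qed (simp add: assms(1))
  then have "(\<integral>v. g v \<partial>\<mu>) = (\<integral>v. g v \<partial>distr \<mu> sphere_borel uminus)" by simp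
  also have "\<dots> = (\<integral>v. g (- v) \<partial>\<mu>)"
    by (rule integral_distr[OF m borel_measurable_sphere_continuous[OF g]])
  finally show ?thesis by simp
qed

text \<open>Adding the reflected function doubles an integral against an even measure, so even test
  functions already determine the integrals of the cut-offs \<open>g k\<close>. These decrease to
  the indicator of a closed set, and closed sets form an intersection-stable generator.\<close>

lemma even_measure_eqI:
  fixes \<mu> \<nu> :: "'a::euclidean_space measure"
  assumes mu: "sets \<mu> = sets sphere_borel" "finite_measure \<mu>"
      "\<And>A. A \<in> sets sphere_borel \<Longrightarrow> emeasure \<mu> (uminus ` A) = emeasure \<mu> A"
    and nu: "sets \<nu> = sets sphere_borel" "finite_measure \<nu>"
      "\<And>A. A \<in> sets sphere_borel \<Longrightarrow> emeasure \<nu> (uminus ` A) = emeasure \<nu> A"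
    and eq: "\<And>g :: 'a \<Rightarrow> real. continuous_on (sphere 0 1) g \<Longrightarrow> (\<And>v. v \<in> sphere 0 1 \<Longrightarrow> g (- v) = g v) \<Longrightarrow>
      (\<integral>v. g v \<partial>\<mu>) = (\<integral>v. g v \<partial>\<nu>)"
  shows "\<mu> = \<nu>"
proof (rule measure_eqI)
  show "sets \<mu> = sets \<nu>" using mu nu by simp
  have closed_eq: "emeasure \<mu> (C \<inter> sphere 0 1) = emeasure \<nu> (C \<inter> sphere 0 1)" if C: "closed C" for C
  proof (cases "C \<inter> sphere 0 1 = {}")
    case False
    define D where "D = C \<inter> sphere 0 1"
    have D: "closed D" "D \<noteq> {}" using C False by (auto simp: D_def)
    have Ds: "D \<in> sets sphere_borel" using D(1) by (auto simp: sets_sphere_borel_iff D_def)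
    define g where "g k v = max 0 (1 - real k * infdist v D)" for k :: nat and v
    have gc: "continuous_on (sphere 0 1) (g k)" for k unfolding g_def by (intro continuous_intros)
    have geq: "(\<integral>v. g k v \<partial>\<mu>) = (\<integral>v. g k v \<partial>\<nu>)" for k
    proof -
      let ?h = "\<lambda>v. g k v + g k (- v)"
      have gc': "continuous_on (sphere 0 1) (\<lambda>v. g k (- v))"
        unfolding g_def by (intro continuous_intros)
      have *: "(\<integral>v. ?h v \<partial>\<rho>) = 2 * (\<integral>v. g k v \<partial>\<rho>)"
        if "sets \<rho> = sets sphere_borel" "finite_measure \<rho>"
          "\<And>A. A \<in> sets sphere_borel \<Longrightarrow> emeasure \<rho> (uminus ` A) = emeasure \<rho> A" for \<rho>
        using integral_uminus_even_measure[OF that(1,3) gc]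
          integrable_sphere_continuous[OF that(2,1) gc] integrable_sphere_continuous[OF that(2,1) gc']
        by (subst Bochner_Integration.integral_add) auto
      have "(\<integral>v. ?h v \<partial>\<mu>) = (\<integral>v. ?h v \<partial>\<nu>)"
        by (rule eq) (auto intro!: continuous_intros gc gc')
      then show ?thesis using *[OF mu] *[OF nu] by simp
    qed
    have lim: "(\<lambda>k. \<integral>v. g k v \<partial>\<rho>) \<longlonglongrightarrow> measure \<rho> D"
      if \<rho>: "sets \<rho> = sets sphere_borel" "finite_measure \<rho>" for \<rho>
    proof -
      interpret \<rho>: finite_measure \<rho> by fact
      have sp: "space \<rho> = sphere 0 1" using sets_eq_imp_space_eq[OF \<rho>(1)] by simp
      have "(\<lambda>k. \<integral>v. g k v \<partial>\<rho>) \<longlonglongrightarrow> (\<integral>v. indicator D v \<partial>\<rho>)"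
      proof (rule integral_dominated_convergence[where w = "\<lambda>_. 1"])
        show "indicator D \<in> borel_measurable \<rho>" using Ds \<rho>(1) by simp
        show "g k \<in> borel_measurable \<rho>" for k
          unfolding measurable_cong_sets[OF \<rho>(1) refl] by (rule borel_measurable_sphere_continuous[OF gc])
        show "AE v in \<rho>. (\<lambda>k. g k v) \<longlonglongrightarrow> indicator D v"
        proof (rule AE_I2)
          fix v
          show "(\<lambda>k. g k v) \<longlonglongrightarrow> indicator D v"
          proof (cases "v \<in> D")
            case True
            then show ?thesis by (simp add: g_def)
          next
            case False
            then have p: "0 < infdist v D"
              using D infdist_nonneg[of v D] in_closed_iff_infdist_zero[OF D] by (simp add: order_less_le)
            obtain K where K: "1 / infdist v D < real K" using reals_Archimedean2 by blast
            have "g k v = 0" if "k \<ge> K" for k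
            proof -
              have "1 / infdist v D < real k" using K that by simp
              then show ?thesis using p by (simp add: g_def field_simps)
            qed
            then have "\<forall>\<^sub>F k in sequentially. g k v = 0"
              unfolding eventually_sequentially by blast
            then show ?thesis using False by (simp add: tendsto_eventually)
          qed
        qed
        show "AE v in \<rho>. norm (g k v) \<le> 1" for k
          using infdist_nonneg[of _ D] by (intro AE_I2) (auto simp: g_def)
      qed auto
      also have "(\<integral>v. indicator D v \<partial>\<rho>) = measure \<rho> D"
        using Ds \<rho>(1) sp by (simp add: D_def Int_commute Int_left_commute)
      finally show ?thesis .
    qed
    have "measure \<mu> D = measure \<nu> D"
      using lim[OF mu(1,2)] lim[OF nu(1,2)] geq LIMSEQ_unique by auto
    then show ?thesis
      using finite_measure.emeasure_eq_measure[OF mu(2)] finite_measure.emeasure_eq_measure[OF nu(2)]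
      by (simp add: D_def)
  qed simp
  have sp: "space \<mu> = sphere 0 1" "space \<nu> = sphere 0 1"
    using sets_eq_imp_space_eq[OF mu(1)] sets_eq_imp_space_eq[OF nu(1)] by simp_all
  have id: "(\<lambda>x. x) \<in> borel_measurable \<mu>" "(\<lambda>x. x) \<in> borel_measurable \<nu>"
    unfolding measurable_cong_sets[OF mu(1) refl] measurable_cong_sets[OF nu(1) refl]
    by (simp_all add: borel_measurable_sphere_borel)
  \<comment> \<open>The generator of closed sets lives on the whole space, so both measures are
    pushed forward along the inclusion of the sphere.\<close>
  have "distr \<mu> borel (\<lambda>x. x) = distr \<nu> borel (\<lambda>x. x)"
  proof (rule measure_eqI_generator_eq[where E = "Collect closed" and \<Omega> = UNIV and A = "\<lambda>_. UNIV"])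
    show "Int_stable (Collect closed :: 'a set set)" by (auto simp: Int_stable_def)
    show "sets (distr \<mu> borel (\<lambda>x. x)) = sigma_sets UNIV (Collect closed)"
      "sets (distr \<nu> borel (\<lambda>x. x)) = sigma_sets UNIV (Collect closed)"
      by (simp_all add: borel_eq_closed)
    show "emeasure (distr \<mu> borel (\<lambda>x. x)) C = emeasure (distr \<nu> borel (\<lambda>x. x)) C" if "C \<in> Collect closed" for C
      using that closed_eq[of C] by (simp add: emeasure_distr id sp borel_closed)
    show "emeasure (distr \<mu> borel (\<lambda>x. x)) UNIV \<noteq> \<infinity>"
      using finite_measure.emeasure_finite[OF mu(2)] by (simp add: emeasure_distr id sp)
  qed auto
  moreover fix A assume "A \<in> sets \<mu>"
  then have "A \<in> sets borel" "A \<subseteq> sphere 0 1" using mu(1) by (auto simp: sets_sphere_borel_iff)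
  moreover from this have "emeasure (distr \<mu> borel (\<lambda>x. x)) A = emeasure \<mu> A"
      "emeasure (distr \<nu> borel (\<lambda>x. x)) A = emeasure \<nu> A"
    by (simp_all add: emeasure_distr id sp Int_absorb2)
  ultimately show "emeasure \<mu> A = emeasure \<nu> A" by metis
qed

context dual_minkowski
begin

lemma volume_add_const:
  assumes f: "continuous_on (sphere 0 1) f"
  shows "volume (\<lambda>v. f v + c) = exp (q * c) * volume f"
proof -
  have fc: "continuous_on (sphere 0 1) (\<lambda>v. f v + c)" by (intro continuous_intros f)
  have "wulff_gauge (\<lambda>v. f v + c) u = exp (- c) * wulff_gauge f u" for u
  proof (rule antisym)
    show "wulff_gauge (\<lambda>v. f v + c) u \<le> exp (- c) * wulff_gauge f u"
      by (rule wulff_gauge_mono[OF f fc]) simp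
    have "wulff_gauge f u \<le> exp c * wulff_gauge (\<lambda>v. f v + c) u"
      by (rule wulff_gauge_mono[OF fc f]) simp
    then show "exp (- c) * wulff_gauge f u \<le> wulff_gauge (\<lambda>v. f v + c) u"
      by (simp add: exp_minus field_simps)
  qed
  then have "wulff_gauge (\<lambda>v. f v + c) u powr (- q) = exp (q * c) * wulff_gauge f u powr (- q)" for u
    using wulff_gauge_nonneg[OF f] by (simp add: powr_mult exp_powr_real mult.commute)
  then show ?thesis by (simp add: volume_def)
qed

text \<open>The functional is invariant under scaling, so the Lagrange multiplier can be normalised to 1.\<close>

lemma normalized_maximizer:
  obtains f where "continuous_on (sphere 0 1) f" "\<And>v. v \<in> sphere 0 1 \<Longrightarrow> f (- v) = f v"
    "\<And>g. continuous_on (sphere 0 1) g \<Longrightarrow> (\<And>v. v \<in> sphere 0 1 \<Longrightarrow> g (- v) = g v) \<Longrightarrow>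
       entropy g \<le> entropy f"
    "volume f = mass"
proof -
  obtain f where f: "continuous_on (sphere 0 1) f" "\<And>v. v \<in> sphere 0 1 \<Longrightarrow> f (- v) = f v"
    "\<And>g. continuous_on (sphere 0 1) g \<Longrightarrow> (\<And>v. v \<in> sphere 0 1 \<Longrightarrow> g (- v) = g v) \<Longrightarrow>
       entropy g \<le> entropy f"
    using entropy_maximizer by blast
  define c where "c = ln (mass / volume f) / q"
  have v: "volume (\<lambda>v. f v + c) = mass"
    using q mass_pos volume_pos[OF f(1)] by (simp add: volume_add_const[OF f(1)] c_def)
  have "entropy (\<lambda>v. f v + c) = entropy f"
    using q volume_pos[OF f(1)] f(1)
    by (simp add: entropy_def volume_add_const[OF f(1)] avg_add ln_mult_pos add_divide_distrib)
  with f v show thesis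
    by (intro that[of "\<lambda>v. f v + c"]) (auto intro!: continuous_intros)
qed

text \<open>The right-hand side is the image \<open>\<nu>\<close> of a weighted \<open>M\<close>
  under the Gauss map. With \<open>volume f\<close> equal to \<open>mass\<close>, the factor in the
  Euler-Lagrange equation cancels the normalisation in \<open>avg\<close>, so \<open>\<mu>\<close>
  and \<open>\<nu>\<close> have equal integrals of even functions; \<open>\<nu>\<close> is even
  because the Gauss map is odd.\<close>

lemma dual_minkowski_solution:
  obtains f where "continuous_on (sphere 0 1) f" "\<And>v. v \<in> sphere 0 1 \<Longrightarrow> f (- v) = f v"
    "\<And>A. A \<in> sets sphere_borel \<Longrightarrow> emeasure \<mu> A =
       (\<integral>\<^sup>+u. ennreal (wulff_gauge f u powr (- q)) * indicator A (radial_gauss_map f u) \<partial>M)"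
proof -
  obtain f where f: "continuous_on (sphere 0 1) f" "\<And>v. v \<in> sphere 0 1 \<Longrightarrow> f (- v) = f v"
    and max: "\<And>g. continuous_on (sphere 0 1) g \<Longrightarrow> (\<And>v. v \<in> sphere 0 1 \<Longrightarrow> g (- v) = g v) \<Longrightarrow>
       entropy g \<le> entropy f"
    and vol: "volume f = mass"
    using normalized_maximizer by blast
  let ?N = "\<lambda>u. wulff_gauge f u powr (- q)" and ?\<alpha> = "radial_gauss_map f"
  define D where "D = density M (\<lambda>u. ennreal (?N u))"
  define \<nu> where "\<nu> = distr D sphere_borel ?\<alpha>"
  have Nm: "?N \<in> borel_measurable M"
    by (rule borel_measurable_M_continuous[OF continuous_on_gauge_powr[OF f(1)]])
  have \<alpha>M: "?\<alpha> \<in> measurable M sphere_borel" by (rule measurable_radial_gauss_map_M[OF f(1)])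
  have \<alpha>D: "?\<alpha> \<in> measurable D sphere_borel" unfolding D_def using \<alpha>M by simp
  have em: "emeasure \<nu> A = (\<integral>\<^sup>+u. ennreal (?N u) * indicator A (?\<alpha> u) \<partial>M)"
    if A: "A \<in> sets sphere_borel" for A
  proof -
    have "emeasure \<nu> A = emeasure D (?\<alpha> -` A \<inter> space M)"
      using A by (simp add: \<nu>_def emeasure_distr[OF \<alpha>D]) (simp add: D_def)
    also have "\<dots> = (\<integral>\<^sup>+u. ennreal (?N u) * indicator (?\<alpha> -` A \<inter> space M) u \<partial>M)"
      unfolding D_def by (rule emeasure_density) (use Nm measurable_sets[OF \<alpha>M A] in auto)
    also have "\<dots> = (\<integral>\<^sup>+u. ennreal (?N u) * indicator A (?\<alpha> u) \<partial>M)"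
      by (intro nn_integral_cong) (auto simp: indicator_def)
    finally show ?thesis .
  qed
  have Nint: "integrable M ?N" by (rule integrable_M[OF continuous_on_gauge_powr[OF f(1)]])
  have fin: "finite_measure \<nu>"
  proof
    have "emeasure \<nu> (space \<nu>) = (\<integral>\<^sup>+u. ennreal (?N u) * indicator (sphere 0 1) (?\<alpha> u) \<partial>M)"
      by (subst em[symmetric]) (auto simp: \<nu>_def sets_sphere_borel_iff)
    also have "\<dots> \<le> (\<integral>\<^sup>+u. ennreal (?N u) \<partial>M)"
      by (intro nn_integral_mono) (auto simp: indicator_def)
    also have "\<dots> < \<infinity>" using Nint by (simp add: nn_integral_eq_integral)
    finally show "emeasure \<nu> (space \<nu>) \<noteq> \<infinity>" by simp
  qed
  have "\<mu> = \<nu>"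
  proof (rule even_measure_eqI)
    show "sets \<nu> = sets sphere_borel" by (simp add: \<nu>_def)
    show "emeasure \<nu> (uminus ` A) = emeasure \<nu> A" if A: "A \<in> sets sphere_borel" for A
    proof -
      have eqA: "uminus ` A = uminus -` A \<inter> sphere 0 1"
        using A by (force simp: sets_sphere_borel_iff)
      have A': "uminus ` A \<in> sets sphere_borel"
        unfolding eqA using measurable_sets[OF measurable_uminus_sphere_borel A] by simp
      let ?\<phi> = "\<lambda>u. ennreal (?N u) * indicator A (?\<alpha> u)"
      have "emeasure \<nu> (uminus ` A) = (\<integral>\<^sup>+u. ennreal (?N u) * indicator (uminus ` A) (?\<alpha> u) \<partial>M)"
        by (rule em[OF A'])
      also have "\<dots> = (\<integral>\<^sup>+u. ?\<phi> (- u) \<partial>M)"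
      proof (intro nn_integral_cong)
        fix u assume "u \<in> space M"
        have "?\<alpha> u \<in> uminus ` A \<longleftrightarrow> - ?\<alpha> u \<in> A" by (auto simp: image_iff) (metis minus_minus)
        moreover have "?\<alpha> (- u) = - ?\<alpha> u" by (rule radial_gauss_map_uminus[OF f])
        moreover have "wulff_gauge f (- u) = wulff_gauge f u" by (rule wulff_gauge_uminus[OF f])
        ultimately show "ennreal (?N u) * indicator (uminus ` A) (?\<alpha> u) = ?\<phi> (- u)"
          by (simp add: indicator_def)
      qed
      also have "\<dots> = (\<integral>\<^sup>+u. ?\<phi> u \<partial>M)"
      proof (rule M_even)
        have "?N \<in> borel_measurable sphere_borel"
          by (rule borel_measurable_sphere_continuous[OF continuous_on_gauge_powr[OF f(1)]])
        moreover have "(\<lambda>u. indicator A (?\<alpha> u) :: ennreal) \<in> borel_measurable sphere_borel"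
          using measurable_compose[OF measurable_radial_gauss_map[OF f(1)], of "indicator A" borel] A by simp
        ultimately show "?\<phi> \<in> borel_measurable sphere_borel" by simp
      qed
      also have "\<dots> = emeasure \<nu> A" by (rule em[OF A, symmetric])
      finally show ?thesis .
    qed
    fix g :: "'a \<Rightarrow> real" assume g: "continuous_on (sphere 0 1) g" "\<And>v. v \<in> sphere 0 1 \<Longrightarrow> g (- v) = g v"
    have gm: "g \<in> borel_measurable sphere_borel" by (rule borel_measurable_sphere_continuous[OF g(1)])
    have "(\<integral>v. g v \<partial>\<nu>) = (\<integral>u. g (?\<alpha> u) \<partial>D)"
      unfolding \<nu>_def by (rule integral_distr[OF \<alpha>D gm])
    also have "\<dots> = (\<integral>u. ?N u *\<^sub>R g (?\<alpha> u) \<partial>M)"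
      unfolding D_def by (rule integral_density) (use Nm measurable_compose[OF \<alpha>M gm] in auto)
    also have "\<dots> = volume f * avg g"
    proof -
      have "(\<integral>u. g (?\<alpha> u) * ?N u \<partial>M) = volume f * avg g"
      proof (rule euler_lagrange[OF f(1)])
        show "entropy h \<le> entropy f" if "continuous_on (sphere 0 1) h"
          "\<And>v. v \<in> sphere 0 1 \<Longrightarrow> h (- v) = h v" for h
          by (rule max[OF that])
      qed (fact f(2) g)+
      then show ?thesis by (simp add: mult.commute)
    qed
    also have "\<dots> = (\<integral>v. g v \<partial>\<mu>)" using mass_pos by (simp add: vol avg_def)
    finally show "(\<integral>v. g v \<partial>\<mu>) = (\<integral>v. g v \<partial>\<nu>)" by simp
  qed (use sets_mu finite_mu mu_even fin in auto)
  with em f show thesis using that by metis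
qed

end

section \<open>Radial functions and outer normals\<close>

lemma radial_function_attained:
  fixes Q :: "'a::euclidean_space set"
  assumes "compact Q" "0 \<in> Q" "u \<in> sphere 0 1"
  shows "radial_function Q u *\<^sub>R u \<in> Q" "\<And>t. t *\<^sub>R u \<in> Q \<Longrightarrow> t \<le> radial_function Q u"
proof -
  obtain B where B: "\<And>x. x \<in> Q \<Longrightarrow> norm x \<le> B"
    using compact_imp_bounded[OF assms(1)] by (auto simp: bounded_iff)
  let ?T = "{t. t *\<^sub>R u \<in> Q}"
  have bd: "\<bar>t\<bar> \<le> B" if "t \<in> ?T" for t using B[of "t *\<^sub>R u"] that assms(3) by simp
  then have bdd: "bdd_above ?T" by (intro bdd_aboveI[of _ B]) force
  have "closed ((\<lambda>t. t *\<^sub>R u) -` Q)"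
    by (intro continuous_closed_vimage compact_imp_closed assms continuous_intros)
  then have cl: "closed ?T" by (simp add: vimage_def)
  have "0 \<in> ?T" using assms(2) by simp
  then have "?T \<noteq> {}" by blast
  from closed_contains_Sup[OF this bdd cl] show "radial_function Q u *\<^sub>R u \<in> Q"
    by (simp add: radial_function_def)
  show "t \<le> radial_function Q u" if "t *\<^sub>R u \<in> Q" for t
    unfolding radial_function_def by (rule cSup_upper) (use that bdd in auto)
qed

lemma radial_function_uminus:
  assumes "origin_symmetric Q"
  shows "radial_function Q (- u) = radial_function Q u"
proof -
  have "- x \<in> Q \<longleftrightarrow> x \<in> Q" for x
    using assms unfolding origin_symmetric_def by (metis image_eqI minus_minus imageE)
  then show ?thesis by (simp add: radial_function_def)
qed

text \<open>If a ball around x lies in \<open>K\<close>, so does its reflection around -x, and a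
  small y is the midpoint of x + y and y - x.\<close>

lemma zero_interior_symmetric_convex_body:
  fixes K :: "'a::euclidean_space set"
  assumes "convex_body K" "origin_symmetric K"
  obtains r where "0 < r" "cball 0 r \<subseteq> K"
proof -
  have neg: "- x \<in> K" if "x \<in> K" for x
    using assms(2) that unfolding origin_symmetric_def by blast
  obtain x e where e: "0 < e" "ball x e \<subseteq> K"
    using assms(1) by (auto simp: convex_body_def mem_interior)
  have "cball 0 (e / 2) \<subseteq> K"
  proof
    fix y :: 'a assume "y \<in> cball 0 (e / 2)"
    then have "x + y \<in> ball x e" "x - y \<in> ball x e" using e(1) by (auto simp: dist_norm)
    then have "x + y \<in> K" "- (x - y) \<in> K" using e(2) neg by blast+
    then have "(1/2) *\<^sub>R (x + y) + (1/2) *\<^sub>R (- (x - y)) \<in> K"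
      using assms(1) unfolding convex_body_def by (intro convexD) auto
    also have "(1/2) *\<^sub>R (x + y) + (1/2) *\<^sub>R (- (x - y)) = y"
      by (simp add: algebra_simps flip: scaleR_add_left)
    finally show "y \<in> K" .
  qed
  then show thesis using that[of "e / 2"] e(1) by simp
qed

lemma radial_function_frontier:
  fixes K :: "'a::euclidean_space set"
  assumes "compact K" "0 \<in> K" "u \<in> sphere 0 1"
  shows "radial_function K u *\<^sub>R u \<in> frontier K"
proof -
  let ?r = "radial_function K u"
  have "?r *\<^sub>R u \<notin> interior K"
  proof
    assume "?r *\<^sub>R u \<in> interior K"
    then obtain e where e: "0 < e" "ball (?r *\<^sub>R u) e \<subseteq> K" by (auto simp: mem_interior)
    have "(?r + e / 2) *\<^sub>R u \<in> ball (?r *\<^sub>R u) e"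
      using e(1) assms(3) by (simp add: dist_norm algebra_simps)
    with e(2) have "(?r + e / 2) *\<^sub>R u \<in> K" by blast
    then show False using radial_function_attained(2)[OF assms] e(1) by fastforce
  qed
  then show ?thesis
    using radial_function_attained(1)[OF assms] assms(1) by (simp add: frontier_def compact_imp_closed)
qed

lemma frontier_outer_unit_normal:
  fixes K :: "'a::euclidean_space set"
  assumes "convex_body K" "x \<in> frontier K"
  obtains w where "outer_unit_normal K x w"
proof -
  have K: "convex K" "interior K \<noteq> {}" "closed K"
    using assms(1) by (auto simp: convex_body_def compact_imp_closed)
  have "x \<in> K" "x \<notin> rel_interior K"
    using assms(2) K by (auto simp: frontier_def rel_interior_nonempty_interior)
  then obtain a where a: "a \<noteq> 0" "\<And>y. y \<in> K \<Longrightarrow> a \<bullet> x \<le> a \<bullet> y"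
    using supporting_hyperplane_rel_boundary[OF K(1)] closure_subset by (metis subsetD)
  \<comment> \<open>The supporting hyperplane theorem delivers a vector minimised at x, that is, an
    inner normal; hence the sign.\<close>
  have "outer_unit_normal K x (- sgn a)"
    unfolding outer_unit_normal_def
  proof (intro conjI ballI)
    show "norm (- sgn a) = 1" using a(1) by (simp add: norm_sgn)
    fix y assume "y \<in> K"
    then have "inverse (norm a) * (a \<bullet> x) \<le> inverse (norm a) * (a \<bullet> y)"
      using a by (intro mult_left_mono) auto
    then show "y \<bullet> - sgn a \<le> x \<bullet> - sgn a" by (simp add: sgn_div_norm inner_commute)
  qed
  then show thesis by (rule that)
qed

lemma powr_bounds_sphere:
  fixes f :: "'a::euclidean_space \<Rightarrow> real"
  assumes "continuous_on (sphere 0 1) f" "\<And>u. u \<in> sphere 0 1 \<Longrightarrow> 0 < f u"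
  obtains a b where "0 < a" "0 < b" "\<And>u. u \<in> sphere 0 1 \<Longrightarrow> a \<le> f u powr p"
    "\<And>u. u \<in> sphere 0 1 \<Longrightarrow> f u powr p \<le> b" "continuous_on (sphere 0 1) (\<lambda>u. f u powr p)"
proof -
  have c: "continuous_on (sphere 0 1) (\<lambda>u. f u powr p)"
    using assms(2) by (intro continuous_intros assms(1)) force
  obtain u1 where u1: "u1 \<in> sphere 0 1" "\<And>u. u \<in> sphere 0 1 \<Longrightarrow> f u1 powr p \<le> f u powr p"
    using continuous_attains_inf[OF compact_sphere sphere_nonempty c] by blast
  obtain b where b: "0 < b" "\<And>u. u \<in> sphere 0 1 \<Longrightarrow> \<bar>f u powr p\<bar> \<le> b"
    using continuous_on_sphere_bounded[OF c] by blast
  show thesis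
  proof (rule that[of "f u1 powr p" b])
    show "0 < f u1 powr p" using assms(2)[OF u1(1)] by simp
    show "f u powr p \<le> b" if "u \<in> sphere 0 1" for u using b(2)[OF that] by simp
  qed (use u1 b c in auto)
qed

section \<open>Necessity: the dual curvature measure charges the complement of every great
  subsphere\<close>

text \<open>Around a direction orthogonal to \<open>\<xi>\<close> no outer normal lies in \<open>\<xi>\<close>.\<close>

lemma dual_curvature_measure_not_concentrated:
  fixes K Q :: "'a::euclidean_space set"
  assumes q: "0 < q" and Q: "star_body Q" and K: "convex_body K" "origin_symmetric K"
    and \<xi>: "subspace \<xi>" "\<xi> \<noteq> UNIV"
  shows "0 < dual_curvature_measure q K Q (sphere 0 1 - \<xi>)"
proof -
  obtain r where r: "0 < r" "cball 0 r \<subseteq> K" using zero_interior_symmetric_convex_body[OF K] .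
  have "0 \<in> cball (0::'a) r" using r(1) by simp
  then have K0: "0 \<in> K" using r(2) by blast
  have Kc: "compact K" using K(1) by (simp add: convex_body_def)
  obtain R where R: "0 < R" "\<And>x. x \<in> K \<Longrightarrow> norm x \<le> R"
    using compact_imp_bounded[OF Kc] by (auto simp: bounded_pos)
  have "dim \<xi> < DIM('a)"
  proof -
    have "dim \<xi> \<noteq> DIM('a)" using \<xi> dim_eq_full[of \<xi>] span_eq_iff by metis
    then show ?thesis using dim_subset_UNIV[of \<xi>] by simp
  qed
  then obtain v0 where v0: "v0 \<noteq> 0" "\<And>y. y \<in> span \<xi> \<Longrightarrow> orthogonal v0 y"
    using orthogonal_to_subspace_exists by blast
  define v where "v = sgn v0"
  have v: "norm v = 1" using v0(1) by (simp add: v_def norm_sgn)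
  have v_orth: "v \<bullet> y = 0" if "y \<in> \<xi>" for y
    using v0(2)[OF span_base[OF that]] by (simp add: v_def sgn_div_norm orthogonal_def)
  \<comment> \<open>With r an inner and R an outer radius of \<open>K\<close>, a normal w in \<xi>
    at the boundary point x in direction u would give x . w \<ge> r, from the inner ball. But w is
    orthogonal to v, so x . w is at most R times the length of the component of u orthogonal to v,
    which is less than r on \<open>U\<close>.\<close>
  define U where "U = {u. norm (u - (u \<bullet> v) *\<^sub>R v) < r / R}"
  have Uo: "open U" unfolding U_def by (intro open_Collect_less continuous_intros)
  have vU: "v \<in> U" using v r R by (simp add: U_def norm_eq_1)
  have rK: "r \<le> radial_function K u" if "u \<in> sphere 0 1" for u
    by (rule radial_function_attained(2)[OF Kc K0 that]) (use r that in \<open>auto simp: subset_iff\<close>)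
  have sub: "u \<in> reverse_radial_gauss_image K (sphere 0 1 - \<xi>)" if u: "u \<in> sphere 0 1" "u \<in> U" for u
  proof -
    let ?x = "radial_function K u *\<^sub>R u"
    have x: "?x \<in> frontier K" by (rule radial_function_frontier[OF Kc K0 u(1)])
    then obtain w where w: "outer_unit_normal K ?x w" using frontier_outer_unit_normal[OF K(1)] by metis
    then have w1: "norm w = 1" by (simp add: outer_unit_normal_def)
    have "w \<notin> \<xi>"
    proof
      assume "w \<in> \<xi>"
      then have wv: "v \<bullet> w = 0" by (rule v_orth)
      have "r *\<^sub>R w \<in> K" using r w1 by (auto simp: subset_iff)
      then have "(r *\<^sub>R w) \<bullet> w \<le> ?x \<bullet> w" using w by (auto simp: outer_unit_normal_def)
      then have "r \<le> radial_function K u * (u \<bullet> w)" using w1 by (simp add: norm_eq_1)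
      also have "u \<bullet> w = (u - (u \<bullet> v) *\<^sub>R v) \<bullet> w" using wv by (simp add: inner_diff_left)
      also have "radial_function K u * \<dots> \<le> R * norm (u - (u \<bullet> v) *\<^sub>R v)"
      proof -
        have "radial_function K u \<le> R"
          using R(2)[OF radial_function_attained(1)[OF Kc K0 u(1)]] u(1) by simp
        moreover have "(u - (u \<bullet> v) *\<^sub>R v) \<bullet> w \<le> norm (u - (u \<bullet> v) *\<^sub>R v)"
          using norm_cauchy_schwarz[of "u - (u \<bullet> v) *\<^sub>R v" w] w1 by simp
        ultimately show ?thesis
          using rK[OF u(1)] r(1) R(1)
          by (meson mult_mono' mult_left_mono mult_right_mono norm_ge_zero order_trans less_imp_le)
      qed
      also have "\<dots> < R * (r / R)" using u(2) R(1) by (intro mult_strict_left_mono) (auto simp: U_def)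
      finally show False using R(1) by simp
    qed
    then show ?thesis
      using u(1) x w w1 by (auto simp: reverse_radial_gauss_image_def inverse_gauss_image_def)
  qed
  obtain a where a: "0 < a" "\<And>u. u \<in> sphere 0 1 \<Longrightarrow> a \<le> radial_function Q u powr (real DIM('a) - q)"
    using powr_bounds_sphere[where f = "radial_function Q" and p = "real DIM('a) - q"] Q
    unfolding star_body_def by metis
  have sU: "sphere 0 1 \<inter> U \<in> sets sphere_borel"
    using Uo by (auto simp: sets_sphere_borel_iff borel_closed borel_open)
  let ?I = "\<lambda>u. ennreal (radial_function K u powr q * radial_function Q u powr (real DIM('a) - q))"
  have "0 < ennreal (r powr q * a) * emeasure sphere_measure (sphere 0 1 \<inter> U)"
    using emeasure_sphere_measure_open_pos[OF Uo vU] v r(1) a(1) by (simp add: ennreal_zero_less_mult_iff)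
  also have "\<dots> = (\<integral>\<^sup>+u. ennreal (r powr q * a) * indicator (sphere 0 1 \<inter> U) u \<partial>sphere_measure)"
    using sU by (simp add: nn_integral_cmult_indicator)
  also have "\<dots> \<le> (\<integral>\<^sup>+u\<in>reverse_radial_gauss_image K (sphere 0 1 - \<xi>). ?I u \<partial>sphere_measure)"
  proof (rule nn_integral_mono)
    fix u :: 'a
    show "ennreal (r powr q * a) * indicator (sphere 0 1 \<inter> U) u \<le>
      ?I u * indicator (reverse_radial_gauss_image K (sphere 0 1 - \<xi>)) u"
    proof (cases "u \<in> sphere 0 1 \<inter> U")
      case True
      then have "r powr q * a \<le> radial_function K u powr q * radial_function Q u powr (real DIM('a) - q)"
        using rK[of u] a r(1) q by (intro mult_mono powr_mono2) auto
      then show ?thesis using True sub[of u] by (simp add: ennreal_leI)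
    qed simp
  qed
  finally show ?thesis
    unfolding dual_curvature_measure_def surface_measure_eq nn_integral_completion
    by (subst ennreal_zero_less_mult_iff) simp
qed

section \<open>The Wulff shape as the body that solves the problem\<close>

text \<open>The Wulff shape of \<open>exp f\<close> is the unit ball of \<open>wulff_gauge f\<close>.\<close>

lemma wulff_shape_convex_body:
  fixes f :: "'a::euclidean_space \<Rightarrow> real"
  assumes f: "continuous_on (sphere 0 1) f" "\<And>v. v \<in> sphere 0 1 \<Longrightarrow> f (- v) = f v"
  shows "convex_body {x. wulff_gauge f x \<le> 1}" and "origin_symmetric {x. wulff_gauge f x \<le> 1}"
proof -
  let ?K = "{x. wulff_gauge f x \<le> 1}"
  obtain B where B: "0 < B" "\<And>v. v \<in> sphere 0 1 \<Longrightarrow> \<bar>f v\<bar> \<le> B"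
    using continuous_on_sphere_bounded[OF f(1)] by blast
  have "bounded ?K"
  proof (rule boundedI)
    fix x assume "x \<in> ?K"
    moreover have "exp (- B) * norm x \<le> wulff_gauge f x"
      by (rule wulff_gauge_ge_norm[OF f(1)]) (use B in force)
    ultimately have "exp (- B) * norm x \<le> 1" by simp
    then show "norm x \<le> exp B" by (simp add: exp_minus field_simps)
  qed
  moreover have "closed ?K"
    by (intro closed_Collect_le continuous_intros continuous_on_wulff_gauge f)
  moreover have "convex ?K"
  proof (rule convexI)
    fix x y and s t :: real assume *: "x \<in> ?K" "y \<in> ?K" "0 \<le> s" "0 \<le> t" "s + t = 1"
    have "wulff_gauge f (s *\<^sub>R x + t *\<^sub>R y) \<le> s * wulff_gauge f x + t * wulff_gauge f y"
      using wulff_gauge_add[OF f(1), of "s *\<^sub>R x" "t *\<^sub>R y"] *(3,4) by (simp add: wulff_gauge_scale[OF f(1)])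
    also have "\<dots> \<le> s * 1 + t * 1" using * by (intro add_mono mult_left_mono) auto
    finally show "s *\<^sub>R x + t *\<^sub>R y \<in> ?K" using *(5) by simp
  qed
  moreover have "0 \<in> interior ?K"
  proof (rule interiorI)
    show "open {x. wulff_gauge f x < 1}"
      by (intro open_Collect_less continuous_intros continuous_on_wulff_gauge f)
  qed (auto simp: f)
  ultimately show "convex_body ?K" by (auto simp: convex_body_def compact_eq_bounded_closed)
  show "origin_symmetric ?K"
    unfolding origin_symmetric_def
  proof (intro set_eqI iffI)
    fix x assume "x \<in> ?K"
    then have "- x \<in> ?K" using wulff_gauge_uminus[OF f, of x] by simp
    then show "x \<in> uminus ` ?K" by (metis image_eqI minus_minus)
  next
    fix x assume "x \<in> uminus ` ?K"
    then obtain y where "y \<in> ?K" "x = - y" by blast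
    then show "x \<in> ?K" using wulff_gauge_uminus[OF f, of y] by simp
  qed
qed

lemma radial_function_wulff_shape:
  fixes f :: "'a::euclidean_space \<Rightarrow> real"
  assumes f: "continuous_on (sphere 0 1) f" and u: "u \<in> sphere 0 1"
  shows "radial_function {x. wulff_gauge f x \<le> 1} u = 1 / wulff_gauge f u"
  unfolding radial_function_def
proof (rule cSup_eq_maximum)
  have "u \<noteq> 0" using u by auto
  then have p: "0 < wulff_gauge f u" by (rule wulff_gauge_pos[OF f])
  then show "1 / wulff_gauge f u \<in> {t. t *\<^sub>R u \<in> {x. wulff_gauge f x \<le> 1}}"
    by (simp add: wulff_gauge_scale[OF f])
  fix t assume "t \<in> {t. t *\<^sub>R u \<in> {x. wulff_gauge f x \<le> 1}}"
  then have t: "wulff_gauge f (t *\<^sub>R u) \<le> 1" by simp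
  show "t \<le> 1 / wulff_gauge f u"
  proof (cases "0 \<le> t")
    case True
    then show ?thesis using t p by (simp add: wulff_gauge_scale[OF f] field_simps)
  next
    case False
    moreover have "0 \<le> 1 / wulff_gauge f u" using p by simp
    ultimately show ?thesis by linarith
  qed
qed

text \<open>An outer normal v at the boundary point x in direction u, divided by x . v, is a
  subgradient of the gauge at u. At a smooth point there is only one, so the normal is the maximiser
  selected by \<open>radial_gauss_map\<close>.\<close>

lemma reverse_radial_gauss_image_wulff_shape:
  fixes f :: "'a::euclidean_space \<Rightarrow> real"
  assumes f: "continuous_on (sphere 0 1) f" "\<And>v. v \<in> sphere 0 1 \<Longrightarrow> f (- v) = f v"
    and u: "u \<in> sphere 0 1" "u \<in> smooth_points (wulff_gauge f)" and A: "A \<subseteq> sphere 0 1"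
  shows "u \<in> reverse_radial_gauss_image {x. wulff_gauge f x \<le> 1} A \<longleftrightarrow> radial_gauss_map f u \<in> A"
proof -
  let ?K = "{x. wulff_gauge f x \<le> 1}" and ?N = "wulff_gauge f"
  have "u \<noteq> 0" using u by auto
  then have p: "0 < ?N u" by (rule wulff_gauge_pos[OF f(1)])
  define x where "x = (1 / ?N u) *\<^sub>R u"
  have Kc: "compact ?K" and K0: "0 \<in> ?K"
    using wulff_shape_convex_body(1)[OF f] f(1) by (auto simp: convex_body_def)
  have xeq: "radial_function ?K u *\<^sub>R u = x"
    by (simp add: x_def radial_function_wulff_shape[OF f(1) u(1)])
  have xf: "x \<in> frontier ?K" using radial_function_frontier[OF Kc K0 u(1)] xeq by simp
  let ?a = "radial_gauss_map f u"
  note a = radial_gauss_map_smooth[OF f(1) u(2)]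
  have xa: "(x \<bullet> ?a) * exp (- f ?a) = 1" using a(2) p by (simp add: x_def)
  have normal: "outer_unit_normal ?K x ?a"
    unfolding outer_unit_normal_def
  proof (intro conjI ballI)
    show "norm ?a = 1" using a(1) by simp
    fix y assume "y \<in> ?K"
    then have "(y \<bullet> ?a) * exp (- f ?a) \<le> (x \<bullet> ?a) * exp (- f ?a)"
      using wulff_gauge_ge[OF f(1) a(1), of y] xa by simp
    then show "y \<bullet> ?a \<le> x \<bullet> ?a" by simp
  qed
  have unique: "v = ?a" if v: "outer_unit_normal ?K x v" for v
  proof -
    have v1: "norm v = 1" and le: "\<And>y. y \<in> ?K \<Longrightarrow> y \<bullet> v \<le> x \<bullet> v" using v by (auto simp: outer_unit_normal_def)
    have "v \<noteq> 0" using v1 by auto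
    then have Nv: "0 < ?N v" by (rule wulff_gauge_pos[OF f(1)])
    \<comment> \<open>Testing the normal v against the boundary point in its own direction shows
      that x . v is positive, so that dividing by it makes sense.\<close>
    have "inverse (?N v) *\<^sub>R v \<in> ?K" using Nv by (simp add: wulff_gauge_scale[OF f(1)])
    from le[OF this] have "inverse (?N v) \<le> x \<bullet> v" using v1 by (simp add: norm_eq_1)
    then have xv: "0 < x \<bullet> v" using Nv by (meson less_le_trans positive_imp_inverse_positive)
    have "inverse (x \<bullet> v) *\<^sub>R v = exp (- f ?a) *\<^sub>R ?a"
    proof (rule smooth_points_unique_subgradient[OF u(2)])
      have "u \<bullet> v = ?N u * (x \<bullet> v)" using p by (simp add: x_def)
      then show "(inverse (x \<bullet> v) *\<^sub>R v) \<bullet> u = ?N u" using xv by (simp add: inner_commute)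
      show "(exp (- f ?a) *\<^sub>R ?a) \<bullet> u = ?N u" using a(2) by (simp add: inner_commute mult.commute)
      fix y
      show "(exp (- f ?a) *\<^sub>R ?a) \<bullet> y \<le> ?N y"
        using wulff_gauge_ge[OF f(1) a(1), of y] by (simp add: inner_commute mult.commute)
      show "(inverse (x \<bullet> v) *\<^sub>R v) \<bullet> y \<le> ?N y"
      proof (cases "y = 0")
        case False
        then have py: "0 < ?N y" by (rule wulff_gauge_pos[OF f(1)])
        then have "inverse (?N y) *\<^sub>R y \<in> ?K" by (simp add: wulff_gauge_scale[OF f(1)])
        from le[OF this] show ?thesis using py xv by (simp add: inner_commute field_simps)
      qed (simp add: f)
    qed
    moreover from this have "norm (inverse (x \<bullet> v) *\<^sub>R v) = norm (exp (- f ?a) *\<^sub>R ?a)" by simp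
    then have "inverse (x \<bullet> v) = exp (- f ?a)" using v1 a(1) xv by simp
    ultimately show ?thesis using xv by simp
  qed
  have "u \<in> reverse_radial_gauss_image ?K A \<longleftrightarrow> (\<exists>v\<in>A. outer_unit_normal ?K x v)"
    using u(1) xf xeq by (simp only: reverse_radial_gauss_image_def inverse_gauss_image_def mem_Collect_eq simp_thms)
  also have "\<dots> \<longleftrightarrow> ?a \<in> A" using normal unique by blast
  finally show ?thesis .
qed

text \<open>The radial function of Q is continuous and positive on a compact set, so the weight lies
  between positive constants and the requirements on \<open>M\<close> reduce to facts about
  \<open>sphere_measure\<close>. Every proper subspace lies in a hyperplane, which is why the locale
  expresses non-concentration through unit vectors.\<close>

lemma dual_minkowski_density:
  fixes Q :: "'a::euclidean_space set" and \<mu> :: "'a measure"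
  assumes q: "0 < q" "q \<le> 1" and Q: "star_body Q" "origin_symmetric Q"
    and mu: "sets \<mu> = sets sphere_borel" "finite_measure \<mu>" "even_measure \<mu>"
    and nc: "\<not> (\<exists>S. great_subsphere S \<and> concentrated_on \<mu> S)"
  shows "dual_minkowski (density sphere_measure
    (\<lambda>u. ennreal (radial_function Q u powr (real DIM('a) - q) / real DIM('a)))) \<mu> q"
proof -
  let ?n = "real DIM('a)"
  define w where "w u = radial_function Q u powr (?n - q) / ?n" for u
  obtain a b where ab: "0 < a" "0 < b" "\<And>u. u \<in> sphere 0 1 \<Longrightarrow> a \<le> radial_function Q u powr (?n - q)"
    "\<And>u. u \<in> sphere 0 1 \<Longrightarrow> radial_function Q u powr (?n - q) \<le> b"
    and c: "continuous_on (sphere 0 1) (\<lambda>u. radial_function Q u powr (?n - q))"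
    using powr_bounds_sphere[where f = "radial_function Q" and p = "?n - q"] Q(1)
    unfolding star_body_def by metis
  have w: "a / ?n \<le> w u" "w u \<le> b / ?n" if "u \<in> sphere 0 1" for u
    using ab(3,4)[OF that] by (simp_all add: w_def divide_right_mono)
  have wc: "continuous_on (sphere 0 1) w" unfolding w_def by (intro continuous_intros c) auto
  have wm: "(\<lambda>u. ennreal (w u)) \<in> borel_measurable sphere_borel"
    using borel_measurable_sphere_continuous[OF wc] by simp
  then have wm': "(\<lambda>u. ennreal (w u)) \<in> borel_measurable sphere_measure"
    unfolding measurable_cong_sets[OF sets_sphere_measure refl] .
  let ?M = "density sphere_measure (\<lambda>u. ennreal (w u))"
  interpret s: finite_measure "sphere_measure :: 'a measure" by (rule finite_measure_sphere_measure)
  have int: "(\<integral>\<^sup>+u. \<phi> u \<partial>?M) = (\<integral>\<^sup>+u. ennreal (w u) * \<phi> u \<partial>sphere_measure)"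
    if "\<phi> \<in> borel_measurable sphere_borel" for \<phi>
    by (rule nn_integral_density[OF wm']) (use that in \<open>simp add: measurable_cong_sets[OF sets_sphere_measure refl]\<close>)
  have int_le: "(\<integral>\<^sup>+u. \<phi> u \<partial>?M) \<le> ennreal (b / ?n) * (\<integral>\<^sup>+u. \<phi> u \<partial>sphere_measure)"
    if \<phi>: "\<phi> \<in> borel_measurable sphere_borel" for \<phi>
  proof -
    have "(\<integral>\<^sup>+u. ennreal (w u) * \<phi> u \<partial>sphere_measure) \<le> (\<integral>\<^sup>+u. ennreal (b / ?n) * \<phi> u \<partial>sphere_measure)"
      using w(2) by (intro nn_integral_mono mult_right_mono ennreal_leI) auto
    also have "\<dots> = ennreal (b / ?n) * (\<integral>\<^sup>+u. \<phi> u \<partial>sphere_measure)"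
      by (rule nn_integral_cmult) (use \<phi> in \<open>simp add: measurable_cong_sets[OF sets_sphere_measure refl]\<close>)
    finally show ?thesis by (simp add: int[OF \<phi>])
  qed
  have sph: "sphere (0::'a) 1 \<in> sets sphere_borel" by (simp add: sets_sphere_borel_iff)
  have "dual_minkowski ?M \<mu> q"
  proof (rule dual_minkowski.intro)
    show "0 < q" "q \<le> 1" by (fact q)+
    show "sets ?M = sets sphere_borel" by simp
    show "finite_measure ?M"
    proof
      have fin: "emeasure sphere_measure (sphere (0::'a) 1) < top"
        using s.emeasure_finite[of "sphere 0 1"]
        by (simp only: infinity_ennreal_def top.not_eq_extremum)
      have "emeasure ?M (space ?M) = (\<integral>\<^sup>+u. 1 \<partial>?M)" by simp
      also have "\<dots> \<le> ennreal (b / ?n) * (\<integral>\<^sup>+(u::'a). 1 \<partial>sphere_measure)" by (rule int_le) simp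
      also have "\<dots> < \<infinity>" using fin by (simp add: ennreal_mult_less_top)
      finally show "emeasure ?M (space ?M) \<noteq> \<infinity>" by simp
    qed
    show "emeasure ?M (sphere 0 1) \<noteq> 0"
    proof -
      obtain u :: 'a where u: "u \<in> sphere 0 1" using sphere_nonempty by blast
      have "0 < ennreal (a / ?n) * emeasure sphere_measure (sphere (0::'a) 1)"
        using emeasure_sphere_measure_open_pos[OF open_UNIV UNIV_I u] ab(1)
        by (simp add: ennreal_zero_less_mult_iff)
      also have "\<dots> = (\<integral>\<^sup>+u. ennreal (a / ?n) * indicator (sphere (0::'a) 1) u \<partial>sphere_measure)"
        using sph by (simp add: nn_integral_cmult_indicator)
      also have "\<dots> \<le> (\<integral>\<^sup>+u. ennreal (w u) * indicator (sphere 0 1) u \<partial>sphere_measure)"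
        using w(1) by (intro nn_integral_mono mult_right_mono ennreal_leI) auto
      also have "\<dots> = emeasure ?M (sphere 0 1)"
        by (rule emeasure_density[symmetric, OF wm']) (simp add: sph)
      finally show ?thesis by simp
    qed
    show "(\<integral>\<^sup>+u. \<phi> (- u) \<partial>?M) = (\<integral>\<^sup>+u. \<phi> u \<partial>?M)" if \<phi>: "\<phi> \<in> borel_measurable sphere_borel" for \<phi>
    proof -
      have \<phi>': "(\<lambda>u. \<phi> (- u)) \<in> borel_measurable sphere_borel"
        using measurable_compose[OF measurable_uminus_sphere_borel \<phi>] .
      have "w (- u) = w u" for u by (simp add: w_def radial_function_uminus[OF Q(2)])
      then have "(\<integral>\<^sup>+u. \<phi> (- u) \<partial>?M) = (\<integral>\<^sup>+u. ennreal (w (- u)) * \<phi> (- u) \<partial>sphere_measure)"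
        by (simp add: int[OF \<phi>'])
      also have "\<dots> = (\<integral>\<^sup>+u. ennreal (w u) * \<phi> u \<partial>sphere_measure)"
        by (rule nn_integral_sphere_measure_uminus) (use wm \<phi> in simp)
      finally show ?thesis by (simp add: int[OF \<phi>])
    qed
    show "AE u in ?M. u \<in> A" if "A \<in> sets borel" "\<And>c x. 0 < c \<Longrightarrow> x \<in> A \<Longrightarrow> c *\<^sub>R x \<in> A"
      "AE x in lborel. x \<in> A" for A
    proof -
      have "AE u in sphere_measure. u \<in> A" by (rule AE_sphere_measure_cone[OF that])
      then show ?thesis unfolding AE_density[OF wm'] by eventually_elim simp
    qed
    show "\<exists>C>0. \<forall>v \<epsilon>. norm v = 1 \<longrightarrow> 0 < \<epsilon> \<longrightarrow>
        (\<integral>\<^sup>+u. ennreal (max \<epsilon> \<bar>u \<bullet> v\<bar> powr (- s)) \<partial>?M) \<le> ennreal C" if s: "0 < s" "s < 1" for s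
    proof -
      obtain C where C: "0 < C" "\<And>v \<epsilon>. norm (v::'a) = 1 \<Longrightarrow> 0 < \<epsilon> \<Longrightarrow>
        (\<integral>\<^sup>+u. ennreal (max \<epsilon> \<bar>u \<bullet> v\<bar> powr (- s)) \<partial>sphere_measure) \<le> ennreal C"
        using nn_integral_sphere_max_powr_le[OF s] by blast
      have "(\<integral>\<^sup>+u. ennreal (max \<epsilon> \<bar>u \<bullet> v\<bar> powr (- s)) \<partial>?M) \<le> ennreal (b / ?n * C)"
        if "norm v = 1" "0 < \<epsilon>" for v :: 'a and \<epsilon>
      proof -
        have "(\<integral>\<^sup>+u. ennreal (max \<epsilon> \<bar>u \<bullet> v\<bar> powr (- s)) \<partial>?M) \<le>
          ennreal (b / ?n) * (\<integral>\<^sup>+u. ennreal (max \<epsilon> \<bar>u \<bullet> v\<bar> powr (- s)) \<partial>sphere_measure)"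
          by (rule int_le) (intro borel_measurable_sphere_borel, measurable)
        also have "\<dots> \<le> ennreal (b / ?n) * ennreal C" by (intro mult_left_mono C that) auto
        also have "\<dots> = ennreal (b / ?n * C)"
          by (rule ennreal_mult[symmetric]) (use ab(2) C(1) in auto)
        finally show ?thesis .
      qed
      then show ?thesis using ab(2) C(1) by (intro exI[of _ "b / ?n * C"]) auto
    qed
    show "sets \<mu> = sets sphere_borel" "finite_measure \<mu>" by (fact mu)+
    show "emeasure \<mu> (uminus ` A) = emeasure \<mu> A" if "A \<in> sets sphere_borel" for A
      using mu(1,3) that by (simp add: even_measure_def)
    show "\<not> (AE v in \<mu>. x \<bullet> v = 0)" if x: "x \<in> sphere 0 1" for x
    proof
      assume AE: "AE v in \<mu>. x \<bullet> v = 0"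
      let ?\<xi> = "{v. x \<bullet> v = 0}"
      have sp: "space \<mu> = sphere 0 1" using sets_eq_imp_space_eq[OF mu(1)] by simp
      have "closed ?\<xi>" by (intro closed_Collect_eq continuous_intros)
      then have m: "sphere 0 1 - ?\<xi> \<in> sets \<mu>"
        by (auto simp: mu(1) sets_sphere_borel_iff borel_closed)
      have "x \<notin> ?\<xi>" using x by auto
      then have "great_subsphere (sphere 0 1 \<inter> ?\<xi>)"
        unfolding great_subsphere_def using subspace_hyperplane[of x] by blast
      moreover have "sphere 0 1 - sphere 0 1 \<inter> ?\<xi> = sphere 0 1 - ?\<xi>" by blast
      with m AE AE_iff_measurable[OF m, of "\<lambda>v. x \<bullet> v = 0"]
      have "concentrated_on \<mu> (sphere 0 1 \<inter> ?\<xi>)"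
        by (simp add: concentrated_on_def sp set_diff_eq)
      ultimately show False using nc by blast
    qed
  qed
  then show ?thesis unfolding w_def .
qed

theorem theorem1p2:
  fixes q :: real and Q :: "(real ^ 'n) set" and \<mu> :: "(real ^ 'n) measure"
  assumes "0 < q" and "q \<le> 1"
    and "star_body Q" and "origin_symmetric Q"
    and "sets \<mu> = sets sphere_borel" and "finite_measure \<mu>" and "even_measure \<mu>"
  shows "(\<exists>K :: (real ^ 'n) set. convex_body K \<and> origin_symmetric K \<and>
            (\<forall>\<eta>\<in>sets sphere_borel. dual_curvature_measure q K Q \<eta> = emeasure \<mu> \<eta>))
     \<longleftrightarrow> \<not> (\<exists>S. great_subsphere S \<and> concentrated_on \<mu> S)"
proof
  assume "\<exists>K :: (real ^ 'n) set. convex_body K \<and> origin_symmetric K \<and>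
            (\<forall>\<eta>\<in>sets sphere_borel. dual_curvature_measure q K Q \<eta> = emeasure \<mu> \<eta>)"
  then obtain K :: "(real ^ 'n) set" where K: "convex_body K" "origin_symmetric K"
    and eq: "\<And>\<eta>. \<eta> \<in> sets sphere_borel \<Longrightarrow> dual_curvature_measure q K Q \<eta> = emeasure \<mu> \<eta>" by blast
  show "\<not> (\<exists>S. great_subsphere S \<and> concentrated_on \<mu> S)"
  proof
    assume "\<exists>S. great_subsphere S \<and> concentrated_on \<mu> S"
    then obtain \<xi> where \<xi>: "subspace \<xi>" "\<xi> \<noteq> UNIV" "concentrated_on \<mu> (sphere 0 1 \<inter> \<xi>)"
      by (auto simp: great_subsphere_def)
    have "sphere 0 1 - \<xi> \<in> sets sphere_borel"
      using closed_subspace[OF \<xi>(1)] by (auto simp: sets_sphere_borel_iff borel_closed)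
    moreover have "sphere 0 1 - sphere 0 1 \<inter> \<xi> = sphere 0 1 - \<xi>" by blast
    ultimately have "dual_curvature_measure q K Q (sphere 0 1 - \<xi>) = 0"
      using eq \<xi>(3) by (simp add: concentrated_on_def)
    with dual_curvature_measure_not_concentrated[OF assms(1,3) K \<xi>(1,2)] show False by simp
  qed
next
  assume nc: "\<not> (\<exists>S. great_subsphere S \<and> concentrated_on \<mu> S)"
  let ?n = "real DIM(real ^ 'n)"
  let ?w = "\<lambda>u. radial_function Q u powr (?n - q)"
  interpret dual_minkowski "density sphere_measure (\<lambda>u. ennreal (?w u / ?n))" \<mu> q
    by (rule dual_minkowski_density[OF assms nc])
  obtain f where f: "continuous_on (sphere 0 1) f" "\<And>v. v \<in> sphere 0 1 \<Longrightarrow> f (- v) = f v"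
    and em: "\<And>A. A \<in> sets sphere_borel \<Longrightarrow> emeasure \<mu> A =
       (\<integral>\<^sup>+u. ennreal (wulff_gauge f u powr (- q)) * indicator A (radial_gauss_map f u)
         \<partial>density sphere_measure (\<lambda>u. ennreal (?w u / ?n)))"
    using dual_minkowski_solution by blast
  let ?K = "{x. wulff_gauge f x \<le> 1}"
  have wc: "continuous_on (sphere 0 1) ?w"
    using assms(3) unfolding star_body_def by (intro continuous_intros) force+
  have wm: "(\<lambda>u. ennreal (?w u / ?n)) \<in> borel_measurable sphere_measure" "(\<lambda>u. ennreal (?w u)) \<in> borel_measurable sphere_measure"
    unfolding measurable_cong_sets[OF sets_sphere_measure refl]
    using borel_measurable_sphere_continuous[OF wc] by simp_all
  have "dual_curvature_measure q ?K Q A = emeasure \<mu> A" if A: "A \<in> sets sphere_borel" for A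
  proof -
    let ?\<phi> = "\<lambda>u. ennreal (wulff_gauge f u powr (- q)) * indicator A (radial_gauss_map f u)"
    have "(\<lambda>u. indicator A (radial_gauss_map f u) :: ennreal) \<in> borel_measurable sphere_borel"
      using measurable_compose[OF measurable_radial_gauss_map[OF f(1)], of "indicator A" borel] A by simp
    then have \<phi>m: "?\<phi> \<in> borel_measurable sphere_measure"
      unfolding measurable_cong_sets[OF sets_sphere_measure refl]
      using borel_measurable_sphere_continuous[OF continuous_on_gauge_powr[OF f(1), of "- q"]] by simp
    \<comment> \<open>The locale gives smoothness almost everywhere for the weighted measure;
      positivity of the weight returns it to \<open>sphere_measure\<close>.\<close>
    have AE: "AE u in sphere_measure. u \<in> sphere 0 1 \<and> u \<in> smooth_points (wulff_gauge f)"
    proof -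
      have "AE u in density sphere_measure (\<lambda>u. ennreal (?w u / ?n)). u \<in> smooth_points (wulff_gauge f)"
        by (rule AE_smooth_points_wulff_gauge[OF f(1)])
      then have "AE u in sphere_measure. 0 < ennreal (?w u / ?n) \<longrightarrow> u \<in> smooth_points (wulff_gauge f)"
        by (simp only: AE_density[OF wm(1)])
      then show ?thesis
        using AE_space
      proof eventually_elim
        case (elim u)
        then have "radial_function Q u > 0" using assms(3) by (simp add: star_body_def)
        with elim show ?case by simp
      qed
    qed
    have "dual_curvature_measure q ?K Q A = ennreal (1 / ?n) *
      (\<integral>\<^sup>+u\<in>reverse_radial_gauss_image ?K A. ennreal (radial_function ?K u powr q * ?w u) \<partial>sphere_measure)"
      unfolding dual_curvature_measure_def surface_measure_eq nn_integral_completion ..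
    also have "(\<integral>\<^sup>+u\<in>reverse_radial_gauss_image ?K A. ennreal (radial_function ?K u powr q * ?w u) \<partial>sphere_measure) =
      (\<integral>\<^sup>+u. ennreal (?w u) * ?\<phi> u \<partial>sphere_measure)"
    \<comment> \<open>The reverse radial Gauss image need not be Borel, but on smooth directions it
      agrees with the preimage of \<open>A\<close> under \<open>radial_gauss_map\<close>; almost
      everywhere equality suffices for the nonnegative integral.\<close>
    proof (rule nn_integral_cong_AE)
      show "AE u in sphere_measure. ennreal (radial_function ?K u powr q * ?w u) *
          indicator (reverse_radial_gauss_image ?K A) u = ennreal (?w u) * ?\<phi> u"
        using AE
      proof eventually_elim
        case (elim u)
        have "u \<noteq> 0" using elim by auto
        then have p: "0 < wulff_gauge f u" by (rule wulff_gauge_pos[OF f(1)])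
        have "u \<in> reverse_radial_gauss_image ?K A \<longleftrightarrow> radial_gauss_map f u \<in> A"
          by (rule reverse_radial_gauss_image_wulff_shape[OF f])
             (use elim A in \<open>auto simp: sets_sphere_borel_iff\<close>)
        moreover have "radial_function ?K u powr q = wulff_gauge f u powr (- q)"
          using elim p by (simp add: radial_function_wulff_shape[OF f(1)] powr_divide powr_minus_divide)
        ultimately show ?case
          by (simp add: indicator_def ennreal_mult mult.commute)
      qed
    qed
    also have "ennreal (1 / ?n) * \<dots> = (\<integral>\<^sup>+u. ennreal (1 / ?n) * (ennreal (?w u) * ?\<phi> u) \<partial>sphere_measure)"
      by (rule nn_integral_cmult[symmetric]) (use wm(2) \<phi>m in simp)
    also have "\<dots> = (\<integral>\<^sup>+u. ennreal (?w u / ?n) * ?\<phi> u \<partial>sphere_measure)"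
      by (intro nn_integral_cong) (simp add: ennreal_mult[symmetric] mult.assoc[symmetric])
    also have "\<dots> = emeasure \<mu> A"
      unfolding em[OF A] by (rule nn_integral_density[symmetric, OF wm(1) \<phi>m])
    finally show ?thesis .
  qed
  then show "\<exists>K :: (real ^ 'n) set. convex_body K \<and> origin_symmetric K \<and>
            (\<forall>\<eta>\<in>sets sphere_borel. dual_curvature_measure q K Q \<eta> = emeasure \<mu> \<eta>)"
    using wulff_shape_convex_body[OF f] by blast
qed

end
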